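(* Let $n,n',d$ be positive integers and let $1\le p,q\le\infty$. For functions $f(x,y)$ on $\mathbb{R}^n\times\mathbb{R}^{n'}$ and $u=(u_\alpha)_{\alpha\in M_{n,d}}\in(\mathbb{R}^{n'})^{M_{n,d}}$ let $$T_{n,n',d}f(u):=\int_{\mathbb{R}^n} f\Big(t,\sum_{\alpha\in M_{n,d}}u_\alpha t^\alpha\Big)\,dt .$$ (i) The operator $T_{n,n',d}$ maps $L^p(\mathbb{R}^n\times\mathbb{R}^{n'})$ boundedly to $L^q((\mathbb{R}^{n'})^{M_{n,d}})$ if and only if $p=1+\frac{n'd}{n+1}$ and $q=|M_{n,d}|\,p$, where $|M_{n,d}|=\binom{n+d}{d}=\frac{(n+d)!}{n!\,d!}$ is the number of multiindices of length $n$ and degree at most $d$. (ii) Furthermore, $T_{n,n',d}$ maps $L^p_{comp}\to L^q_{loc}$ if and only if $(p^{-1},q^{-1})$ is in the closed convex hull of the points $(0,0)$, $(1,1)$, $(0,1)$ and $$\left(\frac{n+1}{n+n'j+1},\ \binom{n+j}{j}^{-1}\frac{n+1}{n+n'j+1}\right)\qquad\text{for } j=1,\ldots,d.$$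
   Context: A multiindex of length $n$ is an $n$-tuple $\alpha=(\alpha_1,\ldots,\alpha_n)$ of nonnegative integers; its degree is $|\alpha|=\sum_j\alpha_j$, and $t^\alpha:=\prod_{j=1}^n t_j^{\alpha_j}$ for $t\in\mathbb{R}^n$. $M_{n,d}$ is the set of all multiindices of length $n$ and degree at most $d$. The space $(\mathbb{R}^{n'})^{M_{n,d}}$ carries Lebesgue measure $du$. "$T$ maps $L^p_{comp}\to L^q_{loc}$" means that for all compact sets $K\subset\mathbb{R}^n\times\mathbb{R}^{n'}$ and $K'\subset(\mathbb{R}^{n'})^{M_{n,d}}$ there is a finite constant $C_{K,K'}$ with $\|Tf\|_{L^q(K')}\le C_{K,K'}\|f\|_{L^p}$ for all $f\in L^p$ supported in $K$. *)

theory Defs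
  imports "HOL-Probability.Essential_Supremum"
begin

text \<open>
  Exponents range over \<open>ennreal\<close>, so that \<open>p = \<infinity>\<close> is allowed and \<open>inverse \<infinity> = 0\<close>.
  For \<open>p = \<infinity>\<close>, the definition of \<^const>\<open>esssup\<close> assigns \<open>\<infinity>\<close> to non-measurable functions;
  measurability is demanded separately in \<open>Lp\<close>.
\<close>

definition Lp_norm :: "'a measure \<Rightarrow> ennreal \<Rightarrow> ('a \<Rightarrow> complex) \<Rightarrow> ennreal" where
  "Lp_norm M p f =
     (if p = \<infinity> then esssup M (\<lambda>x. ennreal (norm (f x)))
      else let I = (\<integral>\<^sup>+ x. ennreal (norm (f x) powr enn2real p) \<partial>M)
           in if I = \<infinity> then \<infinity> else ennreal (enn2real I powr (1 / enn2real p)))"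

definition Lp :: "'a measure \<Rightarrow> ennreal \<Rightarrow> ('a \<Rightarrow> complex) set" where
  "Lp M p = {f \<in> borel_measurable M. Lp_norm M p f < \<infinity>}"

definition multiindices :: "nat \<Rightarrow> (nat ^ 'n::finite) set" where
  "multiindices d = {\<alpha>. (\<Sum>j\<in>UNIV. \<alpha> $ j) \<le> d}"

lemma finite_multiindices: "finite (multiindices d :: (nat ^ 'n::finite) set)"
proof (rule finite_subset)
  show "(multiindices d :: (nat ^ 'n) set) \<subseteq> vec_lambda ` (PiE UNIV (\<lambda>_. {..d}))"
  proof
    fix \<alpha> :: "nat ^ 'n" assume "\<alpha> \<in> multiindices d"
    then have "\<alpha> $ j \<le> d" for j
      using member_le_sum[of j UNIV "\<lambda>j. \<alpha> $ j"] by (auto simp: multiindices_def)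
    then have "vec_nth \<alpha> \<in> PiE UNIV (\<lambda>_. {..d})"
      by auto
    then show "\<alpha> \<in> vec_lambda ` (PiE UNIV (\<lambda>_. {..d}))"
      by (metis imageI vec_nth_inverse)
  qed
qed (auto intro!: finite_imageI finite_PiE)

definition monomial :: "real ^ 'n::finite \<Rightarrow> nat ^ 'n \<Rightarrow> real" where
  "monomial t \<alpha> = (\<Prod>j\<in>UNIV. (t $ j) ^ (\<alpha> $ j))"

text \<open>
  The points of the coefficient space are families \<open>u\<close> of vectors indexed by \<open>multiindices d\<close>,
  represented, as usual for \<^const>\<open>PiM\<close>, by functions that are \<open>undefined\<close> off that index set.
  Its Lebesgue measure is the completion of the finite product of the measures \<^const>\<open>lborel\<close>.
\<close>

definition coeff_measure :: "nat \<Rightarrow> (nat ^ 'n::finite \<Rightarrow> real ^ 'm::finite) measure" where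
  "coeff_measure d = completion (Pi\<^sub>M (multiindices d) (\<lambda>_. lborel))"

definition coeff_topology :: "nat \<Rightarrow> (nat ^ 'n::finite \<Rightarrow> real ^ 'm::finite) topology" where
  "coeff_topology d = product_topology (\<lambda>_. euclidean) (multiindices d)"

definition graph_point ::
    "nat \<Rightarrow> (nat ^ 'n::finite \<Rightarrow> real ^ 'm::finite) \<Rightarrow> real ^ 'n \<Rightarrow> (real ^ 'n) \<times> (real ^ 'm)" where
  "graph_point d u t = (t, \<Sum>\<alpha>\<in>multiindices d. monomial t \<alpha> *\<^sub>R u \<alpha>)"

definition poly_radon ::
    "nat \<Rightarrow> ((real ^ 'n::finite) \<times> (real ^ 'm::finite) \<Rightarrow> complex) \<Rightarrow> (nat ^ 'n \<Rightarrow> real ^ 'm) \<Rightarrow> complex" where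
  "poly_radon d f u = (LINT t|lebesgue. f (graph_point d u t))"

text \<open>
  The Bochner integral of a non-integrable function is \<open>0\<close>. The boundedness notions below
  therefore require separately that the defining integral converges absolutely almost everywhere.
\<close>

definition poly_radon_defined ::
    "nat \<Rightarrow> ((real ^ 'n::finite) \<times> (real ^ 'm::finite) \<Rightarrow> complex) \<Rightarrow> (nat ^ 'n \<Rightarrow> real ^ 'm) \<Rightarrow> bool" where
  "poly_radon_defined d f u \<longleftrightarrow> integrable lebesgue (\<lambda>t. f (graph_point d u t))"

text \<open>
  The type arguments carry the two dimensions \<open>n = CARD('n)\<close> and \<open>n' = CARD('m)\<close>.
  Elements of \<open>L\<^sup>p\<close> are arbitrary Lebesgue measurable representatives, so the support
  condition is stated up to null sets.
\<close>

definition maps_Lp_Lq ::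
    "'n::finite itself \<Rightarrow> 'm::finite itself \<Rightarrow> nat \<Rightarrow> ennreal \<Rightarrow> ennreal \<Rightarrow> bool" where
  "maps_Lp_Lq _ _ d p q \<longleftrightarrow>
     (\<exists>C::real. \<forall>f \<in> Lp (lebesgue :: ((real ^ 'n) \<times> (real ^ 'm)) measure) p.
        (AE u in coeff_measure d. poly_radon_defined d f u) \<and>
        poly_radon d f \<in> Lp (coeff_measure d) q \<and>
        Lp_norm (coeff_measure d) q (poly_radon d f) \<le> ennreal C * Lp_norm lebesgue p f)"

definition maps_Lpcomp_Lqloc ::
    "'n::finite itself \<Rightarrow> 'm::finite itself \<Rightarrow> nat \<Rightarrow> ennreal \<Rightarrow> ennreal \<Rightarrow> bool" where
  "maps_Lpcomp_Lqloc _ _ d p q \<longleftrightarrow>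
     (\<forall>K K'. compact K \<longrightarrow> compactin (coeff_topology d) K' \<longrightarrow>
        (\<exists>C::real. \<forall>f \<in> Lp (lebesgue :: ((real ^ 'n) \<times> (real ^ 'm)) measure) p.
           (AE z in lebesgue. z \<notin> K \<longrightarrow> f z = 0) \<longrightarrow>
             (AE u in restrict_space (coeff_measure d) K'. poly_radon_defined d f u) \<and>
             poly_radon d f \<in> Lp (restrict_space (coeff_measure d) K') q \<and>
             Lp_norm (restrict_space (coeff_measure d) K') q (poly_radon d f)
               \<le> ennreal C * Lp_norm lebesgue p f))"

definition critical_point :: "nat \<Rightarrow> nat \<Rightarrow> nat \<Rightarrow> real \<times> real" where
  "critical_point n n' j =
     (let x = (real n + 1) / (real n + real n' * real j + 1)
      in (x, inverse (real ((n + j) choose j)) * x))"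

end

(*
  The estimate on L^p reduces to an inequality for each single polynomial map. Order the monomials
  phi_0, ..., phi_{N-1} lexicographically and, for g >= 0 on R^n, let delta_k be the infimum of the
  integrals of |P|^{n'} g^p over all P in phi_k + span(phi_i, i < k). Then
    (integral of g)^{Np} <= C * prod_k delta_k,                                          (1)
  while for g(t) = f(t, sum_alpha u_alpha t^alpha) the integral of prod_k delta_k over u is at most
  (integral of f^p)^N: bound delta_k from above by the polynomial produced by Gaussian elimination
  at points t_0, ..., t_{k-1}, average over the points, and change variables from the coefficients
  u to the values at the points t_k. The Jacobian is the product of the |P_k(t_k)|^{n'}.

  Inequality (1) follows from Hoelder's inequality and the bound
    |{t : |P_k(t)| <= eps_k for 1 <= k < N}| <= C * prod_k eps_k^theta,  theta = (n+1)/(Nd),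
  for P_k = phi_k + lower terms. It is proved by integrating out one variable at a time: as a
  polynomial in the leading variable, P_k has a leading coefficient of the same kind in the
  remaining variables, and these leading coefficients enter the next step as weights |Q|^{-theta}.

  The local estimates at the vertices with j < d follow by freezing the coefficients with
  |alpha| > j, and the remaining ones by interpolation. Necessity is tested on indicators of boxes.
*)
theory Submission
  imports Defs "HOL-Library.List_Lexorder" "HOL-Computational_Algebra.Fundamental_Theorem_Algebra"
begin

subsection \<open>Sublevel sets of polynomials in one variable\<close>

text \<open>The exponent \<open>\<theta>\<close> is forced. Over all multiindices of degree at most
  d each variable has total exponent Nd/(n+1), and the integration in that variable is critical
  exactly when \<open>\<theta>\<close> times this total is 1. Hoelder's inequality with exponent p
  calls for N\<theta> = n'/(p-1), and N\<theta> = (n+1)/d then gives p = 1 + n'd/(n+1). The obstacle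
  is uniformity: the constant in (1) must not depend on the lower coefficients, over which delta_k
  is an infimum. The lexicographic order serves this purpose, since monicity passes to the leading
  coefficient in each variable and ends at the constant 1; every coefficient met on the way is a
  weight that a later variable integrates. The infimum in turn gives freedom in the integration over
  u: any admissible polynomial bounds delta_k from above, and it may depend on auxiliary points.
  Elimination polynomials are the right choice because their values at the points are the pivots of
  the evaluation matrix. The weights |P_k|^{n'} then multiply to precisely the Jacobian of the
  passage from coefficients to values, and no determinant has to be estimated.\<close>

definition wt :: "real \<Rightarrow> real \<Rightarrow> ennreal" where
  "wt \<theta> r = (if r = 0 then \<infinity> else ennreal (\<bar>r\<bar> powr - \<theta>))"

lemma wt_pos: "wt \<theta> r \<noteq> 0"
  by (simp add: wt_def)

text \<open>The value \<open>\<infinity>\<close> at 0 is the limit of |r|^(-\<theta>) for positive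
  \<theta>, whereas \<open>powr\<close> would give 0 there. As \<open>wt\<close> never vanishes, no
  product of 0 and \<open>\<infinity>\<close> arises and multiplicativity holds without
  exception.\<close>

lemma wt_mult: "wt \<theta> (x * y) = wt \<theta> x * wt \<theta> y"
proof (cases "x = 0 \<or> y = 0")
  case True
  then show ?thesis
    using wt_pos[of \<theta> x] wt_pos[of \<theta> y] by (auto simp: wt_def ennreal_top_mult ennreal_mult_top)
next
  case False
  then show ?thesis
    by (simp add: wt_def abs_mult powr_mult ennreal_mult)
qed

lemma wt_1: "wt \<theta> 1 = 1"
  by (simp add: wt_def)

lemma wt_prod: "wt \<theta> (prod f A) = (\<Prod>a\<in>A. wt \<theta> (f a))"
  by (induction A rule: infinite_finite_induct) (simp_all add: wt_1 wt_mult)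

lemma wt_anti: "\<theta> \<ge> 0 \<Longrightarrow> \<bar>x\<bar> \<le> \<bar>y\<bar> \<Longrightarrow> wt \<theta> y \<le> wt \<theta> x"
  by (auto simp: wt_def intro!: ennreal_leI powr_mono2')

lemma wt_abs [simp]: "wt \<theta> \<bar>x\<bar> = wt \<theta> x"
  by (simp add: wt_def)

lemma measurable_wt [measurable]: "wt \<theta> \<in> borel_measurable borel"
  unfolding wt_def[abs_def] by measurable

lemma prod_mono_ennreal:
  fixes f g :: "'a \<Rightarrow> ennreal"
  assumes "\<And>i. i \<in> A \<Longrightarrow> f i \<le> g i"
  shows "prod f A \<le> prod g A"
  using assms by (induction A rule: infinite_finite_induct) (auto intro!: mult_mono)

text \<open>The index with the smallest |x j| dominates every factor, and the sum over all indices
  avoids naming it. Several weak singularities are thus traded for single ones of order \<theta> *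
  card J, each integrable by itself when this number is below 1.\<close>

lemma prod_wt_le_sum:
  assumes "finite J" "J \<noteq> {}" "\<theta> \<ge> 0"
  shows "(\<Prod>j\<in>J. wt \<theta> (x j)) \<le> (\<Sum>j\<in>J. wt (\<theta> * card J) (x j))"
proof -
  have "Min ((\<lambda>j. \<bar>x j\<bar>) ` J) \<in> (\<lambda>j. \<bar>x j\<bar>) ` J"
    using assms by (intro Min_in) auto
  then obtain i where i: "i \<in> J" "\<bar>x i\<bar> = Min ((\<lambda>j. \<bar>x j\<bar>) ` J)" by auto
  have le: "\<bar>x i\<bar> \<le> \<bar>x j\<bar>" if "j \<in> J" for j
    using assms that by (auto simp: i(2) intro!: Min_le)
  have "(\<Prod>j\<in>J. wt \<theta> (x j)) \<le> (\<Prod>j\<in>J. wt \<theta> (x i))"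
    using le assms(3) by (intro prod_mono_ennreal) (auto intro: wt_anti)
  also have "\<dots> = wt \<theta> (x i) ^ card J" by simp
  also have "\<dots> = wt (\<theta> * card J) (x i)"
  proof (cases "x i = 0")
    case True
    then show ?thesis using assms by (simp add: wt_def power_eq_top_ennreal card_gt_0_iff)
  next
    case False
    then show ?thesis
      by (simp add: wt_def ennreal_power powr_power mult.commute)
  qed
  also have "\<dots> \<le> (\<Sum>j\<in>J. wt (\<theta> * card J) (x j))"
    using assms(1) i(1) by (intro member_le_sum) auto
  finally show ?thesis .
qed

text \<open>Factor over the complex numbers; replacing a root by its real part only shortens its
  distance to a real point y.\<close>

lemma abs_poly_ge_prod_real_roots:
  fixes q :: real and c :: "nat \<Rightarrow> real" and k :: nat
  assumes "q \<noteq> 0"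
  shows "\<exists>r. \<forall>y. \<bar>q * y ^ k + (\<Sum>j<k. c j * y ^ j)\<bar> \<ge> \<bar>q\<bar> * (\<Prod>i<k. \<bar>y - r i\<bar>)"
proof -
  define p :: "complex poly" where
    "p = monom (of_real q) k + (\<Sum>j<k. monom (of_real (c j)) j)"
  have ck: "coeff p k = of_real q"
    by (auto simp: p_def coeff_sum intro!: sum.neutral)
  have "degree p \<le> k"
    unfolding p_def
    by (intro degree_add_le degree_sum_le) (auto intro: order.trans[OF degree_monom_le])
  with ck assms have deg: "degree p = k"
    by (metis le_antisym le_degree of_real_eq_0_iff)
  have p0: "p \<noteq> 0" using ck assms by auto
  obtain A where A: "size A = degree p" "p = smult (lead_coeff p) (\<Prod>x\<in>#A. [:- x, 1:])"
    using alg_closed_imp_factorization[OF p0] by blast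
  obtain xs where xs: "mset xs = A" using ex_mset by blast
  have len: "length xs = k" using A(1) deg xs by auto
  have pp: "poly p y = of_real q * (\<Prod>i<k. y - xs ! i)" for y
  proof -
    have "poly p y = poly (smult (lead_coeff p) (\<Prod>x\<in>#A. [:- x, 1:])) y" using A(2) by simp
    also have "\<dots> = of_real q * (\<Prod>x\<in>#A. y - x)"
      by (simp add: deg ck poly_prod_mset)
    also have "(\<Prod>x\<in>#A. y - x) = prod_list (map (\<lambda>x. y - x) xs)"
      by (simp add: xs[symmetric] prod_mset_prod_list[symmetric])
    also have "\<dots> = (\<Prod>i<k. y - xs ! i)"
      by (simp add: prod.list_conv_set_nth len atLeast0LessThan)
    finally show ?thesis .
  qed
  show ?thesis
  proof (intro exI allI)
    fix y :: real
    have "poly p (of_real y) = of_real (q * y ^ k + (\<Sum>j<k. c j * y ^ j))"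
      by (simp add: p_def poly_monom poly_sum)
    then have "\<bar>q * y ^ k + (\<Sum>j<k. c j * y ^ j)\<bar> = norm (poly p (of_real y))"
      by (metis norm_of_real)
    also have "\<dots> = \<bar>q\<bar> * (\<Prod>i<k. norm (of_real y - xs ! i))"
      by (simp add: pp norm_mult prod_norm)
    also have "\<dots> \<ge> \<bar>q\<bar> * (\<Prod>i<k. \<bar>y - Re (xs ! i)\<bar>)"
    proof (intro mult_left_mono prod_mono conjI)
      fix i
      show "\<bar>y - Re (xs ! i)\<bar> \<le> norm (of_real y - xs ! i)"
        using abs_Re_le_cmod[of "of_real y - xs ! i"] by simp
    qed auto
    finally show "\<bar>q * y ^ k + (\<Sum>j<k. c j * y ^ j)\<bar> \<ge> \<bar>q\<bar> * (\<Prod>i<k. \<bar>y - Re (xs ! i)\<bar>)" .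
  qed
qed

text \<open>If every |y - r i| exceeded \<rho> = (\<epsilon>/q)^(1/k), the product would exceed
  \<epsilon>/q. So the set lies in k intervals of length 2\<rho>.\<close>

lemma emeasure_sublevel_poly:
  fixes r :: "nat \<Rightarrow> real"
  assumes "k \<ge> 1" "q > 0" "\<epsilon> > 0" "S \<subseteq> {y. q * (\<Prod>i<k. \<bar>y - r i\<bar>) \<le> \<epsilon>}"
  shows "emeasure lborel S \<le> ennreal (2 * k * (\<epsilon> / q) powr (1 / k))"
proof -
  define \<rho> where "\<rho> = (\<epsilon> / q) powr (1 / k)"
  have \<rho>: "\<rho> > 0" "\<rho> ^ k = \<epsilon> / q"
    using assms by (auto simp: \<rho>_def powr_power)
  have sub: "S \<subseteq> (\<Union>i<k. {r i - \<rho> .. r i + \<rho>})"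
  proof
    fix y assume "y \<in> S"
    then have y: "q * (\<Prod>i<k. \<bar>y - r i\<bar>) \<le> \<epsilon>" using assms by auto
    show "y \<in> (\<Union>i<k. {r i - \<rho> .. r i + \<rho>})"
    proof (rule ccontr)
      assume "y \<notin> (\<Union>i<k. {r i - \<rho> .. r i + \<rho>})"
      then have "y \<notin> {r i - \<rho> .. r i + \<rho>}" if "i < k" for i using that by blast
      then have *: "\<rho> < \<bar>y - r i\<bar>" if "i < k" for i using that by (fastforce simp: abs_if)
      have "(\<Prod>i<k. \<rho>) < (\<Prod>i<k. \<bar>y - r i\<bar>)"
        using * \<rho> assms(1) by (intro prod_mono_strict[of 0]) (force simp: less_imp_le)+
      then have "\<epsilon> / q < (\<Prod>i<k. \<bar>y - r i\<bar>)" using \<rho> by simp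
      then show False using y assms by (simp add: field_simps)
    qed
  qed
  have "emeasure lborel S \<le> emeasure lborel (\<Union>i<k. {r i - \<rho> .. r i + \<rho>})"
    by (rule emeasure_mono[OF sub]) auto
  also have "\<dots> \<le> (\<Sum>i<k. emeasure lborel {r i - \<rho> .. r i + \<rho>})"
    by (rule emeasure_subadditive_finite) auto
  also have "\<dots> = (\<Sum>i<k. ennreal (2 * \<rho>))"
    using \<rho> by simp
  also have "\<dots> = ennreal (2 * k * \<rho>)"
    using \<rho> by (simp add: ennreal_of_nat_eq_real_of_nat ennreal_mult[symmetric] mult_ac)
  finally show ?thesis by (simp add: \<rho>_def)
qed

lemma nn_integral_wt_Icc:
  assumes "0 \<le> \<kappa>" "\<kappa> < 1" "s > 0"
  shows "(\<integral>\<^sup>+y. wt \<kappa> y * indicator {-s..s} y \<partial>lborel) \<le> ennreal (2 * s powr (1 - \<kappa>) / (1 - \<kappa>))"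
proof -
  let ?h = "\<lambda>y::real. ennreal (y powr - \<kappa>) * indicator {0..s} y"
  have "((\<lambda>x. x powr (-\<kappa>)) has_integral (s powr (-\<kappa> + 1) / (-\<kappa> + 1))) {0..s}"
    using assms by (intro has_integral_powr_from_0) auto
  then have half: "(\<integral>\<^sup>+y. ?h y \<partial>lborel) = ennreal (s powr (1 - \<kappa>) / (1 - \<kappa>))"
    by (subst nn_integral_has_integral_lebesgue'[where I = "s powr (1 - \<kappa>) / (1 - \<kappa>)"]) auto
  have half': "(\<integral>\<^sup>+y. ?h (- y) \<partial>lborel) = ennreal (s powr (1 - \<kappa>) / (1 - \<kappa>))"
    using nn_integral_real_affine[of ?h "-1" 0] half by simp
  have "(\<integral>\<^sup>+y. wt \<kappa> y * indicator {-s..s} y \<partial>lborel) \<le> (\<integral>\<^sup>+y. ?h y + ?h (- y) \<partial>lborel)"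
  proof (rule nn_integral_mono_AE)
    show "AE y in lborel. wt \<kappa> y * indicator {-s..s} y \<le> ?h y + ?h (- y)"
      using AE_lborel_singleton[of 0]
      by eventually_elim (auto simp: wt_def split: split_indicator)
  qed
  also have "\<dots> = (\<integral>\<^sup>+y. ?h y \<partial>lborel) + (\<integral>\<^sup>+y. ?h (- y) \<partial>lborel)"
    by (rule nn_integral_add) auto
  also have "\<dots> = ennreal (2 * s powr (1 - \<kappa>) / (1 - \<kappa>))"
    using assms unfolding half half' by (simp add: ennreal_plus[symmetric] del: ennreal_plus)
  finally show ?thesis .
qed

text \<open>Within distance s of r the singularity is integrated over the whole interval; farther
  away the weight is at most s^(-\<kappa>) and S has measure at most s. Both parts scale like
  s^(1-\<kappa>), as for an interval of length s centred at r.\<close>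

lemma nn_integral_wt_set:
  assumes "0 \<le> \<kappa>" "\<kappa> < 1" "s > 0" "S \<in> sets borel" "emeasure lborel S \<le> ennreal s"
  shows "(\<integral>\<^sup>+y. wt \<kappa> (y - r) * indicator S y \<partial>lborel) \<le> ennreal ((2 / (1 - \<kappa>) + 1) * s powr (1 - \<kappa>))"
proof -
  let ?f = "\<lambda>y. wt \<kappa> y * indicator {-s..s} y"
  have "wt \<kappa> (y - r) * indicator S y \<le> ?f (y - r) + ennreal (s powr - \<kappa>) * indicator S y" for y
    using wt_anti[of \<kappa> s "y - r"] assms(1,3)
    by (auto simp: wt_def powr_mono2' split: split_indicator intro!: ennreal_leI powr_mono2')
  then have "(\<integral>\<^sup>+y. wt \<kappa> (y - r) * indicator S y \<partial>lborel) \<le> (\<integral>\<^sup>+y. ?f (y - r) + ennreal (s powr - \<kappa>) * indicator S y \<partial>lborel)"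
    by (intro nn_integral_mono)
  also have "\<dots> = (\<integral>\<^sup>+y. ?f (y - r) \<partial>lborel) + ennreal (s powr - \<kappa>) * emeasure lborel S"
    using assms(4) by (subst nn_integral_add) (auto simp: nn_integral_cmult_indicator)
  also have "(\<integral>\<^sup>+y. ?f (y - r) \<partial>lborel) = (\<integral>\<^sup>+y. ?f y \<partial>lborel)"
    using nn_integral_real_affine[of ?f 1 "-r"] by simp
  also have "\<dots> + ennreal (s powr - \<kappa>) * emeasure lborel S \<le> ennreal (2 * s powr (1 - \<kappa>) / (1 - \<kappa>)) + ennreal (s powr - \<kappa>) * ennreal s"
    by (intro add_mono nn_integral_wt_Icc assms mult_left_mono) auto
  also have "\<dots> = ennreal ((2 / (1 - \<kappa>) + 1) * s powr (1 - \<kappa>))"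
    using assms by (simp add: ennreal_mult[symmetric] ennreal_plus[symmetric] powr_mult_base field_simps del: ennreal_plus)
  finally show ?thesis .
qed

lemma prod_eq_top_ennreal:
  fixes f :: "'a \<Rightarrow> ennreal"
  assumes "finite A" "a \<in> A" "f a = \<infinity>" "\<And>x. x \<in> A \<Longrightarrow> f x \<noteq> 0"
  shows "prod f A = \<infinity>"
proof -
  have "prod f A = f a * prod f (A - {a})" using assms by (simp add: prod.remove)
  moreover have "prod f (A - {a}) \<noteq> 0" using assms by simp
  ultimately show ?thesis using assms by (simp add: ennreal_top_mult)
qed

text \<open>One step of the iterated integration. The polynomials in \<open>A\<close> confine y to a
  sublevel set, those in \<open>B\<close> are weights left by earlier variables. With \<kappa> =
  \<theta> times the degree sum over \<open>B\<close>, the singularities have total order \<kappa>,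
  and 1 - \<kappa> is \<theta> times the degree sum over \<open>A\<close>. This exact balance
  distributes the measure of the sublevel set over the members of \<open>A\<close> in proportion to
  their degrees, and leaves weights of the same form in the leading coefficients.\<close>

lemma one_dim_sublevel_weight_bound:
  fixes k :: "'a \<Rightarrow> nat" and \<theta> :: real
  assumes A: "finite A" "A \<noteq> {}" "\<And>a. a \<in> A \<Longrightarrow> k a \<ge> 1" and B: "finite B" and AB: "A \<inter> B = {}"
    and \<theta>: "\<theta> > 0" "\<theta> * (\<Sum>a\<in>A \<union> B. k a) = 1"
  shows "\<exists>C>0. \<forall>P q \<epsilon>. (\<forall>a\<in>A \<union> B. P a \<in> borel_measurable borel \<and> (\<exists>c. \<forall>y. P a y = q a * y ^ k a + (\<Sum>j<k a. c j * y ^ j))) \<longrightarrow> (\<forall>a\<in>A. \<epsilon> a > 0) \<longrightarrow>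
    (\<integral>\<^sup>+y. (\<Prod>a\<in>A. indicator {y. \<bar>P a y\<bar> \<le> \<epsilon> a} y) * (\<Prod>b\<in>B. wt \<theta> (P b y)) \<partial>lborel)
     \<le> ennreal C * (\<Prod>a\<in>A. ennreal (\<epsilon> a powr \<theta>) * wt \<theta> (q a)) * (\<Prod>b\<in>B. wt \<theta> (q b))"
proof -
  define K where "K = (\<Sum>b\<in>B. k b)"
  define L where "L = (\<Sum>a\<in>A. k a)"
  define \<kappa> where "\<kappa> = \<theta> * K"
  have sumk: "\<theta> * L + \<kappa> = 1"
    using \<theta>(2) AB A(1) B by (simp add: L_def \<kappa>_def K_def sum.union_disjoint algebra_simps)
  have "L \<ge> 1" unfolding L_def
  proof -
    obtain a where "a \<in> A" using A by auto
    then show "1 \<le> (\<Sum>a\<in>A. k a)" using A(3)[of a] member_le_sum[of a A k] A(1) by force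
  qed
  then have "\<theta> * L > 0" using \<theta>(1) by simp
  then have \<kappa>: "0 \<le> \<kappa>" "\<kappa> < 1" "1 - \<kappa> = \<theta> * L" using sumk \<theta>(1) by (auto simp: \<kappa>_def)
  define Ck where "Ck = 2 / (1 - \<kappa>) + 1"
  have Ck: "Ck > 0" using \<kappa> by (simp add: Ck_def add_pos_pos)
  define C where "C = (1 + K * Ck) * (\<Prod>a\<in>A. (2 * real (k a)) powr (\<theta> * k a))"
  show ?thesis
  proof (intro exI[of _ C] conjI allI impI)
    show "C > 0" unfolding C_def using Ck A(3)
      by (intro mult_pos_pos prod_pos add_pos_nonneg) (force simp: )+
    fix P :: "'a \<Rightarrow> real \<Rightarrow> real" and q \<epsilon> :: "'a \<Rightarrow> real"
    assume P: "\<forall>a\<in>A \<union> B. P a \<in> borel_measurable borel \<and> (\<exists>c. \<forall>y. P a y = q a * y ^ k a + (\<Sum>j<k a. c j * y ^ j))"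
      and \<epsilon>: "\<forall>a\<in>A. \<epsilon> a > 0"
    show "(\<integral>\<^sup>+y. (\<Prod>a\<in>A. indicator {y. \<bar>P a y\<bar> \<le> \<epsilon> a} y) * (\<Prod>b\<in>B. wt \<theta> (P b y)) \<partial>lborel)
     \<le> ennreal C * (\<Prod>a\<in>A. ennreal (\<epsilon> a powr \<theta>) * wt \<theta> (q a)) * (\<Prod>b\<in>B. wt \<theta> (q b))"
    \<comment> \<open>A vanishing leading coefficient makes the right-hand side infinite, because
      none of its other factors is 0.\<close>
    proof (cases "\<exists>a\<in>A\<union>B. q a = 0")
      case True
      let ?X = "\<Prod>a\<in>A. ennreal (\<epsilon> a powr \<theta>) * wt \<theta> (q a)" and ?Y = "\<Prod>b\<in>B. wt \<theta> (q b)"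
      have nz: "?X \<noteq> 0" "?Y \<noteq> 0" using A(1) B \<epsilon> by (auto simp: wt_pos)
      from True have "?X = \<infinity> \<or> ?Y = \<infinity>"
      proof
        fix a assume a: "a \<in> A \<union> B" "q a = 0"
        then have "wt \<theta> (q a) = \<infinity>" by (simp add: wt_def)
        then show ?thesis
          using a \<epsilon> A(1) B prod_eq_top_ennreal[of A a "\<lambda>a. ennreal (\<epsilon> a powr \<theta>) * wt \<theta> (q a)"]
             prod_eq_top_ennreal[of B a "\<lambda>a. wt \<theta> (q a)"]
          by (fastforce simp: wt_pos ennreal_mult_top)
      qed
      then have "ennreal C * ?X * ?Y = \<infinity>"
        using nz \<open>C > 0\<close> by (auto simp: ennreal_mult_top ennreal_top_mult)
      then show ?thesis by simp
    next
      case False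
      then have q: "q a \<noteq> 0" if "a \<in> A \<union> B" for a using that by auto
      have "\<forall>a\<in>A\<union>B. \<exists>r. \<forall>y. \<bar>P a y\<bar> \<ge> \<bar>q a\<bar> * (\<Prod>i<k a. \<bar>y - r i\<bar>)"
      proof
        fix a assume a: "a \<in> A \<union> B"
        then obtain c where "\<forall>y. P a y = q a * y ^ k a + (\<Sum>j<k a. c j * y ^ j)" using P by blast
        then show "\<exists>r. \<forall>y. \<bar>P a y\<bar> \<ge> \<bar>q a\<bar> * (\<Prod>i<k a. \<bar>y - r i\<bar>)"
          using abs_poly_ge_prod_real_roots[OF q[OF a], of "k a" c] by simp
      qed
      then obtain r where r: "\<And>a y. a \<in> A \<union> B \<Longrightarrow> \<bar>P a y\<bar> \<ge> \<bar>q a\<bar> * (\<Prod>i<k a. \<bar>y - r a i\<bar>)"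
        by (auto simp: bchoice_iff)
      define S where "S = (\<Inter>a\<in>A. {y. \<bar>P a y\<bar> \<le> \<epsilon> a})"
      have S[measurable]: "S \<in> sets borel"
      proof -
        have "{y. \<bar>P a y\<bar> \<le> \<epsilon> a} \<in> sets borel" if "a \<in> A" for a
        proof -
          have [measurable]: "P a \<in> borel_measurable borel" using P that by auto
          show ?thesis by measurable
        qed
        then show ?thesis unfolding S_def using A by (intro sets.finite_INT) auto
      qed
      define s where "s a = 2 * real (k a) * (\<epsilon> a / \<bar>q a\<bar>) powr (1 / k a)" for a
      have s: "s a > 0" "emeasure lborel S \<le> ennreal (s a)" if "a \<in> A" for a
      proof -
        show "s a > 0" using A(3)[OF that] \<epsilon> q[of a] that by (auto simp: s_def)
        have "S \<subseteq> {y. \<bar>q a\<bar> * (\<Prod>i<k a. \<bar>y - r a i\<bar>) \<le> \<epsilon> a}"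
          unfolding S_def using that r[of a] by (auto intro: order.trans)
        then show "emeasure lborel S \<le> ennreal (s a)"
          unfolding s_def using A(3)[OF that] \<epsilon> q[of a] that by (intro emeasure_sublevel_poly) auto
      qed
      \<comment> \<open>Each member of \<open>A\<close> alone bounds the measure of S by
        \<open>s a\<close>. The smallest of these bounds enters the integral; its power 1 - \<kappa>
        is afterwards estimated by the product of the powers \<theta> * k a of all
        \<open>s a\<close>, whose exponents add up to 1 - \<kappa>.\<close>
      define s0 where "s0 = Min (s ` A)"
      have "s0 \<in> s ` A" unfolding s0_def using A by (intro Min_in) auto
      then have s0: "s0 > 0" "emeasure lborel S \<le> ennreal s0" using s by auto
      have s0_le: "s0 \<le> s a" if "a \<in> A" for a
        unfolding s0_def using A that by (intro Min_le) auto
      \<comment> \<open>One index for each root of each polynomial in \<open>B\<close>; the product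
        of the weights at these roots has total order \<kappa> = \<theta> * card J.\<close>
      define J where "J = Sigma B (\<lambda>b. {..<k b})"
      have J: "finite J" "card J = K" unfolding J_def K_def using B by auto
      define D where "D = (\<Prod>b\<in>B. wt \<theta> (q b))"
      have wtB: "(\<Prod>b\<in>B. wt \<theta> (P b y)) \<le> D * (\<Prod>(b,i)\<in>J. wt \<theta> (y - r b i))" for y
      proof -
        have "(\<Prod>b\<in>B. wt \<theta> (P b y)) \<le> (\<Prod>b\<in>B. wt \<theta> (q b) * (\<Prod>i<k b. wt \<theta> (y - r b i)))"
        proof (intro prod_mono_ennreal)
          fix b assume "b \<in> B"
          have "wt \<theta> (P b y) \<le> wt \<theta> (\<bar>q b\<bar> * (\<Prod>i<k b. \<bar>y - r b i\<bar>))"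
            using r[of b y] \<open>b \<in> B\<close> \<theta>(1) by (intro wt_anti) (auto simp: abs_mult prod_nonneg)
          then show "wt \<theta> (P b y) \<le> wt \<theta> (q b) * (\<Prod>i<k b. wt \<theta> (y - r b i))"
            by (simp add: wt_mult wt_prod)
        qed
        also have "\<dots> = D * (\<Prod>(b,i)\<in>J. wt \<theta> (y - r b i))"
          unfolding J_def D_def using B by (simp add: prod.distrib prod.Sigma)
        finally show ?thesis .
      qed
      have ind: "(\<Prod>a\<in>A. indicator {y. \<bar>P a y\<bar> \<le> \<epsilon> a} y) = (indicator S y :: ennreal)" for y
        unfolding S_def using A by (auto simp: indicator_def prod_zero_iff)
      have main: "(\<integral>\<^sup>+y. (\<Prod>(b,i)\<in>J. wt \<theta> (y - r b i)) * indicator S y \<partial>lborel) \<le> ennreal ((1 + K * Ck) * s0 powr (1 - \<kappa>))"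
      proof (cases "J = {}")
        case True
        then have "K = 0" using J by simp
        then have "\<kappa> = 0" by (simp add: \<kappa>_def)
        then show ?thesis using True s0 S \<open>K = 0\<close> by simp
      next
        case False
        have "(\<integral>\<^sup>+y. (\<Prod>(b,i)\<in>J. wt \<theta> (y - r b i)) * indicator S y \<partial>lborel)
           \<le> (\<integral>\<^sup>+y. (\<Sum>j\<in>J. wt \<kappa> (y - r (fst j) (snd j)) * indicator S y) \<partial>lborel)"
          unfolding sum_distrib_right[symmetric]
          using prod_wt_le_sum[OF J(1) False, of \<theta> "\<lambda>j. _ - r (fst j) (snd j)"] \<theta>(1)
          by (intro nn_integral_mono mult_right_mono) (auto simp: J \<kappa>_def case_prod_beta)
        also have "\<dots> = (\<Sum>j\<in>J. \<integral>\<^sup>+y. wt \<kappa> (y - r (fst j) (snd j)) * indicator S y \<partial>lborel)"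
          by (rule nn_integral_sum) auto
        also have "\<dots> \<le> (\<Sum>j\<in>J. ennreal (Ck * s0 powr (1 - \<kappa>)))"
          unfolding Ck_def by (intro sum_mono nn_integral_wt_set \<kappa> s0) auto
        also have "\<dots> = ennreal (K * (Ck * s0 powr (1 - \<kappa>)))"
          using Ck by (simp add: J ennreal_of_nat_eq_real_of_nat ennreal_mult[symmetric])
        also have "\<dots> \<le> ennreal ((1 + K * Ck) * s0 powr (1 - \<kappa>))"
          by (intro ennreal_leI) (simp add: algebra_simps)
        finally show ?thesis .
      qed
      have "s0 powr (1 - \<kappa>) = (\<Prod>a\<in>A. s0 powr (\<theta> * k a))"
        using s0(1) A by (simp add: \<kappa>(3) L_def powr_sum[symmetric] sum_distrib_left)
      also have "\<dots> \<le> (\<Prod>a\<in>A. s a powr (\<theta> * k a))"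
        using s0 s0_le \<theta>(1) by (intro prod_mono conjI powr_mono2) auto
      \<comment> \<open>The root 1 / k a in the measure bound cancels the degree k a in the
        exponent, so each member contributes a constant times (\<epsilon> a / |q
        a|)^\<theta>.\<close>
      also have "\<dots> = (\<Prod>a\<in>A. (2 * real (k a)) powr (\<theta> * k a) * (\<epsilon> a powr \<theta> * \<bar>q a\<bar> powr - \<theta>))"
      proof (rule prod.cong[OF refl])
        fix a assume a: "a \<in> A"
        then have "k a \<noteq> 0" using A(3)[OF a] by simp
        then show "s a powr (\<theta> * k a) = (2 * real (k a)) powr (\<theta> * k a) * (\<epsilon> a powr \<theta> * \<bar>q a\<bar> powr - \<theta>)"
          using a \<epsilon> q[of a] by (simp add: s_def powr_mult powr_powr powr_divide powr_minus_divide)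
      qed
      finally have s0p: "s0 powr (1 - \<kappa>) \<le> (\<Prod>a\<in>A. (2 * real (k a)) powr (\<theta> * k a)) * (\<Prod>a\<in>A. \<epsilon> a powr \<theta> * \<bar>q a\<bar> powr - \<theta>)"
        by (simp add: prod.distrib)
      have X: "(\<Prod>a\<in>A. ennreal (\<epsilon> a powr \<theta>) * wt \<theta> (q a)) = ennreal (\<Prod>a\<in>A. \<epsilon> a powr \<theta> * \<bar>q a\<bar> powr - \<theta>)"
        using q by (subst prod_ennreal[symmetric]) (auto simp: wt_def ennreal_mult intro!: prod.cong)
      have "(\<integral>\<^sup>+y. (\<Prod>a\<in>A. indicator {y. \<bar>P a y\<bar> \<le> \<epsilon> a} y) * (\<Prod>b\<in>B. wt \<theta> (P b y)) \<partial>lborel)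
        \<le> (\<integral>\<^sup>+y. D * ((\<Prod>(b,i)\<in>J. wt \<theta> (y - r b i)) * indicator S y) \<partial>lborel)"
        unfolding ind using wtB by (intro nn_integral_mono) (auto simp: mult_ac split: split_indicator)
      also have "\<dots> = D * (\<integral>\<^sup>+y. (\<Prod>(b,i)\<in>J. wt \<theta> (y - r b i)) * indicator S y \<partial>lborel)"
        by (intro nn_integral_cmult) (auto simp: case_prod_beta)
      also have "\<dots> \<le> D * ennreal ((1 + K * Ck) * s0 powr (1 - \<kappa>))"
        by (intro mult_left_mono main) auto
      also have "\<dots> \<le> D * ennreal ((1 + K * Ck) * ((\<Prod>a\<in>A. (2 * real (k a)) powr (\<theta> * k a)) * (\<Prod>a\<in>A. \<epsilon> a powr \<theta> * \<bar>q a\<bar> powr - \<theta>)))"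
        using Ck by (intro mult_left_mono ennreal_leI s0p) auto
      also have "\<dots> = D * ennreal (C * (\<Prod>a\<in>A. \<epsilon> a powr \<theta> * \<bar>q a\<bar> powr - \<theta>))"
        by (simp add: C_def mult_ac)
      also have "\<dots> = ennreal C * (\<Prod>a\<in>A. ennreal (\<epsilon> a powr \<theta>) * wt \<theta> (q a)) * D"
        unfolding X using \<open>C > 0\<close> by (simp add: ennreal_mult prod_nonneg mult_ac)
      finally show ?thesis by (simp add: D_def)
    qed
  qed
qed

subsection \<open>Lexicographically monic functions\<close>

text \<open>Polynomials whose lexicographically leading monomial has exponents
  \<open>\<alpha>\<close> and coefficient 1, the head of the list being the most significant
  variable. The leading coefficient in the head variable must be of the same kind in the tail. The
  lower coefficients \<open>c\<close> are arbitrary functions: measurability is imposed on P and,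
  through the recursion, on the leading coefficients only.\<close>

fun lexmonic :: "'v list \<Rightarrow> ('v \<Rightarrow> nat) \<Rightarrow> (('v \<Rightarrow> real) \<Rightarrow> real) \<Rightarrow> bool" where
  "lexmonic [] \<alpha> P \<longleftrightarrow> (\<forall>x. P x = 1)"
| "lexmonic (v # vs) \<alpha> P \<longleftrightarrow> P \<in> borel_measurable (Pi\<^sub>M (insert v (set vs)) (\<lambda>_. lborel)) \<and>
     (\<exists>Q c. lexmonic vs \<alpha> Q \<and> (\<forall>x y. P (x(v := y)) = Q x * y ^ \<alpha> v + (\<Sum>j<\<alpha> v. c j x * y ^ j)))"

lemma lexmonic_measurable:
  "lexmonic vs \<alpha> P \<Longrightarrow> P \<in> borel_measurable (Pi\<^sub>M (set vs) (\<lambda>_. lborel))"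
proof (cases vs)
  case Nil
  assume "lexmonic vs \<alpha> P"
  with Nil have "P = (\<lambda>_. 1)" by auto
  then show ?thesis by simp
qed auto

lemma product_sigma_finite_lborel: "product_sigma_finite (\<lambda>_. lborel :: 'a::euclidean_space measure)"
  by standard (rule lborel.sigma_finite_countable)

text \<open>Induction on the list integrates out its head v. The members of \<open>A\<close> with
  positive exponent in v are spent on this integration and return as weights in their leading
  coefficients, so they move to \<open>B\<close>; the others coincide with their leading coefficient
  and stay in \<open>A\<close>. The union of both sets never changes, hence neither does the balance
  condition. The last assumption ensures that at every variable some member of \<open>A\<close> is
  still unspent and involves it.\<close>

lemma lexmonic_sublevel_bound:
  fixes \<alpha> :: "'a \<Rightarrow> 'v \<Rightarrow> nat" and \<theta> :: real
  assumes "distinct vs" "finite A" "finite B" "A \<inter> B = {}" and \<theta>: "\<theta> > 0"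
    and "\<And>v. v \<in> set vs \<Longrightarrow> \<theta> * (\<Sum>a\<in>A \<union> B. \<alpha> a v) = 1"
    and "\<And>us v ws. vs = us @ v # ws \<Longrightarrow> \<exists>a\<in>A. \<alpha> a v \<ge> 1 \<and> (\<forall>u\<in>set us. \<alpha> a u = 0)"
  shows "\<exists>C>0. \<forall>P \<epsilon>. (\<forall>a\<in>A \<union> B. lexmonic vs (\<alpha> a) (P a)) \<longrightarrow> (\<forall>a\<in>A. \<epsilon> a > 0) \<longrightarrow>
    (\<integral>\<^sup>+x. (\<Prod>a\<in>A. indicator {x. \<bar>P a x\<bar> \<le> \<epsilon> a} x) * (\<Prod>b\<in>B. wt \<theta> (P b x)) \<partial>Pi\<^sub>M (set vs) (\<lambda>_. lborel))
     \<le> ennreal C * (\<Prod>a\<in>A. ennreal (\<epsilon> a powr \<theta>))"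
  using assms(1-4,6-)
proof (induction vs arbitrary: A B)
  case Nil
  interpret product_sigma_finite "\<lambda>_::'v. lborel :: real measure" by (rule product_sigma_finite_lborel)
  show ?case
  proof (intro exI[of _ 1] conjI allI impI)
    fix P :: "'a \<Rightarrow> ('v \<Rightarrow> real) \<Rightarrow> real" and \<epsilon> :: "'a \<Rightarrow> real"
    assume P: "\<forall>a\<in>A \<union> B. lexmonic [] (\<alpha> a) (P a)" and \<epsilon>: "\<forall>a\<in>A. \<epsilon> a > 0"
    have B: "(\<Prod>b\<in>B. wt \<theta> (P b x)) = 1" for x using P by (simp add: wt_1)
    have "(\<Prod>a\<in>A. indicator {x. \<bar>P a x\<bar> \<le> \<epsilon> a} x) \<le> (\<Prod>a\<in>A. ennreal (\<epsilon> a powr \<theta>))" for x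
    proof (rule prod_mono_ennreal)
      fix a assume a: "a \<in> A"
      then have [simp]: "P a x = 1" using P by auto
      \<comment> \<open>The constant 1 obeys the constraint only if \<epsilon> a \<ge> 1, and then
        the factor on the right is at least 1.\<close>
      have "1 \<le> \<epsilon> a powr \<theta>" if "1 \<le> \<epsilon> a" using that \<theta> by (simp add: ge_one_powr_ge_zero)
      then show "indicator {x. \<bar>P a x\<bar> \<le> \<epsilon> a} x \<le> ennreal (\<epsilon> a powr \<theta>)"
        by (auto split: split_indicator)
    qed
    then show "(\<integral>\<^sup>+x. (\<Prod>a\<in>A. indicator {x. \<bar>P a x\<bar> \<le> \<epsilon> a} x) * (\<Prod>b\<in>B. wt \<theta> (P b x)) \<partial>Pi\<^sub>M (set []) (\<lambda>_. lborel))
     \<le> ennreal 1 * (\<Prod>a\<in>A. ennreal (\<epsilon> a powr \<theta>))"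
      by (simp add: B nn_integral_empty)
  qed auto
next
  case (Cons v vs)
  interpret product_sigma_finite "\<lambda>_::'v. lborel :: real measure" by (rule product_sigma_finite_lborel)
  define A0 where "A0 = {a\<in>A. \<alpha> a v = 0}"
  define A1 where "A1 = {a\<in>A. \<alpha> a v \<ge> 1}"
  have fin: "finite A0" "finite A1" "A0 \<inter> A1 = {}" "A = A0 \<union> A1" "A0 \<inter> (A1 \<union> B) = {}" "A1 \<inter> B = {}"
      "A0 \<union> (A1 \<union> B) = A \<union> B"
    using Cons.prems(2-4) by (auto simp: A0_def A1_def)
  have "A1 \<noteq> {}"
    using Cons.prems(6)[of "[]" v vs] by (auto simp: A1_def)
  have sum1: "\<theta> * (\<Sum>a\<in>A1 \<union> B. \<alpha> a v) = 1"
  proof -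
    have "(\<Sum>a\<in>A1 \<union> B. \<alpha> a v) = (\<Sum>a\<in>A \<union> B. \<alpha> a v)"
      using Cons.prems(2,3) by (intro sum.mono_neutral_left) (auto simp: A1_def)
    then show ?thesis using Cons.prems(5)[of v] by simp
  qed
  have kk: "\<alpha> a v \<ge> 1" if "a \<in> A1" for a using that by (simp add: A1_def)
  obtain C1 where C1: "C1 > 0" "\<And>P q \<epsilon>. \<forall>a\<in>A1 \<union> B. P a \<in> borel_measurable borel \<and> (\<exists>c. \<forall>y. P a y = q a * y ^ \<alpha> a v + (\<Sum>j<\<alpha> a v. c j * y ^ j)) \<Longrightarrow> \<forall>a\<in>A1. \<epsilon> a > 0 \<Longrightarrow>
    (\<integral>\<^sup>+y. (\<Prod>a\<in>A1. indicator {y. \<bar>P a y\<bar> \<le> \<epsilon> a} y) * (\<Prod>b\<in>B. wt \<theta> (P b y)) \<partial>lborel)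
     \<le> ennreal C1 * (\<Prod>a\<in>A1. ennreal (\<epsilon> a powr \<theta>) * wt \<theta> (q a)) * (\<Prod>b\<in>B. wt \<theta> (q b))"
    using one_dim_sublevel_weight_bound[of A1 "\<lambda>a. \<alpha> a v" B \<theta>, OF fin(2) \<open>A1 \<noteq> {}\<close> kk Cons.prems(3) fin(6) \<theta> sum1]
    by blast
  have "\<exists>C>0. \<forall>P \<epsilon>. (\<forall>a\<in>A0 \<union> (A1 \<union> B). lexmonic vs (\<alpha> a) (P a)) \<longrightarrow> (\<forall>a\<in>A0. \<epsilon> a > 0) \<longrightarrow>
    (\<integral>\<^sup>+x. (\<Prod>a\<in>A0. indicator {x. \<bar>P a x\<bar> \<le> \<epsilon> a} x) * (\<Prod>b\<in>A1 \<union> B. wt \<theta> (P b x)) \<partial>Pi\<^sub>M (set vs) (\<lambda>_. lborel))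
     \<le> ennreal C * (\<Prod>a\<in>A0. ennreal (\<epsilon> a powr \<theta>))"
  proof (rule Cons.IH)
    fix w assume "w \<in> set vs"
    then show "\<theta> * (\<Sum>a\<in>A0 \<union> (A1 \<union> B). \<alpha> a w) = 1"
      using Cons.prems(5)[of w] fin by simp
  next
    fix us w ws assume "vs = us @ w # ws"
    \<comment> \<open>The witness has exponent 0 in v too, so it was not spent and lies in
      \<open>A0\<close>.\<close>
    then show "\<exists>a\<in>A0. \<alpha> a w \<ge> 1 \<and> (\<forall>u\<in>set us. \<alpha> a u = 0)"
      using Cons.prems(6)[of "v # us" w ws] by (auto simp: A0_def)
  qed (use Cons.prems fin in auto)
  then obtain C2 where C2: "C2 > 0" "\<And>P \<epsilon>. \<forall>a\<in>A0 \<union> (A1 \<union> B). lexmonic vs (\<alpha> a) (P a) \<Longrightarrow> \<forall>a\<in>A0. \<epsilon> a > 0 \<Longrightarrow>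
    (\<integral>\<^sup>+x. (\<Prod>a\<in>A0. indicator {x. \<bar>P a x\<bar> \<le> \<epsilon> a} x) * (\<Prod>b\<in>A1 \<union> B. wt \<theta> (P b x)) \<partial>Pi\<^sub>M (set vs) (\<lambda>_. lborel))
     \<le> ennreal C2 * (\<Prod>a\<in>A0. ennreal (\<epsilon> a powr \<theta>))" by blast
  show ?case
  proof (intro exI[of _ "C1 * C2"] conjI allI impI)
    show "C1 * C2 > 0" using C1 C2 by simp
    fix P :: "'a \<Rightarrow> ('v \<Rightarrow> real) \<Rightarrow> real" and \<epsilon> :: "'a \<Rightarrow> real"
    assume P: "\<forall>a\<in>A \<union> B. lexmonic (v # vs) (\<alpha> a) (P a)" and \<epsilon>: "\<forall>a\<in>A. \<epsilon> a > 0"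
    have "\<forall>a\<in>A\<union>B. \<exists>Q c. lexmonic vs (\<alpha> a) Q \<and> (\<forall>x y. P a (x(v := y)) = Q x * y ^ \<alpha> a v + (\<Sum>j<\<alpha> a v. c j x * y ^ j))"
      using P by simp
    then obtain Q where Q': "\<forall>a\<in>A\<union>B. \<exists>c. lexmonic vs (\<alpha> a) (Q a) \<and> (\<forall>x y. P a (x(v := y)) = Q a x * y ^ \<alpha> a v + (\<Sum>j<\<alpha> a v. c j x * y ^ j))"
      unfolding bchoice_iff[of "A \<union> B"] by blast
    then obtain c where Qc: "\<forall>a\<in>A\<union>B. lexmonic vs (\<alpha> a) (Q a) \<and> (\<forall>x y. P a (x(v := y)) = Q a x * y ^ \<alpha> a v + (\<Sum>j<\<alpha> a v. c a j x * y ^ j))"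
      unfolding bchoice_iff[of "A \<union> B"] by blast
    then have Q: "\<And>a. a \<in> A \<union> B \<Longrightarrow> lexmonic vs (\<alpha> a) (Q a)"
      and Pe: "\<And>a x y. a \<in> A \<union> B \<Longrightarrow> P a (x(v := y)) = Q a x * y ^ \<alpha> a v + (\<Sum>j<\<alpha> a v. c a j x * y ^ j)"
      by blast+
    have Pm[measurable]: "P a \<in> borel_measurable (Pi\<^sub>M (insert v (set vs)) (\<lambda>_. lborel))" if "a \<in> A \<union> B" for a
      using P that by simp
    have Qm[measurable]: "Q a \<in> borel_measurable (Pi\<^sub>M (set vs) (\<lambda>_. lborel))" if "a \<in> A \<union> B" for a
      using Q[OF that] by (rule lexmonic_measurable)
    have ind_eq: "(indicator {x. \<bar>P a x\<bar> \<le> \<epsilon> a} x :: ennreal) = (if \<bar>P a x\<bar> \<le> \<epsilon> a then 1 else 0)"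
                 "(indicator {x. \<bar>Q a x\<bar> \<le> \<epsilon> a} x :: ennreal) = (if \<bar>Q a x\<bar> \<le> \<epsilon> a then 1 else 0)" for a x
      by (auto split: split_indicator)
    let ?F = "\<lambda>x. (\<Prod>a\<in>A. indicator {x. \<bar>P a x\<bar> \<le> \<epsilon> a} x) * (\<Prod>b\<in>B. wt \<theta> (P b x))"
    let ?G = "\<lambda>x. (\<Prod>a\<in>A0. indicator {x. \<bar>Q a x\<bar> \<le> \<epsilon> a} x) * (\<Prod>b\<in>A1 \<union> B. wt \<theta> (Q b x))"
    let ?E1 = "\<Prod>a\<in>A1. ennreal (\<epsilon> a powr \<theta>)"
    have Fm: "?F \<in> borel_measurable (Pi\<^sub>M (insert v (set vs)) (\<lambda>_. lborel))"
      unfolding ind_eq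
    proof (intro borel_measurable_times_ennreal borel_measurable_prod_ennreal)
      fix a assume "a \<in> A"
      then have [measurable]: "P a \<in> borel_measurable (Pi\<^sub>M (insert v (set vs)) (\<lambda>_. lborel))" by (intro Pm) auto
      show "(\<lambda>x. (if \<bar>P a x\<bar> \<le> \<epsilon> a then 1 else 0) :: ennreal) \<in> borel_measurable (Pi\<^sub>M (insert v (set vs)) (\<lambda>_. lborel))"
        by measurable
    next
      fix a assume "a \<in> B"
      then have [measurable]: "P a \<in> borel_measurable (Pi\<^sub>M (insert v (set vs)) (\<lambda>_. lborel))" by (intro Pm) auto
      show "(\<lambda>x. wt \<theta> (P a x)) \<in> borel_measurable (Pi\<^sub>M (insert v (set vs)) (\<lambda>_. lborel))"
        by measurable
    qed
    have Gm: "?G \<in> borel_measurable (Pi\<^sub>M (set vs) (\<lambda>_. lborel))"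
      unfolding ind_eq
    proof (intro borel_measurable_times_ennreal borel_measurable_prod_ennreal)
      fix a assume "a \<in> A0"
      then have [measurable]: "Q a \<in> borel_measurable (Pi\<^sub>M (set vs) (\<lambda>_. lborel))" by (intro Qm) (auto simp: fin)
      show "(\<lambda>x. (if \<bar>Q a x\<bar> \<le> \<epsilon> a then 1 else 0) :: ennreal) \<in> borel_measurable (Pi\<^sub>M (set vs) (\<lambda>_. lborel))"
        by measurable
    next
      fix a assume "a \<in> A1 \<union> B"
      then have [measurable]: "Q a \<in> borel_measurable (Pi\<^sub>M (set vs) (\<lambda>_. lborel))" by (intro Qm) (auto simp: fin)
      show "(\<lambda>x. wt \<theta> (Q a x)) \<in> borel_measurable (Pi\<^sub>M (set vs) (\<lambda>_. lborel))"
        by measurable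
    qed
    have fiber: "(\<integral>\<^sup>+y. ?F (x(v := y)) \<partial>lborel) \<le> ennreal C1 * ?E1 * ?G x" for x
    proof -
      have Pb: "(\<lambda>y. P a (x(v := y))) \<in> borel_measurable borel" if "a \<in> A \<union> B" for a
        using Pe[OF that] by simp
      let ?I0 = "\<Prod>a\<in>A0. indicator {x. \<bar>Q a x\<bar> \<le> \<epsilon> a} x :: ennreal"
      let ?H = "\<lambda>y. (\<Prod>a\<in>A1. indicator {y. \<bar>P a (x(v := y))\<bar> \<le> \<epsilon> a} y) * (\<Prod>b\<in>B. wt \<theta> (P b (x(v := y))))"
      have Hm: "?H \<in> borel_measurable borel"
        unfolding ind_eq
      proof (intro borel_measurable_times_ennreal borel_measurable_prod_ennreal)
        fix a assume "a \<in> A1"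
        then have [measurable]: "(\<lambda>y. P a (x(v := y))) \<in> borel_measurable borel" by (intro Pb) (auto simp: fin)
        show "(indicator {y. \<bar>P a (x(v := y))\<bar> \<le> \<epsilon> a} :: real \<Rightarrow> ennreal) \<in> borel_measurable borel"
          by measurable
      next
        fix a assume "a \<in> B"
        then have [measurable]: "(\<lambda>y. P a (x(v := y))) \<in> borel_measurable borel" by (intro Pb) auto
        show "(\<lambda>y. wt \<theta> (P a (x(v := y)))) \<in> borel_measurable borel"
          by measurable
      qed
      have "?F (x(v := y)) = ?I0 * ?H y" for y
      proof -
        have "(\<Prod>a\<in>A. indicator {x. \<bar>P a x\<bar> \<le> \<epsilon> a} (x(v := y))) =
          (\<Prod>a\<in>A0. indicator {x. \<bar>P a x\<bar> \<le> \<epsilon> a} (x(v := y))) * (\<Prod>a\<in>A1. indicator {x. \<bar>P a x\<bar> \<le> \<epsilon> a} (x(v := y)) :: ennreal)"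
          using fin by (simp add: prod.union_disjoint)
        \<comment> \<open>With exponent 0 in v the polynomial equals Q a, so its constraint does not
          involve y and leaves the inner integral.\<close>
        also have "(\<Prod>a\<in>A0. indicator {x. \<bar>P a x\<bar> \<le> \<epsilon> a} (x(v := y))) = ?I0"
          using Pe by (intro prod.cong) (auto simp: A0_def indicator_def)
        finally have eq: "(\<Prod>a\<in>A. indicator {x. \<bar>P a x\<bar> \<le> \<epsilon> a} (x(v := y))) =
          ?I0 * (\<Prod>a\<in>A1. indicator {x. \<bar>P a x\<bar> \<le> \<epsilon> a} (x(v := y)) :: ennreal)" .
        show ?thesis unfolding eq by (simp add: mult_ac indicator_def del: fun_upd_apply)
      qed
      then have "(\<integral>\<^sup>+y. ?F (x(v := y)) \<partial>lborel) = (\<integral>\<^sup>+y. ?I0 * ?H y \<partial>lborel)" by simp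
      also have "\<dots> = ?I0 * (\<integral>\<^sup>+y. ?H y \<partial>lborel)" using Hm by (intro nn_integral_cmult) auto
      also have "(\<integral>\<^sup>+y. ?H y \<partial>lborel) \<le> ennreal C1 * (\<Prod>a\<in>A1. ennreal (\<epsilon> a powr \<theta>) * wt \<theta> (Q a x)) * (\<Prod>b\<in>B. wt \<theta> (Q b x))"
      proof (rule C1(2))
        show "\<forall>a\<in>A1 \<union> B. (\<lambda>y. P a (x(v := y))) \<in> borel_measurable borel \<and> (\<exists>c. \<forall>y. P a (x(v := y)) = Q a x * y ^ \<alpha> a v + (\<Sum>j<\<alpha> a v. c j * y ^ j))"
        proof
          fix a assume "a \<in> A1 \<union> B"
          then have a: "a \<in> A \<union> B" by (auto simp: fin)
          show "(\<lambda>y. P a (x(v := y))) \<in> borel_measurable borel \<and> (\<exists>c. \<forall>y. P a (x(v := y)) = Q a x * y ^ \<alpha> a v + (\<Sum>j<\<alpha> a v. c j * y ^ j))"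
            using Pb[OF a] Pe[OF a, of x] by (intro conjI exI[of _ "\<lambda>j. c a j x"]) auto
        qed
      qed (use \<epsilon> fin in auto)
      finally have "(\<integral>\<^sup>+y. ?F (x(v := y)) \<partial>lborel) \<le> ?I0 * (ennreal C1 * (\<Prod>a\<in>A1. ennreal (\<epsilon> a powr \<theta>) * wt \<theta> (Q a x)) * (\<Prod>b\<in>B. wt \<theta> (Q b x)))"
        by (simp add: mult_left_mono)
      also have "\<dots> = ennreal C1 * ?E1 * ?G x"
        using fin Cons.prems(2,3) by (simp add: prod.union_disjoint prod.distrib mult_ac)
      finally show ?thesis .
    qed
    have "(\<integral>\<^sup>+x. ?F x \<partial>Pi\<^sub>M (set (v # vs)) (\<lambda>_. lborel)) = (\<integral>\<^sup>+x. (\<integral>\<^sup>+y. ?F (x(v := y)) \<partial>lborel) \<partial>Pi\<^sub>M (set vs) (\<lambda>_. lborel))"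
      using product_nn_integral_insert[of "set vs" v ?F] Fm Cons.prems(1) by simp
    also have "\<dots> \<le> (\<integral>\<^sup>+x. ennreal C1 * ?E1 * ?G x \<partial>Pi\<^sub>M (set vs) (\<lambda>_. lborel))"
      by (intro nn_integral_mono fiber)
    also have "\<dots> = ennreal C1 * ?E1 * (\<integral>\<^sup>+x. ?G x \<partial>Pi\<^sub>M (set vs) (\<lambda>_. lborel))"
      by (intro nn_integral_cmult Gm)
    also have "\<dots> \<le> ennreal C1 * ?E1 * (ennreal C2 * (\<Prod>a\<in>A0. ennreal (\<epsilon> a powr \<theta>)))"
      using Q \<epsilon> by (intro mult_left_mono C2(2)) (auto simp: fin)
    also have "\<dots> = ennreal (C1 * C2) * (\<Prod>a\<in>A. ennreal (\<epsilon> a powr \<theta>))"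
      using fin C1 C2 by (simp add: prod.union_disjoint ennreal_mult mult_ac)
    finally show "(\<integral>\<^sup>+x. ?F x \<partial>Pi\<^sub>M (set (v # vs)) (\<lambda>_. lborel)) \<le> ennreal (C1 * C2) * (\<Prod>a\<in>A. ennreal (\<epsilon> a powr \<theta>))" .
  qed
qed

subsection \<open>Polynomials with lexicographic leading monomials\<close>

lemma measurable_vec_lambda_PiM:
  "(\<lambda>x. \<chi> i. x i) \<in> Pi\<^sub>M UNIV (\<lambda>_. lborel) \<rightarrow>\<^sub>M (borel :: (real ^ 'n::finite) measure)"
proof (subst borel_measurable_euclidean_space, rule ballI)
  fix b :: "real ^ 'n" assume "b \<in> Basis"
  then obtain i where "b = axis i 1" by (auto simp: Basis_vec_def)
  then show "(\<lambda>x. (\<chi> i. x i) \<bullet> b) \<in> borel_measurable (Pi\<^sub>M UNIV (\<lambda>_. lborel))"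
    by (simp add: inner_axis)
qed

lemma prod_Basis_vec:
  fixes f :: "real ^ 'n::finite \<Rightarrow> 'b::comm_monoid_mult"
  shows "prod f Basis = (\<Prod>i\<in>UNIV. f (axis i 1))"
proof -
  have "Basis = range (\<lambda>i. axis i (1::real) :: real ^ 'n)"
    by (auto simp: Basis_vec_def)
  moreover have "inj (\<lambda>i. axis i (1::real) :: real ^ 'n)"
    by (auto simp: inj_def axis_eq_axis)
  ultimately show ?thesis
    using prod.reindex[of "\<lambda>i. axis i (1::real) :: real ^ 'n" UNIV f] by (simp add: o_def)
qed

lemma lborel_vec_eq:
  "(lborel :: (real ^ 'n::finite) measure) = distr (Pi\<^sub>M UNIV (\<lambda>_. lborel)) borel (\<lambda>x. \<chi> i. x i)"
proof (rule lborel_eqI)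
  interpret product_sigma_finite "\<lambda>_::'n. lborel :: real measure" by (rule product_sigma_finite_lborel)
  fix l u :: "real ^ 'n" assume lu: "\<And>b. b \<in> Basis \<Longrightarrow> l \<bullet> b \<le> u \<bullet> b"
  have le: "l $ i \<le> u $ i" for i
    using lu[of "axis i 1"] by (simp add: inner_axis)
  have "(\<lambda>x. \<chi> i. x i) -` box l u \<inter> space (Pi\<^sub>M UNIV (\<lambda>_. lborel :: real measure)) = Pi\<^sub>E UNIV (\<lambda>i. {l $ i <..< u $ i})"
    by (auto simp: space_PiM mem_box_cart PiE_iff)
  then have "emeasure (distr (Pi\<^sub>M UNIV (\<lambda>_. lborel)) borel (\<lambda>x. \<chi> i. x i)) (box l u)
      = emeasure (Pi\<^sub>M UNIV (\<lambda>_. lborel)) (Pi\<^sub>E UNIV (\<lambda>i. {l $ i <..< u $ i}))"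
    by (subst emeasure_distr) (auto intro: measurable_vec_lambda_PiM)
  also have "\<dots> = (\<Prod>i\<in>UNIV. ennreal (u $ i - l $ i))"
    by (subst emeasure_PiM) (auto simp: le)
  also have "\<dots> = ennreal (\<Prod>b\<in>Basis. (u - l) \<bullet> b)"
    by (subst prod_ennreal) (auto simp: le prod_Basis_vec inner_axis)
  finally show "emeasure (distr (Pi\<^sub>M UNIV (\<lambda>_. lborel)) borel (\<lambda>x. \<chi> i. x i)) (box l u) = ennreal (\<Prod>b\<in>Basis. (u - l) \<bullet> b)" .
qed simp

lemma nn_integral_lborel_vec:
  assumes "f \<in> borel_measurable (borel :: (real ^ 'n::finite) measure)"
  shows "(\<integral>\<^sup>+t. f t \<partial>lborel) = (\<integral>\<^sup>+x. f (\<chi> i. x i) \<partial>Pi\<^sub>M UNIV (\<lambda>_. lborel))"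
  using assms by (subst lborel_vec_eq, subst nn_integral_distr) (auto intro: measurable_vec_lambda_PiM)

text \<open>Terms are grouped by their exponent of the head variable v. Being lexicographically
  smaller, they have exponent at most \<alpha> v there, and those that reach it are smaller than
  \<alpha> in the tail. The latter join the leading coefficient, which is therefore of the same
  form; all others go into the lower coefficients.\<close>

lemma lexmonic_monomial_combination:
  fixes c :: "('v \<Rightarrow> nat) \<Rightarrow> real"
  assumes "distinct vs" "finite J" "\<And>\<beta>. \<beta> \<in> J \<Longrightarrow> map \<beta> vs < map \<alpha> vs"
  shows "lexmonic vs \<alpha> (\<lambda>x. (\<Prod>v\<in>set vs. x v ^ \<alpha> v) + (\<Sum>\<beta>\<in>J. c \<beta> * (\<Prod>v\<in>set vs. x v ^ \<beta> v)))"
  using assms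
proof (induction vs arbitrary: J)
  case Nil
  then show ?case by (cases "J = {}") auto
next
  case (Cons v vs)
  let ?m = "\<lambda>\<beta> x. \<Prod>v\<in>set vs. x v ^ \<beta> v"
  let ?P = "(\<lambda>x. (\<Prod>v\<in>set (v # vs). x v ^ \<alpha> v) + (\<Sum>\<beta>\<in>J. c \<beta> * (\<Prod>v\<in>set (v # vs). x v ^ \<beta> v)))"
  define J' where "J' = {\<beta>\<in>J. \<beta> v = \<alpha> v}"
  let ?Q = "\<lambda>x. ?m \<alpha> x + (\<Sum>\<beta>\<in>J'. c \<beta> * ?m \<beta> x)"
  let ?c = "\<lambda>j x. \<Sum>\<beta>\<in>{\<beta>\<in>J. \<beta> v = j}. c \<beta> * ?m \<beta> x"
  have le: "\<beta> v \<le> \<alpha> v" if "\<beta> \<in> J" for \<beta>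
    using Cons.prems(3)[OF that] by auto
  have "lexmonic vs \<alpha> ?Q"
  proof (rule Cons.IH)
    fix \<beta> assume "\<beta> \<in> J'"
    then show "map \<beta> vs < map \<alpha> vs" using Cons.prems(3)[of \<beta>] by (simp add: J'_def)
  qed (use Cons.prems(1,2) in \<open>auto simp: J'_def\<close>)
  moreover have "?P (x(v := y)) = ?Q x * y ^ \<alpha> v + (\<Sum>j<\<alpha> v. ?c j x * y ^ j)" for x y
  proof -
    have m: "(\<Prod>w\<in>set (v # vs). (x(v := y)) w ^ \<beta> w) = y ^ \<beta> v * ?m \<beta> x" for \<beta>
    proof -
      have "(\<Prod>w\<in>set vs. (x(v := y)) w ^ \<beta> w) = ?m \<beta> x"
        using Cons.prems(1) by (intro prod.cong) auto
      then show ?thesis using Cons.prems(1) by simp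
    qed
    have "(\<Sum>\<beta>\<in>J. c \<beta> * (y ^ \<beta> v * ?m \<beta> x)) = (\<Sum>j\<le>\<alpha> v. \<Sum>\<beta>\<in>{\<beta>\<in>J. \<beta> v = j}. c \<beta> * (y ^ \<beta> v * ?m \<beta> x))"
      using Cons.prems(2) le by (intro sum.group[symmetric]) auto
    also have "\<dots> = (\<Sum>j\<le>\<alpha> v. ?c j x * y ^ j)"
      by (intro sum.cong refl) (simp add: sum_distrib_left mult_ac)
    also have "\<dots> = ?c (\<alpha> v) x * y ^ \<alpha> v + (\<Sum>j<\<alpha> v. ?c j x * y ^ j)"
      by (simp add: lessThan_Suc_atMost[symmetric])
    finally show ?thesis
      unfolding m by (simp add: J'_def algebra_simps)
  qed
  ultimately show ?case
    unfolding lexmonic.simps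
    by (intro conjI exI[of _ ?Q] exI[of _ ?c] allI) (simp_all del: set_simps, measurable)
qed

section \<open>The lexicographic enumeration of monomials\<close>

lemma monomial_0 [simp]: "monomial t 0 = 1"
  by (simp add: monomial_def)

lemma measurable_monomial [measurable]: "(\<lambda>t. monomial t \<alpha>) \<in> borel_measurable borel"
  unfolding monomial_def by measurable

text \<open>Exponents are compared as lists along a fixed ordering \<open>vs\<close> of the
  variables. The second condition on \<open>\<theta>\<close> is the balance condition of the
  iterated integration for every variable at once; one value can serve all of them because the index
  set is symmetric in the variables.\<close>

locale multiindex_enumeration =
  fixes d N :: nat and e :: "nat \<Rightarrow> nat ^ 'n::finite" and vs :: "'n list" and \<theta> :: real
  assumes d: "d \<ge> 1"
    and bij: "bij_betw e {..<N} (multiindices d)"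
    and vs: "distinct vs" "set vs = UNIV"
    and lex: "\<And>i k. i < k \<Longrightarrow> k < N \<Longrightarrow> map (($) (e i)) vs < map (($) (e k)) vs"
    and \<theta>: "\<theta> > 0" "\<And>v. \<theta> * (\<Sum>\<alpha>\<in>(multiindices d :: (nat ^ 'n) set). \<alpha> $ v) = 1"
begin

lemma e_zero: "e 0 = 0" and N_pos: "N > 0"
proof -
  have "0 \<in> (multiindices d :: (nat ^ 'n) set)" by (simp add: multiindices_def)
  then have "0 \<in> e ` {..<N}" using bij by (simp add: bij_betw_def)
  then obtain k where k: "k < N" "e k = 0" by auto
  then show "N > 0" by simp
  have "\<not> 0 < k"
  proof
    assume "0 < k"
    then have "map (($) (e 0)) vs < map (\<lambda>_. 0) vs" using lex[of 0 k] k by (simp add: zero_vec_def map_eq_conv[symmetric] cong: map_cong)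
    moreover have "\<not> map f us < map (\<lambda>_. 0) us" for f :: "'n \<Rightarrow> nat" and us
      by (induction us) auto
    ultimately show False by blast
  qed
  then show "e 0 = 0" using k by simp
qed

definition lowcomb :: "(nat \<Rightarrow> real) \<Rightarrow> nat \<Rightarrow> real ^ 'n \<Rightarrow> real" where
  "lowcomb c k t = monomial t (e k) + (\<Sum>i<k. c i * monomial t (e i))"

lemma measurable_lowcomb [measurable]: "lowcomb c k \<in> borel_measurable borel"
  unfolding lowcomb_def[abs_def] by measurable

lemma lowcomb_0 [simp]: "lowcomb c 0 t = 1"
  by (simp add: lowcomb_def e_zero)

lemma lexmonic_lowcomb:
  assumes "k < N"
  shows "lexmonic vs (($) (e k)) (\<lambda>x. lowcomb c k (\<chi> i. x i))"
proof -
  have inj: "inj_on (\<lambda>i. ($) (e i)) {..<k}"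
  proof (rule inj_onI)
    fix i j assume "i \<in> {..<k}" "j \<in> {..<k}" "($) (e i) = ($) (e j)"
    then show "i = j" using bij assms by (auto simp: bij_betw_def inj_on_def vec_eq_iff fun_eq_iff)
  qed
  \<comment> \<open>The general statement indexes coefficients by exponents, \<open>lowcomb\<close>
    by positions; \<open>c'\<close> translates along the injective enumeration.\<close>
  define c' where "c' \<beta> = c (the_inv_into {..<k} (\<lambda>i. ($) (e i)) \<beta>)" for \<beta>
  have "lexmonic vs (($) (e k)) (\<lambda>x. (\<Prod>v\<in>set vs. x v ^ (e k $ v)) + (\<Sum>\<beta>\<in>(\<lambda>i. ($) (e i)) ` {..<k}. c' \<beta> * (\<Prod>v\<in>set vs. x v ^ \<beta> v)))"
    using lex assms by (intro lexmonic_monomial_combination vs) auto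
  also have "(\<lambda>x. (\<Prod>v\<in>set vs. x v ^ (e k $ v)) + (\<Sum>\<beta>\<in>(\<lambda>i. ($) (e i)) ` {..<k}. c' \<beta> * (\<Prod>v\<in>set vs. x v ^ \<beta> v)))
     = (\<lambda>x. lowcomb c k (\<chi> i. x i))"
    using inj the_inv_into_f_f[OF inj]
    by (auto simp: lowcomb_def sum.reindex c'_def monomial_def vs fun_eq_iff intro!: sum.cong)
  finally show ?thesis .
qed

text \<open>The iterated integration starts with no weights and all polynomials as constraints.
  Index 0 is omitted: its polynomial is the constant 1, so its constraint does not depend on t, and
  its exponents contribute nothing to the balance.\<close>

lemma sublevel_lowcomb:
  "\<exists>C>0. \<forall>c \<epsilon>. (\<forall>k\<in>{1..<N}. \<epsilon> k > 0) \<longrightarrow>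
     emeasure lborel {t. \<forall>k\<in>{1..<N}. \<bar>lowcomb (c k) k t\<bar> \<le> \<epsilon> k} \<le> ennreal (C * (\<Prod>k\<in>{1..<N}. \<epsilon> k powr \<theta>))"
proof -
  have "\<exists>C>0. \<forall>P \<epsilon>. (\<forall>a\<in>{1..<N} \<union> {}. lexmonic vs (($) (e a)) (P a)) \<longrightarrow> (\<forall>a\<in>{1..<N}. \<epsilon> a > 0) \<longrightarrow>
    (\<integral>\<^sup>+x. (\<Prod>a\<in>{1..<N}. indicator {x. \<bar>P a x\<bar> \<le> \<epsilon> a} x) * (\<Prod>b\<in>{}. wt \<theta> (P b x)) \<partial>Pi\<^sub>M (set vs) (\<lambda>_. lborel))
     \<le> ennreal C * (\<Prod>a\<in>{1..<N}. ennreal (\<epsilon> a powr \<theta>))"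
  proof (rule lexmonic_sublevel_bound)
    fix v
    have "(\<Sum>a\<in>{1..<N}. e a $ v) = (\<Sum>a\<in>{..<N}. e a $ v)"
      by (intro sum.mono_neutral_left) (auto simp: e_zero not_le)
    also have "\<dots> = (\<Sum>\<alpha>\<in>multiindices d. \<alpha> $ v)"
      by (rule sum.reindex_bij_betw[OF bij])
    finally show "\<theta> * (\<Sum>a\<in>{1..<N} \<union> {}. e a $ v) = 1" using \<theta>(2)[of v] by simp
  next
    fix us v ws assume us: "vs = us @ v # ws"
    \<comment> \<open>The coordinate t_v is itself a monomial of the family because d \<ge> 1. It
      involves no variable before v, so it is unspent when v is integrated.\<close>
    have "axis v 1 \<in> (multiindices d :: (nat ^ 'n) set)"
      using d by (simp add: multiindices_def axis_def)
    then have "axis v 1 \<in> e ` {..<N}" using bij by (simp add: bij_betw_def)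
    then obtain k where k: "k < N" "e k = axis v 1" by auto
    have "k \<noteq> 0" using k e_zero by (metis axis_eq_0_iff one_neq_zero)
    moreover have "v \<notin> set us" using vs(1) us by auto
    ultimately show "\<exists>a\<in>{1..<N}. 1 \<le> e a $ v \<and> (\<forall>u\<in>set us. e a $ u = 0)"
      using k by (intro bexI[of _ k]) (auto simp: axis_def)
  qed (use vs \<theta> in auto)
  then obtain C where C: "C > 0" "\<And>P \<epsilon>. (\<forall>a\<in>{1..<N}. lexmonic vs (($) (e a)) (P a)) \<Longrightarrow> (\<forall>a\<in>{1..<N}. \<epsilon> a > 0) \<Longrightarrow>
    (\<integral>\<^sup>+x. (\<Prod>a\<in>{1..<N}. indicator {x. \<bar>P a x\<bar> \<le> \<epsilon> a} x) \<partial>Pi\<^sub>M UNIV (\<lambda>_. lborel))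
     \<le> ennreal C * (\<Prod>a\<in>{1..<N}. ennreal (\<epsilon> a powr \<theta>))" by (auto simp: vs)
  show ?thesis
  proof (intro exI[of _ C] conjI allI impI C(1))
    fix c and \<epsilon> :: "nat \<Rightarrow> real" assume \<epsilon>: "\<forall>k\<in>{1..<N}. \<epsilon> k > 0"
    let ?S = "{t. \<forall>k\<in>{1..<N}. \<bar>lowcomb (c k) k t\<bar> \<le> \<epsilon> k}"
    have [measurable]: "?S \<in> sets borel" by measurable
    have "emeasure lborel ?S = (\<integral>\<^sup>+t. indicator ?S t \<partial>lborel)" by simp
    also have "\<dots> = (\<integral>\<^sup>+x. indicator ?S (\<chi> i. x i) \<partial>Pi\<^sub>M UNIV (\<lambda>_. lborel))"
      by (rule nn_integral_lborel_vec) auto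
    also have "\<dots> = (\<integral>\<^sup>+x. (\<Prod>a\<in>{1..<N}. indicator {x. \<bar>lowcomb (c a) a (\<chi> i. x i)\<bar> \<le> \<epsilon> a} x) \<partial>Pi\<^sub>M UNIV (\<lambda>_. lborel))"
      by (intro nn_integral_cong) (auto simp: indicator_def prod_zero_iff Ball_def)
    also have "\<dots> \<le> ennreal C * (\<Prod>a\<in>{1..<N}. ennreal (\<epsilon> a powr \<theta>))"
      using \<epsilon> by (intro C(2)) (auto intro: lexmonic_lowcomb)
    also have "\<dots> = ennreal (C * (\<Prod>k\<in>{1..<N}. \<epsilon> k powr \<theta>))"
      using C(1) by (simp add: prod_ennreal ennreal_mult prod_nonneg)
    finally show "emeasure lborel ?S \<le> ennreal (C * (\<Prod>k\<in>{1..<N}. \<epsilon> k powr \<theta>))" .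
  qed
qed

text \<open>Dyadic summation over the values of W = \<Sum> |P_k|^m / D_k. On {W \<le> 2s} each |P_k|
  is at most (2 s D_k)^(1/m), so this set has measure of order s^((N-1)\<eta>), where \<eta> =
  \<theta>/m. The integrand has size s^(-N\<eta>), which leaves a factor s^(-\<eta>) and a geometric
  series governed by the smallest scale 1/D_0. That lower bound for W comes from P_0 = 1, and it
  supplies the factor D_0^\<eta> that the sublevel estimate lacks.\<close>

lemma testing_integral_bound:
  assumes m: "m \<ge> (1::nat)"
  shows "\<exists>C>0. \<forall>c D. (\<forall>k<N. D k > 0) \<longrightarrow>
    (\<integral>\<^sup>+t. ennreal ((\<Sum>k<N. \<bar>lowcomb (c k) k t\<bar> ^ m / D k) powr - (N * \<theta> / m)) \<partial>lborel)
      \<le> ennreal (C * (\<Prod>k<N. D k powr (\<theta> / m)))"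
proof -
  obtain C where C: "C > 0" "\<And>c \<epsilon>. (\<forall>k\<in>{1..<N}. \<epsilon> k > 0) \<Longrightarrow>
     emeasure lborel {t. \<forall>k\<in>{1..<N}. \<bar>lowcomb (c k) k t\<bar> \<le> \<epsilon> k} \<le> ennreal (C * (\<Prod>k\<in>{1..<N}. \<epsilon> k powr \<theta>))"
    using sublevel_lowcomb by blast
  define \<eta> where "\<eta> = \<theta> / m"
  have \<eta>: "\<eta> > 0" using \<theta> m by (simp add: \<eta>_def)
  define \<rho> where "\<rho> = (2::real) powr - \<eta>"
  have \<rho>: "0 < \<rho>" "\<rho> < 1" using \<eta> by (auto simp: \<rho>_def powr_less_one)
  define C' where "C' = C * 2 powr ((N - 1) * \<eta>) / (1 - \<rho>)"
  show ?thesis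
  proof (intro exI[of _ C'] conjI allI impI)
    show "C' > 0" using C(1) \<rho> by (simp add: C'_def)
    fix c :: "nat \<Rightarrow> nat \<Rightarrow> real" and D :: "nat \<Rightarrow> real" assume D: "\<forall>k<N. D k > 0"
    have D0: "D 0 > 0" using D N_pos by simp
    define W where "W t = (\<Sum>k<N. \<bar>lowcomb (c k) k t\<bar> ^ m / D k)" for t
    have Wm[measurable]: "W \<in> borel_measurable borel" unfolding W_def[abs_def] by measurable
    have Wk: "\<bar>lowcomb (c k) k t\<bar> ^ m / D k \<le> W t" if "k < N" for k t
      unfolding W_def using D that by (intro member_le_sum) (auto simp: less_imp_le)
    have W0: "1 / D 0 \<le> W t" for t using Wk[of 0 t] N_pos by simp
    define s where "s j = 2 ^ j / D 0" for j :: nat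
    have s: "s j > 0" for j using D0 by (simp add: s_def)
    define \<kappa> where "\<kappa> = N * \<eta>"
    define R where "R = (\<Prod>k\<in>{1..<N}. D k powr \<eta>)"
    have R: "R > 0" unfolding R_def using D by (intro prod_pos) force
    have meas: "emeasure lborel {t. W t \<le> 2 * s j} \<le> ennreal (C * ((2 * s j) powr ((N - 1) * \<eta>) * R))" for j
    proof -
      let ?\<epsilon> = "\<lambda>k. (2 * s j * D k) powr (1 / m)"
      have "{t. W t \<le> 2 * s j} \<subseteq> {t. \<forall>k\<in>{1..<N}. \<bar>lowcomb (c k) k t\<bar> \<le> ?\<epsilon> k}"
      proof safe
        fix t k assume W: "W t \<le> 2 * s j" and k: "k \<in> {1..<N}"
        then have "\<bar>lowcomb (c k) k t\<bar> ^ m / D k \<le> 2 * s j" using Wk[of k t] by auto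
        then have "\<bar>lowcomb (c k) k t\<bar> ^ m \<le> 2 * s j * D k" using D k by (simp add: field_simps)
        also have "\<dots> = ?\<epsilon> k ^ m"
        proof -
          have "2 * s j * D k > 0" using D k s[of j] by simp
          then show ?thesis using m by (subst powr_power) auto
        qed
        finally show "\<bar>lowcomb (c k) k t\<bar> \<le> ?\<epsilon> k" using m by (subst (asm) power_mono_iff) auto
      qed
      then have "emeasure lborel {t. W t \<le> 2 * s j} \<le> emeasure lborel {t. \<forall>k\<in>{1..<N}. \<bar>lowcomb (c k) k t\<bar> \<le> ?\<epsilon> k}"
        by (rule emeasure_mono) (simp, measurable)
      also have "\<dots> \<le> ennreal (C * (\<Prod>k\<in>{1..<N}. ?\<epsilon> k powr \<theta>))"
        using D s[of j] by (intro C(2)) auto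
      also have "(\<Prod>k\<in>{1..<N}. ?\<epsilon> k powr \<theta>) = (\<Prod>k\<in>{1..<N}. (2 * s j) powr \<eta> * D k powr \<eta>)"
        using D s[of j] by (intro prod.cong) (auto simp: powr_powr \<eta>_def powr_mult less_imp_le)
      also have "\<dots> = (2 * s j) powr ((N - 1) * \<eta>) * R"
        using s[of j] N_pos by (simp add: prod.distrib R_def powr_power mult.commute)
      finally show ?thesis .
    qed
    have pt: "ennreal (W t powr - \<kappa>) \<le> (\<Sum>j. ennreal (s j powr - \<kappa>) * indicator {t. W t \<le> 2 * s j} t)" for t
    proof -
      have W1: "W t * D 0 \<ge> 1" using W0[of t] D0 by (simp add: field_simps)
      \<comment> \<open>The dyadic scale of t, with s i \<le> W t \<le> 2 * s i. The logarithm is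
        nonnegative as W t * D 0 \<ge> 1, so \<open>nat\<close> loses nothing.\<close>
      define i where "i = nat \<lfloor>log 2 (W t * D 0)\<rfloor>"
      have "real i \<le> log 2 (W t * D 0)" "log 2 (W t * D 0) \<le> real (Suc i)"
        using W1 by (auto simp: i_def of_nat_nat) linarith
      then have "2 ^ i \<le> W t * D 0" "W t * D 0 \<le> 2 ^ Suc i"
        using W1 by (auto simp: le_log_iff log_le_iff powr_realpow[symmetric] simp del: power_Suc)
      then have i: "s i \<le> W t" "W t \<le> 2 * s i" using D0 by (auto simp: s_def field_simps)
      have "ennreal (W t powr - \<kappa>) \<le> ennreal (s i powr - \<kappa>) * indicator {t. W t \<le> 2 * s i} t"
        using i s[of i] \<eta> by (auto simp: \<kappa>_def intro!: ennreal_leI powr_mono2')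
      also have "\<dots> \<le> (\<Sum>j. ennreal (s j powr - \<kappa>) * indicator {t. W t \<le> 2 * s j} t)"
        using sum_le_suminf[OF summableI, of "{i}" "\<lambda>j. ennreal (s j powr - \<kappa>) * indicator {t. W t \<le> 2 * s j} t"]
        by (simp del: sum_mult_indicator)
      finally show ?thesis .
    qed
    \<comment> \<open>All but one of the N factors s_j^(-\<eta>) cancel against the measure bound.
      The one left equals 2^(-j\<eta>) D_0^\<eta>, hence the ratio \<open>\<rho>\<close>.\<close>
    have summand: "s j powr - \<kappa> * (C * ((2 * s j) powr ((N - 1) * \<eta>) * R)) = C * 2 powr ((N - 1) * \<eta>) * (D 0 powr \<eta> * R) * \<rho> ^ j" for j
    proof -
      have "s j powr - \<kappa> * s j powr ((N - 1) * \<eta>) = s j powr (- \<eta>)"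
        using N_pos s[of j] by (simp add: powr_add[symmetric] \<kappa>_def of_nat_diff algebra_simps)
      also have "\<dots> = \<rho> ^ j * D 0 powr \<eta>"
        using D0 by (simp add: s_def powr_divide powr_minus \<rho>_def powr_power powr_realpow[symmetric] powr_powr mult.commute divide_simps)
      finally show ?thesis
        using s[of j] by (simp add: powr_mult mult_ac)
    qed
    have "(\<integral>\<^sup>+t. ennreal (W t powr - \<kappa>) \<partial>lborel) \<le> (\<integral>\<^sup>+t. (\<Sum>j. ennreal (s j powr - \<kappa>) * indicator {t. W t \<le> 2 * s j} t) \<partial>lborel)"
      by (intro nn_integral_mono pt)
    also have "\<dots> = (\<Sum>j. \<integral>\<^sup>+t. ennreal (s j powr - \<kappa>) * indicator {t. W t \<le> 2 * s j} t \<partial>lborel)"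
      by (intro nn_integral_suminf) auto
    also have "\<dots> = (\<Sum>j. ennreal (s j powr - \<kappa>) * emeasure lborel {t. W t \<le> 2 * s j})"
      by (simp add: nn_integral_cmult_indicator)
    also have "\<dots> \<le> (\<Sum>j. ennreal (s j powr - \<kappa>) * ennreal (C * ((2 * s j) powr ((N - 1) * \<eta>) * R)))"
      by (intro suminf_le mult_left_mono meas) auto
    also have "\<dots> = (\<Sum>j. ennreal (C * 2 powr ((N - 1) * \<eta>) * (D 0 powr \<eta> * R) * \<rho> ^ j))"
      unfolding summand[symmetric] using C(1) R by (simp add: ennreal_mult[symmetric])
    also have "\<dots> = ennreal (\<Sum>j. C * 2 powr ((N - 1) * \<eta>) * (D 0 powr \<eta> * R) * \<rho> ^ j)"
      using C(1) R \<rho> by (intro suminf_ennreal2 summable_mult summable_geometric) auto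
    also have "(\<Sum>j. C * 2 powr ((N - 1) * \<eta>) * (D 0 powr \<eta> * R) * \<rho> ^ j) = C' * (D 0 powr \<eta> * R)"
      using \<rho> by (simp add: suminf_mult suminf_geometric summable_geometric C'_def)
    also have "D 0 powr \<eta> * R = (\<Prod>k<N. D k powr \<eta>)"
    proof -
      have "{..<N} = insert 0 {1..<N}" using N_pos by auto
      then show ?thesis by (simp add: R_def)
    qed
    finally show "(\<integral>\<^sup>+t. ennreal ((\<Sum>k<N. \<bar>lowcomb (c k) k t\<bar> ^ m / D k) powr - (N * \<theta> / m)) \<partial>lborel)
      \<le> ennreal (C' * (\<Prod>k<N. D k powr (\<theta> / m)))"
      by (simp add: W_def \<kappa>_def \<eta>_def)
  qed
qed

text \<open>Hoelder's inequality for g = (g W^(1/p)) W^(-1/p) with W = \<Sum> |P_k|^m / D_k. The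
  p-th power of the first factor has integral at most N by the moment bounds; the second gives the
  testing integral with exponent \<kappa> = 1/(p-1). Positive upper bounds \<open>D\<close> stand in
  for the moments themselves, since a moment may vanish and W divides by it.\<close>

lemma integral_le_prod_moments:
  fixes p :: real
  assumes m: "m \<ge> (1::nat)" and p: "p = 1 + m / (N * \<theta>)"
  shows "\<exists>C>0. \<forall>g c D. g \<in> borel_measurable borel \<longrightarrow> (\<forall>t. g t \<ge> 0) \<longrightarrow> (\<forall>k<N. D k > 0) \<longrightarrow>
    (\<forall>k<N. (\<integral>\<^sup>+t. ennreal (\<bar>lowcomb (c k) k t\<bar> ^ m * g t powr p) \<partial>lborel) \<le> ennreal (D k)) \<longrightarrow>
    (\<integral>\<^sup>+t. ennreal (g t) \<partial>lborel) \<le> ennreal (C * (\<Prod>k<N. D k powr (1 / (N * p))))"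
proof -
  obtain C where C: "C > 0" "\<And>c D. (\<forall>k<N. D k > 0) \<Longrightarrow>
    (\<integral>\<^sup>+t. ennreal ((\<Sum>k<N. \<bar>lowcomb (c k) k t\<bar> ^ m / D k) powr - (N * \<theta> / m)) \<partial>lborel)
      \<le> ennreal (C * (\<Prod>k<N. D k powr (\<theta> / m)))"
    using testing_integral_bound[OF m] by blast
  define \<kappa> where "\<kappa> = N * \<theta> / m"
  have \<kappa>: "\<kappa> > 0" using N_pos \<theta> m by (simp add: \<kappa>_def)
  have p': "p = 1 + 1 / \<kappa>" using N_pos \<theta> m by (simp add: p \<kappa>_def)
  define C' where "C' = (N + 1) * C powr (1 / (1 + \<kappa>))"
  show ?thesis
  proof (intro exI[of _ C'] conjI allI impI)
    show "C' > 0" using C(1) by (simp add: C'_def)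
    fix g :: "real ^ 'n \<Rightarrow> real" and c :: "nat \<Rightarrow> nat \<Rightarrow> real" and D :: "nat \<Rightarrow> real"
    assume g[measurable]: "g \<in> borel_measurable borel" and g0: "\<forall>t. g t \<ge> 0" and D: "\<forall>k<N. D k > 0"
      and le: "\<forall>k<N. (\<integral>\<^sup>+t. ennreal (\<bar>lowcomb (c k) k t\<bar> ^ m * g t powr p) \<partial>lborel) \<le> ennreal (D k)"
    define W where "W t = (\<Sum>k<N. \<bar>lowcomb (c k) k t\<bar> ^ m / D k)" for t
    have Wm[measurable]: "W \<in> borel_measurable borel" unfolding W_def[abs_def] by measurable
    have "1 / D 0 \<le> W t" for t
      using member_le_sum[of 0 "{..<N}" "\<lambda>k. \<bar>lowcomb (c k) k t\<bar> ^ m / D k"] D N_pos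
      by (auto simp: W_def less_imp_le)
    then have W: "W t > 0" for t
      using D N_pos by (meson less_le_trans zero_less_divide_1_iff)
    define B where "B = C * (\<Prod>k<N. D k powr (\<theta> / m))"
    have B: "B > 0" unfolding B_def using C(1) D by (intro mult_pos_pos prod_pos) force+
    have intW: "(\<integral>\<^sup>+t. ennreal (W t powr - \<kappa>) \<partial>lborel) \<le> ennreal B"
      using C(2)[OF D] unfolding W_def B_def \<kappa>_def .
    have intgW: "(\<integral>\<^sup>+t. ennreal (g t powr p * W t) \<partial>lborel) \<le> ennreal N"
    proof -
      have "(\<integral>\<^sup>+t. ennreal (g t powr p * W t) \<partial>lborel) = (\<integral>\<^sup>+t. (\<Sum>k<N. ennreal (1 / D k) * ennreal (\<bar>lowcomb (c k) k t\<bar> ^ m * g t powr p)) \<partial>lborel)"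
      proof (intro nn_integral_cong)
        fix t
        have "g t powr p * W t = (\<Sum>k<N. (1 / D k) * (\<bar>lowcomb (c k) k t\<bar> ^ m * g t powr p))"
          by (simp add: W_def sum_distrib_left mult_ac)
        also have "ennreal \<dots> = (\<Sum>k<N. ennreal ((1 / D k) * (\<bar>lowcomb (c k) k t\<bar> ^ m * g t powr p)))"
          using D by (intro sum_ennreal[symmetric]) (simp add: less_imp_le)
        also have "\<dots> = (\<Sum>k<N. ennreal (1 / D k) * ennreal (\<bar>lowcomb (c k) k t\<bar> ^ m * g t powr p))"
          using D by (intro sum.cong refl ennreal_mult) (auto simp: less_imp_le)
        finally show "ennreal (g t powr p * W t) = (\<Sum>k<N. ennreal (1 / D k) * ennreal (\<bar>lowcomb (c k) k t\<bar> ^ m * g t powr p))" .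
      qed
      also have "\<dots> = (\<Sum>k<N. ennreal (1 / D k) * (\<integral>\<^sup>+t. ennreal (\<bar>lowcomb (c k) k t\<bar> ^ m * g t powr p) \<partial>lborel))"
        by (subst nn_integral_sum) (auto simp: nn_integral_cmult)
      also have "\<dots> \<le> (\<Sum>k<N. ennreal (1 / D k) * ennreal (D k))"
        using le by (intro sum_mono mult_left_mono) auto
      also have "\<dots> = (\<Sum>k<N. 1)"
        using D by (intro sum.cong) (auto simp: ennreal_mult[symmetric] less_imp_le)
      finally show ?thesis by (simp add: ennreal_of_nat_eq_real_of_nat)
    qed
    \<comment> \<open>Hoelder's inequality is used as a pointwise inequality with a free parameter.
      This value balances the two integrated terms, as \<mu>^(-\<kappa>) B = \<mu>.\<close>
    define \<mu> where "\<mu> = B powr (1 / (1 + \<kappa>))"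
    have \<mu>: "\<mu> > 0" using B by (simp add: \<mu>_def)
    \<comment> \<open>Either g \<le> \<mu> W g^p or g \<le> (\<mu> W)^(-\<kappa>); the two cases
      meet where \<mu> W g^(1/\<kappa>) = 1.\<close>
    have pt: "g t \<le> \<mu> * (g t powr p * W t) + \<mu> powr - \<kappa> * W t powr - \<kappa>" for t
    proof (cases "1 \<le> \<mu> * W t * g t powr (1 / \<kappa>)")
      case True
      have "g t \<le> g t * (\<mu> * W t * g t powr (1 / \<kappa>))"
        using True g0 mult_left_mono[OF True, of "g t"] by simp
      also have "\<dots> = \<mu> * (g t powr p * W t)"
        using g0 by (cases "g t = 0") (auto simp: p' powr_add less_le)
      finally show ?thesis using W[of t] by (smt (verit) powr_ge_zero mult_nonneg_nonneg)
    next
      case False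
      then have "g t powr (1 / \<kappa>) \<le> 1 / (\<mu> * W t)" using W[of t] \<mu> by (simp add: field_simps)
      then have "(g t powr (1 / \<kappa>)) powr \<kappa> \<le> (1 / (\<mu> * W t)) powr \<kappa>"
        using \<kappa> by (intro powr_mono2) auto
      then have "g t \<le> (1 / (\<mu> * W t)) powr \<kappa>"
        using \<kappa> g0 by (simp add: powr_powr)
      also have "\<dots> = \<mu> powr - \<kappa> * W t powr - \<kappa>"
        using \<mu> W[of t] by (simp add: powr_divide powr_mult powr_minus divide_simps)
      finally show ?thesis using W[of t] \<mu> by (smt (verit) powr_ge_zero mult_nonneg_nonneg)
    qed
    have "(\<integral>\<^sup>+t. ennreal (g t) \<partial>lborel) \<le> (\<integral>\<^sup>+t. ennreal \<mu> * ennreal (g t powr p * W t) + ennreal (\<mu> powr - \<kappa>) * ennreal (W t powr - \<kappa>) \<partial>lborel)"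
      using pt \<mu> W by (intro nn_integral_mono)
        (simp add: ennreal_mult[symmetric] ennreal_plus[symmetric] ennreal_leI less_imp_le del: ennreal_plus)
    also have "\<dots> = ennreal \<mu> * (\<integral>\<^sup>+t. ennreal (g t powr p * W t) \<partial>lborel) + ennreal (\<mu> powr - \<kappa>) * (\<integral>\<^sup>+t. ennreal (W t powr - \<kappa>) \<partial>lborel)"
      by (subst nn_integral_add) (auto simp: nn_integral_cmult)
    also have "\<dots> \<le> ennreal \<mu> * ennreal N + ennreal (\<mu> powr - \<kappa>) * ennreal B"
      by (intro add_mono mult_left_mono intgW intW) auto
    also have "\<dots> = ennreal (N * \<mu> + \<mu> powr - \<kappa> * B)"
      using \<mu> B by (simp add: ennreal_mult[symmetric] ennreal_plus[symmetric] mult.commute del: ennreal_plus)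
    also have "\<mu> powr - \<kappa> * B = \<mu>"
    proof -
      have "\<mu> powr - \<kappa> * B = B powr (- \<kappa> / (1 + \<kappa>)) * B powr 1"
        using B by (simp add: \<mu>_def powr_powr)
      also have "\<dots> = B powr (1 / (1 + \<kappa>))"
        using \<kappa> unfolding powr_add[symmetric] by (simp add: field_simps)
      finally show ?thesis by (simp add: \<mu>_def)
    qed
    also have "N * \<mu> + \<mu> = C' * (\<Prod>k<N. D k powr (1 / (N * p)))"
    proof -
      have e: "\<theta> / m * (1 / (1 + \<kappa>)) = 1 / (N * p)"
      proof -
        have "m + \<theta> * N > 0" using m \<theta> by (intro add_pos_nonneg) auto
        then show ?thesis
          using N_pos m \<theta>(1) by (simp add: p' \<kappa>_def divide_simps)
      qed
      have "\<mu> = C powr (1 / (1 + \<kappa>)) * (\<Prod>k<N. (D k powr (\<theta> / m)) powr (1 / (1 + \<kappa>)))"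
        using C(1) unfolding \<mu>_def B_def by (simp add: powr_mult prod_nonneg prod_powr_distrib)
      also have "(\<Prod>k<N. (D k powr (\<theta> / m)) powr (1 / (1 + \<kappa>))) = (\<Prod>k<N. D k powr (1 / (N * p)))"
        unfolding powr_powr e ..
      finally show ?thesis by (simp add: C'_def algebra_simps)
    qed
    finally show "(\<integral>\<^sup>+t. ennreal (g t) \<partial>lborel) \<le> ennreal (C' * (\<Prod>k<N. D k powr (1 / (N * p))))" .
  qed
qed

end

subsection \<open>Gaussian elimination\<close>

definition epowr :: "ennreal \<Rightarrow> real \<Rightarrow> ennreal" where
  "epowr x r = (if x = \<infinity> then \<infinity> else ennreal (enn2real x powr r))"

lemma epowr_ennreal [simp]: "0 \<le> x \<Longrightarrow> epowr (ennreal x) r = ennreal (x powr r)"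
  by (simp add: epowr_def)

lemma epowr_top [simp]: "epowr \<infinity> r = \<infinity>" "epowr top r = top"
  by (simp_all add: epowr_def)

lemma epowr_0 [simp]: "epowr 0 r = 0"
  by (simp add: epowr_def)

lemma epowr_mono: "r \<ge> 0 \<Longrightarrow> x \<le> y \<Longrightarrow> epowr x r \<le> epowr y r"
  by (cases x; cases y) (auto intro!: ennreal_leI powr_mono2 simp: top_unique)

lemma epowr_1 [simp]: "epowr x 1 = x"
  by (cases x) auto

lemma epowr_epowr: "epowr (epowr x r) s = epowr x (r * s)"
  by (cases x) (auto simp: powr_powr)

lemma epowr_le_iff: "r > 0 \<Longrightarrow> epowr x r \<le> y \<longleftrightarrow> x \<le> epowr y (1 / r)"
  using epowr_mono[of r x "epowr y (1 / r)"] epowr_mono[of "1 / r" "epowr x r" y]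
  by (auto simp: epowr_epowr)

lemma epowr_mult: "r > 0 \<Longrightarrow> epowr (x * y) r = epowr x r * epowr y r"
proof (cases x; cases y)
  fix a b :: real assume "r > 0" "x = ennreal a" "0 \<le> a" "y = ennreal b" "0 \<le> b"
  then show ?thesis by (simp add: ennreal_mult[symmetric] powr_mult)
next
  fix a :: real assume "r > 0" "x = ennreal a" "0 \<le> a" "y = top"
  then show ?thesis by (cases "a = 0") (auto simp: ennreal_mult_top)
next
  fix a :: real assume "r > 0" "y = ennreal a" "0 \<le> a" "x = top"
  then show ?thesis by (cases "a = 0") (auto simp: ennreal_top_mult)
qed (simp_all)

lemma epowr_of_nat: "n > 0 \<Longrightarrow> epowr x (real n) = x ^ n"
  by (cases x) (auto simp: ennreal_power powr_realpow' power_eq_top_ennreal)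

lemma epowr_SUP:
  assumes "r > 0" "I \<noteq> {}"
  shows "epowr (SUP i\<in>I. f i) r = (SUP i\<in>I. epowr (f i) r)"
proof (rule antisym)
  have "f i \<le> epowr (SUP i\<in>I. epowr (f i) r) (1 / r)" if "i \<in> I" for i
    using that assms by (auto simp: epowr_le_iff[symmetric] intro: SUP_upper)
  then show "epowr (SUP i\<in>I. f i) r \<le> (SUP i\<in>I. epowr (f i) r)"
    using assms by (simp add: epowr_le_iff SUP_least)
  show "(SUP i\<in>I. epowr (f i) r) \<le> epowr (SUP i\<in>I. f i) r"
    using assms by (intro SUP_least epowr_mono SUP_upper) auto
qed

lemma measurable_epowr [measurable (raw)]:
  assumes [measurable]: "f \<in> borel_measurable M"
  shows "(\<lambda>x. epowr (f x) r) \<in> borel_measurable M"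
  unfolding epowr_def by measurable

section \<open>Change of variables from coefficients to values\<close>

lemma nn_integral_lborel_affine:
  fixes f :: "'a::euclidean_space \<Rightarrow> ennreal"
  assumes c: "c \<noteq> 0" and [measurable]: "f \<in> borel_measurable borel"
  shows "(\<integral>\<^sup>+x. f x \<partial>lborel) = (\<integral>\<^sup>+x. ennreal (\<bar>c\<bar> ^ DIM('a)) * f (t + c *\<^sub>R x) \<partial>lborel)"
  by (subst lborel_affine[OF c, of t]) (simp add: nn_integral_density nn_integral_distr nn_integral_cmult)

lemma sigma_finite_PiM_lborel:
  "finite I \<Longrightarrow> sigma_finite_measure (Pi\<^sub>M I (\<lambda>_. lborel :: 'a::euclidean_space measure))"
  by (rule product_sigma_finite.sigma_finite[OF product_sigma_finite_lborel])

lemma nn_integral_swap: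
  assumes "sigma_finite_measure M" "sigma_finite_measure N"
    and f: "(\<lambda>(x, y). f x y) \<in> borel_measurable (M \<Otimes>\<^sub>M N)"
  shows "(\<integral>\<^sup>+x. \<integral>\<^sup>+y. f x y \<partial>N \<partial>M) = (\<integral>\<^sup>+y. \<integral>\<^sup>+x. f x y \<partial>M \<partial>N)"
proof -
  interpret pair_sigma_finite M N using assms(1,2) by (simp add: pair_sigma_finite_def)
  show ?thesis using Fubini'[of f] f by simp
qed

text \<open>\<open>a k\<close> is the matrix of a linear system after k elimination steps: row i is
  the i-th value, column j the j-th unknown, and the numbers \<open>a i i i\<close> are the pivots.
  Step n replaces the unknown u_n by the value z of row n; the Jacobian is the pivot to the power of
  the dimension, and substitution into the later rows produces the next matrix together with a shift
  depending on z. The arbitrary shifts \<open>s\<close> absorb this in the induction. Only an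
  inequality holds, as a zero pivot makes the left-hand side 0.\<close>

lemma nn_integral_elimination_le:
  fixes h :: "nat \<Rightarrow> 'a::euclidean_space \<Rightarrow> ennreal" and a :: "nat \<Rightarrow> nat \<Rightarrow> nat \<Rightarrow> real"
  assumes h[measurable]: "\<And>i. h i \<in> borel_measurable borel"
    and a: "\<And>k i j. a (Suc k) i j = a k i j - a k k j / a k k k * a k i k"
    and k: "k \<le> N"
  shows "(\<integral>\<^sup>+u. (\<Prod>i\<in>{k..<N}. h i (s i + (\<Sum>j\<in>{k..<N}. a k i j *\<^sub>R u j)) * ennreal (\<bar>a i i i\<bar> ^ DIM('a))) \<partial>Pi\<^sub>M {k..<N} (\<lambda>_. lborel))
    \<le> (\<Prod>i\<in>{k..<N}. \<integral>\<^sup>+y. h i y \<partial>lborel)"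
  using k
proof (induction k arbitrary: s rule: inc_induct)
  case base
  interpret product_sigma_finite "\<lambda>_::nat. lborel :: 'a measure" by (rule product_sigma_finite_lborel)
  show ?case by (simp add: space_PiM_empty)
next
  case (step n)
  interpret product_sigma_finite "\<lambda>_::nat. lborel :: 'a measure" by (rule product_sigma_finite_lborel)
  let ?I = "{Suc n..<N}"
  let ?D = "DIM('a)"
  have I: "{n..<N} = insert n ?I" "n \<notin> ?I" "finite ?I" using step by auto
  let ?f = "\<lambda>u. \<Prod>i\<in>{n..<N}. h i (s i + (\<Sum>j\<in>{n..<N}. a n i j *\<^sub>R u j)) * ennreal (\<bar>a i i i\<bar> ^ ?D)"
  have fm: "?f \<in> borel_measurable (Pi\<^sub>M (insert n ?I) (\<lambda>_. lborel))"
  proof (intro borel_measurable_prod_ennreal borel_measurable_times_ennreal measurable_compose[OF _ h])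
    fix i
    show "(\<lambda>u. s i + (\<Sum>j\<in>{n..<N}. a n i j *\<^sub>R u j)) \<in> Pi\<^sub>M (insert n ?I) (\<lambda>_. lborel) \<rightarrow>\<^sub>M (borel :: 'a measure)"
      unfolding I(1) by measurable
  qed auto
  show ?case
  proof (cases "a n n n = 0")
    case True
    then have "?f = (\<lambda>_. 0)" by (auto simp: I fun_eq_iff)
    then show ?thesis by simp
  next
    case False
    define b where "b = a n n n"
    \<comment> \<open>The integrand in coordinates (x, z): z is the value of row n and replaces u_n,
      x holds the later unknowns. The later rows have u_n eliminated with the factor a n i n /
      b.\<close>
    define H where "H x z = h n z * (\<Prod>i\<in>?I. h i ((s i + (a n i n / b) *\<^sub>R (z - s n)) + (\<Sum>j\<in>?I. a (Suc n) i j *\<^sub>R x j)) * ennreal (\<bar>a i i i\<bar> ^ ?D))" for x z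
    have Hm: "(\<lambda>(x, z). H x z) \<in> borel_measurable (Pi\<^sub>M ?I (\<lambda>_. lborel) \<Otimes>\<^sub>M lborel)"
      unfolding H_def case_prod_beta
      by (intro borel_measurable_times_ennreal borel_measurable_prod_ennreal measurable_compose[OF _ h]) measurable
    have Hx: "H x \<in> borel_measurable borel" for x
      unfolding H_def[abs_def]
      by (intro borel_measurable_times_ennreal borel_measurable_prod_ennreal measurable_compose[OF _ h]) auto
    have inner: "(\<integral>\<^sup>+y. ?f (x(n := y)) \<partial>lborel) = (\<integral>\<^sup>+z. H x z \<partial>lborel)" for x
    proof -
      let ?t = "s n + (\<Sum>j\<in>?I. a n n j *\<^sub>R x j)"
      have "?f (x(n := y)) = ennreal (\<bar>b\<bar> ^ ?D) * H x (?t + b *\<^sub>R y)" for y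
      proof -
        have S: "(\<Sum>j\<in>{n..<N}. a n i j *\<^sub>R (x(n := y)) j) = a n i n *\<^sub>R y + (\<Sum>j\<in>?I. a n i j *\<^sub>R x j)" for i
          unfolding I(1) using I(2,3) by simp
        have n: "s n + (\<Sum>j\<in>{n..<N}. a n n j *\<^sub>R (x(n := y)) j) = ?t + b *\<^sub>R y"
          unfolding S b_def by simp
        have i: "s i + (\<Sum>j\<in>{n..<N}. a n i j *\<^sub>R (x(n := y)) j) =
          (s i + (a n i n / b) *\<^sub>R ((?t + b *\<^sub>R y) - s n)) + (\<Sum>j\<in>?I. a (Suc n) i j *\<^sub>R x j)" for i
        proof -
          have "(\<Sum>j\<in>?I. a (Suc n) i j *\<^sub>R x j) = (\<Sum>j\<in>?I. a n i j *\<^sub>R x j) - (a n i n / b) *\<^sub>R (\<Sum>j\<in>?I. a n n j *\<^sub>R x j)"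
            by (simp add: a b_def scaleR_diff_left sum_subtractf scaleR_sum_right mult_ac)
          then show ?thesis
            unfolding S using False by (simp add: b_def algebra_simps)
        qed
        have "?f (x(n := y)) = (h n (s n + (\<Sum>j\<in>{n..<N}. a n n j *\<^sub>R (x(n := y)) j)) * ennreal (\<bar>a n n n\<bar> ^ ?D)) *
            (\<Prod>i\<in>?I. h i (s i + (\<Sum>j\<in>{n..<N}. a n i j *\<^sub>R (x(n := y)) j)) * ennreal (\<bar>a i i i\<bar> ^ ?D))"
          using prod.insert[OF I(3,2), of "\<lambda>i. h i (s i + (\<Sum>j\<in>{n..<N}. a n i j *\<^sub>R (x(n := y)) j)) * ennreal (\<bar>a i i i\<bar> ^ ?D)"]
          by (simp only: I(1)[symmetric])
        also have "\<dots> = (h n (?t + b *\<^sub>R y) * ennreal (\<bar>b\<bar> ^ ?D)) *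
            (\<Prod>i\<in>?I. h i ((s i + (a n i n / b) *\<^sub>R ((?t + b *\<^sub>R y) - s n)) + (\<Sum>j\<in>?I. a (Suc n) i j *\<^sub>R x j)) * ennreal (\<bar>a i i i\<bar> ^ ?D))"
          unfolding n by (simp only: i b_def[symmetric])
        finally show ?thesis by (simp add: H_def mult_ac)
      qed
      then have "(\<integral>\<^sup>+y. ?f (x(n := y)) \<partial>lborel) = (\<integral>\<^sup>+y. ennreal (\<bar>b\<bar> ^ ?D) * H x (?t + b *\<^sub>R y) \<partial>lborel)"
        by simp
      also have "\<dots> = (\<integral>\<^sup>+z. H x z \<partial>lborel)"
        using False by (intro nn_integral_lborel_affine[symmetric] Hx) (simp add: b_def)
      finally show ?thesis .
    qed
    have "(\<integral>\<^sup>+u. ?f u \<partial>Pi\<^sub>M {n..<N} (\<lambda>_. lborel)) = (\<integral>\<^sup>+x. \<integral>\<^sup>+y. ?f (x(n := y)) \<partial>lborel \<partial>Pi\<^sub>M ?I (\<lambda>_. lborel))"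
      unfolding I(1) by (rule product_nn_integral_insert[OF I(3,2) fm[unfolded I(1)]])
    also have "\<dots> = (\<integral>\<^sup>+x. \<integral>\<^sup>+z. H x z \<partial>lborel \<partial>Pi\<^sub>M ?I (\<lambda>_. lborel))"
      unfolding inner ..
    \<comment> \<open>With z outermost, the inner integral is an instance of the induction
      hypothesis whose shifts depend on z.\<close>
    also have "\<dots> = (\<integral>\<^sup>+z. \<integral>\<^sup>+x. H x z \<partial>Pi\<^sub>M ?I (\<lambda>_. lborel) \<partial>lborel)"
      by (intro nn_integral_swap sigma_finite_PiM_lborel Hm sigma_finite_lborel) simp
    also have "\<dots> \<le> (\<integral>\<^sup>+z. h n z * (\<Prod>i\<in>?I. \<integral>\<^sup>+y. h i y \<partial>lborel) \<partial>lborel)"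
    proof (rule nn_integral_mono)
      fix z
      have "(\<integral>\<^sup>+x. H x z \<partial>Pi\<^sub>M ?I (\<lambda>_. lborel)) = h n z * (\<integral>\<^sup>+x. (\<Prod>i\<in>?I. h i ((s i + (a n i n / b) *\<^sub>R (z - s n)) + (\<Sum>j\<in>?I. a (Suc n) i j *\<^sub>R x j)) * ennreal (\<bar>a i i i\<bar> ^ ?D)) \<partial>Pi\<^sub>M ?I (\<lambda>_. lborel))"
        unfolding H_def
        by (intro nn_integral_cmult borel_measurable_times_ennreal borel_measurable_prod_ennreal measurable_compose[OF _ h]) measurable
      also have "\<dots> \<le> h n z * (\<Prod>i\<in>?I. \<integral>\<^sup>+y. h i y \<partial>lborel)"
        by (intro mult_left_mono step.IH) auto
      finally show "(\<integral>\<^sup>+x. H x z \<partial>Pi\<^sub>M ?I (\<lambda>_. lborel)) \<le> h n z * (\<Prod>i\<in>?I. \<integral>\<^sup>+y. h i y \<partial>lborel)" .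
    qed
    also have "\<dots> = (\<Prod>i\<in>{n..<N}. \<integral>\<^sup>+y. h i y \<partial>lborel)"
      unfolding I(1) using I(2,3) by (simp add: nn_integral_multc)
    finally show ?thesis .
  qed
qed

text \<open>Elimination carried out on functions: \<open>resid \<phi> \<tau> k j\<close> is
  \<open>\<phi> j\<close> corrected by earlier functions so as to vanish at the first k nodes,
  provided that no pivot is 0. Evaluation at the nodes gives the recursion of the elimination
  matrices, with \<open>resid \<phi> \<tau> k k (\<tau> k)\<close> as k-th pivot. At a zero pivot
  the quotient is 0 and the step leaves the function unchanged.\<close>

primrec resid :: "(nat \<Rightarrow> 'x \<Rightarrow> real) \<Rightarrow> (nat \<Rightarrow> 'x) \<Rightarrow> nat \<Rightarrow> nat \<Rightarrow> 'x \<Rightarrow> real" where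
  "resid \<phi> \<tau> 0 j x = \<phi> j x"
| "resid \<phi> \<tau> (Suc k) j x = resid \<phi> \<tau> k j x - resid \<phi> \<tau> k j (\<tau> k) / resid \<phi> \<tau> k k (\<tau> k) * resid \<phi> \<tau> k k x"

text \<open>Makes the elimination polynomials admissible in the infimum over lower coefficients for
  all nodes: a step with zero pivot still yields a combination of this form.\<close>

lemma resid_combination:
  "\<exists>c. \<forall>x. resid \<phi> \<tau> k j x = \<phi> j x + (\<Sum>i<k. c i * \<phi> i x)"
proof (induction k arbitrary: j)
  case 0
  then show ?case by simp
next
  case (Suc k)
  obtain c c' where c: "\<And>x. resid \<phi> \<tau> k j x = \<phi> j x + (\<Sum>i<k. c i * \<phi> i x)"
    "\<And>x. resid \<phi> \<tau> k k x = \<phi> k x + (\<Sum>i<k. c' i * \<phi> i x)"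
    using Suc[of j] Suc[of k] by blast
  define r where "r = resid \<phi> \<tau> k j (\<tau> k) / resid \<phi> \<tau> k k (\<tau> k)"
  have "resid \<phi> \<tau> (Suc k) j x = resid \<phi> \<tau> k j x - r * resid \<phi> \<tau> k k x" for x by (simp add: r_def)
  then have "resid \<phi> \<tau> (Suc k) j x = \<phi> j x + (\<Sum>i<Suc k. (if i < k then c i - r * c' i else - r) * \<phi> i x)" for x
    unfolding c by (simp add: algebra_simps sum_subtractf sum_distrib_left sum.distrib)
  then show ?case
    by (intro exI[of _ "\<lambda>i. if i < k then c i - r * c' i else - r"] allI)
qed

lemma resid_cong:
  "(\<And>i. i < k \<Longrightarrow> \<tau> i = \<tau>' i) \<Longrightarrow> resid \<phi> \<tau> k j x = resid \<phi> \<tau>' k j x"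
  by (induction k arbitrary: j x) auto

lemma measurable_resid:
  assumes \<phi>: "\<And>j. \<phi> j \<in> borel_measurable X"
    and T: "\<And>i. i < k \<Longrightarrow> (\<lambda>w. T w i) \<in> M \<rightarrow>\<^sub>M X" and g: "g \<in> M \<rightarrow>\<^sub>M X"
  shows "(\<lambda>w. resid \<phi> (T w) k j (g w)) \<in> borel_measurable M"
  using T g
proof (induction k arbitrary: j g)
  case 0
  then show ?case using \<phi> by (simp add: measurable_compose)
next
  case (Suc k)
  have "(\<lambda>w. T w k) \<in> M \<rightarrow>\<^sub>M X" using Suc.prems by simp
  then have [measurable]: "(\<lambda>w. resid \<phi> (T w) k j (T w k)) \<in> borel_measurable M"
    "(\<lambda>w. resid \<phi> (T w) k j (g w)) \<in> borel_measurable M" for j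
    using Suc.IH Suc.prems by auto
  show ?case unfolding resid.simps by measurable
qed

text \<open>For fixed earlier nodes the residual is a competitor in the k-th infimum, so integrating
  out the k-th node gives at least that infimum. Since the k-th factor involves only nodes up to k,
  the nodes can be peeled off from the last one down.\<close>

lemma prod_moments_le:
  fixes G :: "'a::euclidean_space \<Rightarrow> ennreal"
  assumes G: "G \<in> borel_measurable borel" and \<phi>: "\<And>j. \<phi> j \<in> borel_measurable borel"
  shows "(\<Prod>k<N. INF c. \<integral>\<^sup>+x. G x * ennreal (\<bar>\<phi> k x + (\<Sum>i<k. c i * \<phi> i x)\<bar> ^ m) \<partial>lborel)
    \<le> (\<integral>\<^sup>+\<tau>. (\<Prod>k<N. G (\<tau> k) * ennreal (\<bar>resid \<phi> \<tau> k k (\<tau> k)\<bar> ^ m)) \<partial>Pi\<^sub>M {..<N} (\<lambda>_. lborel))"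
    (is "(\<Prod>k<N. ?\<delta> k) \<le> _")
proof (induction N)
  interpret product_sigma_finite "\<lambda>_::nat. lborel :: 'a measure" by (rule product_sigma_finite_lborel)
  case 0
  show ?case by (simp add: space_PiM_empty)
next
  interpret product_sigma_finite "\<lambda>_::nat. lborel :: 'a measure" by (rule product_sigma_finite_lborel)
  case (Suc N)
  let ?f = "\<lambda>N \<tau>. \<Prod>k<N. G (\<tau> k) * ennreal (\<bar>resid \<phi> \<tau> k k (\<tau> k)\<bar> ^ m)"
  have fm: "?f n \<in> borel_measurable (Pi\<^sub>M {..<n} (\<lambda>_. lborel))" for n
  proof (intro borel_measurable_prod_ennreal borel_measurable_times_ennreal)
    fix k assume k: "k \<in> {..<n}"
    then have c: "(\<lambda>w. w k) \<in> Pi\<^sub>M {..<n} (\<lambda>_. lborel) \<rightarrow>\<^sub>M (borel :: 'a measure)" by measurable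
    then show "(\<lambda>w. G (w k)) \<in> borel_measurable (Pi\<^sub>M {..<n} (\<lambda>_. lborel))"
      using G by (rule measurable_compose)
    have "(\<lambda>w. resid \<phi> w k k (w k)) \<in> borel_measurable (Pi\<^sub>M {..<n} (\<lambda>_. lborel))"
      using k by (intro measurable_resid[where X = borel and T = "\<lambda>w. w"] \<phi> c) measurable
    then show "(\<lambda>w. ennreal (\<bar>resid \<phi> w k k (w k)\<bar> ^ m)) \<in> borel_measurable (Pi\<^sub>M {..<n} (\<lambda>_. lborel))"
      by measurable
  qed
  have ins: "{..<Suc N} = insert N {..<N}" by auto
  \<comment> \<open>Only the last factor sees the new node, and there it enters only as the point of
    evaluation.\<close>
  have "?f (Suc N) (x(N := y)) = ?f N x * (G y * ennreal (\<bar>resid \<phi> x N N y\<bar> ^ m))" for x y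
  proof -
    have "?f N (x(N := y)) = ?f N x"
      by (intro prod.cong) (auto intro!: arg_cong2[where f=times] arg_cong[where f=ennreal] arg_cong[where f="\<lambda>z. \<bar>z\<bar> ^ m"] resid_cong)
    moreover have "resid \<phi> (x(N := y)) N N y = resid \<phi> x N N y" by (rule resid_cong) auto
    ultimately show ?thesis by simp
  qed
  then have "(\<integral>\<^sup>+\<tau>. ?f (Suc N) \<tau> \<partial>Pi\<^sub>M {..<Suc N} (\<lambda>_. lborel)) = (\<integral>\<^sup>+x. \<integral>\<^sup>+y. ?f N x * (G y * ennreal (\<bar>resid \<phi> x N N y\<bar> ^ m)) \<partial>lborel \<partial>Pi\<^sub>M {..<N} (\<lambda>_. lborel))"
    using product_nn_integral_insert[of "{..<N}" N "?f (Suc N)"] fm[of "Suc N"] by (simp add: ins[symmetric])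
  also have "\<dots> \<ge> (\<integral>\<^sup>+x. ?f N x * ?\<delta> N \<partial>Pi\<^sub>M {..<N} (\<lambda>_. lborel))"
  proof (rule nn_integral_mono)
    fix x
    obtain c where c: "\<And>y. resid \<phi> x N N y = \<phi> N y + (\<Sum>i<N. c i * \<phi> i y)" using resid_combination by blast
    have [measurable]: "G \<in> borel_measurable borel" by (rule G)
    have [measurable]: "(\<lambda>y. resid \<phi> x N N y) \<in> borel_measurable borel" unfolding c using \<phi> by measurable
    have "?\<delta> N \<le> (\<integral>\<^sup>+y. G y * ennreal (\<bar>resid \<phi> x N N y\<bar> ^ m) \<partial>lborel)"
      unfolding c by (rule INF_lower) simp
    then have "?f N x * ?\<delta> N \<le> ?f N x * (\<integral>\<^sup>+y. G y * ennreal (\<bar>resid \<phi> x N N y\<bar> ^ m) \<partial>lborel)"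
      by (rule mult_left_mono) simp
    also have "\<dots> = (\<integral>\<^sup>+y. ?f N x * (G y * ennreal (\<bar>resid \<phi> x N N y\<bar> ^ m)) \<partial>lborel)"
      by (intro nn_integral_cmult[symmetric]) measurable
    finally show "?f N x * ?\<delta> N \<le> (\<integral>\<^sup>+y. ?f N x * (G y * ennreal (\<bar>resid \<phi> x N N y\<bar> ^ m)) \<partial>lborel)" .
  qed
  also have "(\<integral>\<^sup>+x. ?f N x * ?\<delta> N \<partial>Pi\<^sub>M {..<N} (\<lambda>_. lborel)) = (\<integral>\<^sup>+x. ?f N x \<partial>Pi\<^sub>M {..<N} (\<lambda>_. lborel)) * ?\<delta> N"
    by (rule nn_integral_multc[OF fm])
  finally have *: "(\<integral>\<^sup>+x. ?f N x \<partial>Pi\<^sub>M {..<N} (\<lambda>_. lborel)) * ?\<delta> N \<le> (\<integral>\<^sup>+\<tau>. ?f (Suc N) \<tau> \<partial>Pi\<^sub>M {..<Suc N} (\<lambda>_. lborel))" .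
  have "(\<Prod>k<Suc N. ?\<delta> k) \<le> (\<integral>\<^sup>+x. ?f N x \<partial>Pi\<^sub>M {..<N} (\<lambda>_. lborel)) * ?\<delta> N"
    using Suc by (simp add: mult_right_mono)
  with * show ?case by (rule order.trans[rotated])
qed

subsection \<open>The strong type estimate in enumerated coordinates\<close>

context multiindex_enumeration
begin

definition curve :: "(nat \<Rightarrow> 'b::euclidean_space) \<Rightarrow> real ^ 'n \<Rightarrow> 'b" where
  "curve u t = (\<Sum>k<N. monomial t (e k) *\<^sub>R u k)"

lemma measurable_curve [measurable]: "curve u \<in> borel_measurable borel"
  unfolding curve_def[abs_def] by measurable

text \<open>Near-minimisers are inserted with D k = \<delta>_k + \<epsilon>, and \<epsilon> tends to
  0; this covers infima that are 0 or not attained. Finite monomial moments make each \<delta>_k a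
  real number, so that \<delta>_k + \<epsilon> strictly exceeds it.\<close>

lemma integral_powr_le_prod_inf_moments:
  fixes p :: real
  assumes m: "m \<ge> (1::nat)" and p: "p = 1 + m / (N * \<theta>)"
  shows "\<exists>C>0. \<forall>g. g \<in> borel_measurable borel \<longrightarrow> (\<forall>t. g t \<ge> 0) \<longrightarrow>
    (\<forall>k<N. (\<integral>\<^sup>+t. ennreal (g t powr p) * ennreal (\<bar>monomial t (e k)\<bar> ^ m) \<partial>lborel) < \<infinity>) \<longrightarrow>
    epowr (\<integral>\<^sup>+t. ennreal (g t) \<partial>lborel) (N * p) \<le> ennreal C *
      (\<Prod>k<N. INF c. \<integral>\<^sup>+t. ennreal (g t powr p) * ennreal (\<bar>monomial t (e k) + (\<Sum>i<k. c i * monomial t (e i))\<bar> ^ m) \<partial>lborel)"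
proof -
  obtain C where C: "C > 0" "\<And>g c D. g \<in> borel_measurable borel \<Longrightarrow> \<forall>t. g t \<ge> 0 \<Longrightarrow> \<forall>k<N. D k > 0 \<Longrightarrow>
    \<forall>k<N. (\<integral>\<^sup>+t. ennreal (\<bar>lowcomb (c k) k t\<bar> ^ m * g t powr p) \<partial>lborel) \<le> ennreal (D k) \<Longrightarrow>
    (\<integral>\<^sup>+t. ennreal (g t) \<partial>lborel) \<le> ennreal (C * (\<Prod>k<N. D k powr (1 / (N * p))))"
    using integral_le_prod_moments[OF m p] by blast
  have Np: "N * p > 0" using N_pos p m \<theta> by (simp add: add_pos_nonneg)
  show ?thesis
  proof (intro exI[of _ "C powr (N * p)"] conjI allI impI)
    show "C powr (N * p) > 0" using C by simp
    fix g :: "real ^ 'n \<Rightarrow> real"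
    assume g[measurable]: "g \<in> borel_measurable borel" and g0: "\<forall>t. g t \<ge> 0"
      and fin: "\<forall>k<N. (\<integral>\<^sup>+t. ennreal (g t powr p) * ennreal (\<bar>monomial t (e k)\<bar> ^ m) \<partial>lborel) < \<infinity>"
    define M where "M k c = (\<integral>\<^sup>+t. ennreal (g t powr p) * ennreal (\<bar>lowcomb c k t\<bar> ^ m) \<partial>lborel)" for k c
    define \<delta> where "\<delta> k = (INF c. M k c)" for k
    define r where "r k = enn2real (\<delta> k)" for k
    have \<delta>: "\<delta> k = ennreal (r k)" "0 \<le> r k" if "k < N" for k
    proof -
      have "\<delta> k \<le> M k (\<lambda>_. 0)" unfolding \<delta>_def by (rule INF_lower) simp
      also have "\<dots> < \<infinity>" using fin that by (simp add: M_def lowcomb_def)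
      finally show "\<delta> k = ennreal (r k)" "0 \<le> r k" by (auto simp: r_def less_top)
    qed
    let ?I = "\<integral>\<^sup>+t. ennreal (g t) \<partial>lborel"
    have eps: "epowr ?I (N * p) \<le> ennreal (C powr (N * p) * (\<Prod>k<N. r k + \<epsilon>))" if \<epsilon>: "\<epsilon> > 0" for \<epsilon>
    proof -
      have "\<exists>c. M k c < ennreal (r k + \<epsilon>)" if "k < N" for k
      proof -
        have "\<delta> k < ennreal (r k + \<epsilon>)" using \<delta>[OF that] \<epsilon> by (simp add: ennreal_lessI)
        then show ?thesis by (auto simp: \<delta>_def INF_less_iff)
      qed
      then obtain c where c: "\<And>k. k < N \<Longrightarrow> M k (c k) < ennreal (r k + \<epsilon>)" by metis
      have D: "\<forall>k<N. r k + \<epsilon> > 0" using \<delta> \<epsilon> by (auto simp: add_nonneg_pos)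
      have "?I \<le> ennreal (C * (\<Prod>k<N. (r k + \<epsilon>) powr (1 / (N * p))))"
      proof (rule C(2)[OF g g0 D, of c], intro allI impI)
        fix k assume "k < N"
        then show "(\<integral>\<^sup>+t. ennreal (\<bar>lowcomb (c k) k t\<bar> ^ m * g t powr p) \<partial>lborel) \<le> ennreal (r k + \<epsilon>)"
          using c[of k] by (simp add: M_def ennreal_mult mult.commute less_imp_le)
      qed
      then have "epowr ?I (N * p) \<le> epowr (ennreal (C * (\<Prod>k<N. (r k + \<epsilon>) powr (1 / (N * p))))) (N * p)"
        using Np by (intro epowr_mono) auto
      also have "\<dots> = ennreal (C powr (N * p) * (\<Prod>k<N. r k + \<epsilon>))"
      proof -
        have "(C * (\<Prod>k<N. (r k + \<epsilon>) powr (1 / (N * p)))) powr (N * p) = C powr (N * p) * (\<Prod>k<N. ((r k + \<epsilon>) powr (1 / (N * p))) powr (N * p))"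
          using C(1) by (simp add: powr_mult prod_nonneg prod_powr_distrib)
        also have "(\<Prod>k<N. ((r k + \<epsilon>) powr (1 / (N * p))) powr (N * p)) = (\<Prod>k<N. r k + \<epsilon>)"
        proof (intro prod.cong refl)
          fix k assume "k \<in> {..<N}"
          then have "r k + \<epsilon> > 0" using D by simp
          moreover have "N \<noteq> 0" "p \<noteq> 0" using Np N_pos by auto
          ultimately show "((r k + \<epsilon>) powr (1 / (N * p))) powr (N * p) = r k + \<epsilon>" by (simp add: powr_powr)
        qed
        finally show ?thesis using C(1) by (simp add: prod_nonneg)
      qed
      finally show ?thesis .
    qed
    have "((\<lambda>\<epsilon>. ennreal (C powr (N * p) * (\<Prod>k<N. r k + \<epsilon>))) \<longlongrightarrow> ennreal (C powr (N * p) * (\<Prod>k<N. r k + 0))) (at_right 0)"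
      by (intro tendsto_ennrealI tendsto_intros)
    then have "epowr ?I (N * p) \<le> ennreal (C powr (N * p) * (\<Prod>k<N. r k + 0))"
      by (rule tendsto_lowerbound) (auto intro: eps simp: eventually_at_right_less intro!: eventually_mono[OF eventually_at_right_less])
    also have "\<dots> = ennreal (C powr (N * p)) * (\<Prod>k<N. \<delta> k)"
    proof -
      have "(\<Prod>k<N. \<delta> k) = ennreal (\<Prod>k<N. r k)"
        using \<delta> by (subst prod_ennreal[symmetric]) auto
      moreover have "0 \<le> (\<Prod>k<N. r k)" using \<delta>(2) by (intro prod_nonneg) auto
      ultimately show ?thesis by (simp add: ennreal_mult)
    qed
    finally show "epowr ?I (N * p) \<le> ennreal (C powr (N * p)) *
      (\<Prod>k<N. INF c. \<integral>\<^sup>+t. ennreal (g t powr p) * ennreal (\<bar>monomial t (e k) + (\<Sum>i<k. c i * monomial t (e i))\<bar> ^ m) \<partial>lborel)"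
      by (simp add: \<delta>_def M_def lowcomb_def)
  qed
qed

text \<open>The infima give way to residuals at nodes \<tau>, and the integral over u is moved
  inside. For fixed nodes, u \<mapsto> (curve u (\<tau> i)) is linear with the monomials at the
  nodes as matrix, and its pivots are the very factors present in the integrand; elimination then
  decouples the nodes. Measurability of the infima in u never comes up, because the comparison with
  residuals is pointwise and \<open>nn_integral_mono\<close> asks for none.\<close>

lemma nn_integral_moments_le:
  fixes G :: "(real ^ 'n) \<times> 'b::euclidean_space \<Rightarrow> ennreal"
  assumes G[measurable]: "G \<in> borel_measurable borel"
  shows "(\<integral>\<^sup>+u. C * (\<Prod>k<N. INF c. \<integral>\<^sup>+t. G (t, curve u t) * ennreal (\<bar>monomial t (e k) + (\<Sum>i<k. c i * monomial t (e i))\<bar> ^ DIM('b)) \<partial>lborel) \<partial>Pi\<^sub>M {..<N} (\<lambda>_. lborel))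
    \<le> C * (\<integral>\<^sup>+z. G z \<partial>lborel) ^ N"
proof -
  interpret product_sigma_finite "\<lambda>_::nat. lborel :: (real ^ 'n) measure" by (rule product_sigma_finite_lborel)
  let ?\<phi> = "\<lambda>j t. monomial t (e j)"
  let ?U = "Pi\<^sub>M {..<N} (\<lambda>_. lborel) :: (nat \<Rightarrow> 'b) measure"
  let ?T = "Pi\<^sub>M {..<N} (\<lambda>_. lborel) :: (nat \<Rightarrow> real ^ 'n) measure"
  define K where "K u \<tau> = (\<Prod>k<N. G (\<tau> k, curve u (\<tau> k)) * ennreal (\<bar>resid ?\<phi> \<tau> k k (\<tau> k)\<bar> ^ DIM('b)))" for u \<tau>
  have Km: "(\<lambda>(u, \<tau>). K u \<tau>) \<in> borel_measurable (?U \<Otimes>\<^sub>M ?T)"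
    unfolding K_def case_prod_beta
  proof (intro borel_measurable_prod_ennreal borel_measurable_times_ennreal)
    fix k assume k: "k \<in> {..<N}"
    have c[measurable]: "(\<lambda>w. snd w k) \<in> (?U \<Otimes>\<^sub>M ?T) \<rightarrow>\<^sub>M (borel :: (real ^ 'n) measure)" using k by measurable
    have "(\<lambda>w. curve (fst w) (snd w k)) \<in> (?U \<Otimes>\<^sub>M ?T) \<rightarrow>\<^sub>M (borel :: 'b measure)"
      using k unfolding curve_def by measurable
    then show "(\<lambda>w. G (snd w k, curve (fst w) (snd w k))) \<in> borel_measurable (?U \<Otimes>\<^sub>M ?T)"
      using c by measurable
    have "(\<lambda>w. resid ?\<phi> (snd w) k k (snd w k)) \<in> borel_measurable (?U \<Otimes>\<^sub>M ?T)"
    proof (rule measurable_resid[where X = borel])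
      fix i assume "i < k"
      then have "i \<in> {..<N}" using k by simp
      then show "(\<lambda>w. snd w i) \<in> (?U \<Otimes>\<^sub>M ?T) \<rightarrow>\<^sub>M borel" by measurable
    qed (use c in auto)
    then show "(\<lambda>w. ennreal (\<bar>resid ?\<phi> (snd w) k k (snd w k)\<bar> ^ DIM('b))) \<in> borel_measurable (?U \<Otimes>\<^sub>M ?T)"
      by measurable
  qed
  have sfT: "sigma_finite_measure ?T" by (rule sigma_finite_PiM_lborel) simp
  have "(\<integral>\<^sup>+u. C * (\<Prod>k<N. INF c. \<integral>\<^sup>+t. G (t, curve u t) * ennreal (\<bar>monomial t (e k) + (\<Sum>i<k. c i * monomial t (e i))\<bar> ^ DIM('b)) \<partial>lborel) \<partial>?U)
    \<le> (\<integral>\<^sup>+u. C * (\<integral>\<^sup>+\<tau>. K u \<tau> \<partial>?T) \<partial>?U)"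
    unfolding K_def by (intro nn_integral_mono mult_left_mono prod_moments_le[where \<phi> = ?\<phi>]) measurable
  also have "\<dots> = C * (\<integral>\<^sup>+u. \<integral>\<^sup>+\<tau>. K u \<tau> \<partial>?T \<partial>?U)"
    using sigma_finite_measure.borel_measurable_nn_integral[OF sfT, of K ?U] Km
    by (intro nn_integral_cmult) auto
  also have "(\<integral>\<^sup>+u. \<integral>\<^sup>+\<tau>. K u \<tau> \<partial>?T \<partial>?U) = (\<integral>\<^sup>+\<tau>. \<integral>\<^sup>+u. K u \<tau> \<partial>?U \<partial>?T)"
    by (intro nn_integral_swap sigma_finite_PiM_lborel Km) auto
  also have "\<dots> \<le> (\<integral>\<^sup>+\<tau>. (\<Prod>i<N. \<integral>\<^sup>+y. G (\<tau> i, y) \<partial>lborel) \<partial>?T)"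
  proof (rule nn_integral_mono)
    fix \<tau>
    \<comment> \<open>Row i belongs to the node \<tau> i and column j to the j-th monomial, hence
      the interchanged indices in the matrix passed to the elimination inequality.\<close>
    show "(\<integral>\<^sup>+u. K u \<tau> \<partial>?U) \<le> (\<Prod>i<N. \<integral>\<^sup>+y. G (\<tau> i, y) \<partial>lborel)"
      using nn_integral_elimination_le[of "\<lambda>i y. G (\<tau> i, y)" "\<lambda>k i j. resid ?\<phi> \<tau> k j (\<tau> i)" 0 N "\<lambda>_. 0"]
      by (simp add: K_def curve_def atLeast0LessThan)
  qed
  also have "\<dots> = (\<Prod>i<N. \<integral>\<^sup>+t. \<integral>\<^sup>+y. G (t, y) \<partial>lborel \<partial>lborel)"
    by (intro product_nn_integral_prod) measurable
  also have "(\<integral>\<^sup>+t. \<integral>\<^sup>+y. G (t, y) \<partial>lborel \<partial>lborel) = (\<integral>\<^sup>+z. G z \<partial>(lborel \<Otimes>\<^sub>M lborel))"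
    by (rule lborel.nn_integral_fst) (simp add: lborel_prod)
  finally show ?thesis by (simp add: lborel_prod mult_left_mono)
qed

text \<open>A common bound B for the height of F and for its support in t makes the monomial moments
  finite along every curve, whatever u.\<close>

lemma strong_type_truncated:
  fixes p :: real
  assumes p: "p = 1 + DIM('b) / (N * \<theta>)"
  shows "\<exists>C>0. \<forall>F :: (real ^ 'n) \<times> 'b::euclidean_space \<Rightarrow> real. F \<in> borel_measurable borel \<longrightarrow> (\<forall>z. 0 \<le> F z) \<longrightarrow>
    (\<exists>B. \<forall>z. F z \<le> B \<and> (norm (fst z) > B \<longrightarrow> F z = 0)) \<longrightarrow>
    (\<integral>\<^sup>+u. epowr (\<integral>\<^sup>+t. ennreal (F (t, curve u t)) \<partial>lborel) (N * p) \<partial>Pi\<^sub>M {..<N} (\<lambda>_. lborel))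
      \<le> ennreal C * (\<integral>\<^sup>+z. ennreal (F z powr p) \<partial>lborel) ^ N"
proof -
  have m: "DIM('b) \<ge> 1" by (simp add: DIM_positive Suc_leI)
  obtain C where C: "C > 0" "\<And>g. g \<in> borel_measurable borel \<Longrightarrow> (\<forall>t. g t \<ge> 0) \<Longrightarrow>
    (\<forall>k<N. (\<integral>\<^sup>+t. ennreal (g t powr p) * ennreal (\<bar>monomial t (e k)\<bar> ^ DIM('b)) \<partial>lborel) < \<infinity>) \<Longrightarrow>
    epowr (\<integral>\<^sup>+t. ennreal (g t) \<partial>lborel) (N * p) \<le> ennreal C *
      (\<Prod>k<N. INF c. \<integral>\<^sup>+t. ennreal (g t powr p) * ennreal (\<bar>monomial t (e k) + (\<Sum>i<k. c i * monomial t (e i))\<bar> ^ DIM('b)) \<partial>lborel)"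
    using integral_powr_le_prod_inf_moments[OF m p] by blast
  have p0: "p > 0" using p m N_pos \<theta> by (simp add: add_pos_nonneg)
  show ?thesis
  proof (intro exI[of _ C] conjI allI impI C(1))
    fix F :: "(real ^ 'n) \<times> 'b \<Rightarrow> real"
    assume F[measurable]: "F \<in> borel_measurable borel" and F0: "\<forall>z. 0 \<le> F z"
      and "\<exists>B. \<forall>z. F z \<le> B \<and> (norm (fst z) > B \<longrightarrow> F z = 0)"
    then obtain B where B: "\<And>z. F z \<le> B" "\<And>z. norm (fst z) > B \<Longrightarrow> F z = 0" by blast
    have B0: "B \<ge> 0" using B(1) F0 order.trans by blast
    have fin: "(\<integral>\<^sup>+t. ennreal (F (t, curve u t) powr p) * ennreal (\<bar>monomial t (e k)\<bar> ^ DIM('b)) \<partial>lborel) < \<infinity>" for u k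
    proof -
      have "compact (cball (0 :: real ^ 'n) B)" by simp
      moreover have "continuous_on (cball (0 :: real ^ 'n) B) (\<lambda>t. \<bar>monomial t (e k)\<bar> ^ DIM('b))"
        unfolding monomial_def by (intro continuous_intros)
      ultimately have "bounded ((\<lambda>t. \<bar>monomial t (e k)\<bar> ^ DIM('b)) ` cball (0 :: real ^ 'n) B)"
        by (intro compact_imp_bounded compact_continuous_image)
      then obtain b where "\<forall>t\<in>cball 0 B. \<bar>monomial t (e k)\<bar> ^ DIM('b) \<le> b"
        by (auto simp: bounded_iff)
      then have b: "\<bar>monomial t (e k)\<bar> ^ DIM('b) \<le> b" if "norm t \<le> B" for t
        using that by simp
      have "0 \<le> \<bar>monomial (0 :: real ^ 'n) (e k)\<bar> ^ DIM('b)" by simp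
      also have "\<dots> \<le> b" using b[of 0] B0 by simp
      finally have b0: "b \<ge> 0" .
      have "(\<integral>\<^sup>+t. ennreal (F (t, curve u t) powr p) * ennreal (\<bar>monomial t (e k)\<bar> ^ DIM('b)) \<partial>lborel)
        \<le> (\<integral>\<^sup>+t. ennreal (B powr p * b) * indicator (cball (0 :: real ^ 'n) B) t \<partial>lborel)"
      proof (rule nn_integral_mono)
        fix t :: "real ^ 'n"
        show "ennreal (F (t, curve u t) powr p) * ennreal (\<bar>monomial t (e k)\<bar> ^ DIM('b)) \<le> ennreal (B powr p * b) * indicator (cball 0 B) t"
        proof (cases "norm t \<le> B")
          case True
          then show ?thesis using B(1) F0 b[of t] p0 b0
            by (auto simp: ennreal_mult[symmetric] intro!: ennreal_leI mult_mono powr_mono2)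
        next
          case False
          then show ?thesis using B(2)[of "(t, curve u t)"] by simp
        qed
      qed
      also have "\<dots> = ennreal (B powr p * b) * emeasure lborel (cball (0 :: real ^ 'n) B)"
        by (simp add: nn_integral_cmult_indicator)
      also have "\<dots> < \<infinity>" using emeasure_lborel_cball_finite[of "0 :: real ^ 'n" B] by (simp add: ennreal_mult_less_top)
      finally show ?thesis .
    qed
    have "(\<integral>\<^sup>+u. epowr (\<integral>\<^sup>+t. ennreal (F (t, curve u t)) \<partial>lborel) (N * p) \<partial>Pi\<^sub>M {..<N} (\<lambda>_. lborel))
      \<le> (\<integral>\<^sup>+u. ennreal C * (\<Prod>k<N. INF c. \<integral>\<^sup>+t. ennreal (F (t, curve u t) powr p) * ennreal (\<bar>monomial t (e k) + (\<Sum>i<k. c i * monomial t (e i))\<bar> ^ DIM('b)) \<partial>lborel) \<partial>Pi\<^sub>M {..<N} (\<lambda>_. lborel))"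
      using F0 fin by (intro nn_integral_mono C(2)) measurable
    also have "\<dots> \<le> ennreal C * (\<integral>\<^sup>+z. ennreal (F z powr p) \<partial>lborel) ^ N"
      by (rule nn_integral_moments_le) measurable
    finally show "(\<integral>\<^sup>+u. epowr (\<integral>\<^sup>+t. ennreal (F (t, curve u t)) \<partial>lborel) (N * p) \<partial>Pi\<^sub>M {..<N} (\<lambda>_. lborel))
      \<le> ennreal C * (\<integral>\<^sup>+z. ennreal (F z powr p) \<partial>lborel) ^ N" .
  qed
qed

text \<open>Monotone convergence along truncations at height and radius j, for which the constant is
  the same.\<close>

lemma strong_type:
  fixes p :: real
  assumes p: "p = 1 + DIM('b) / (N * \<theta>)"
  shows "\<exists>C>0. \<forall>F :: (real ^ 'n) \<times> 'b::euclidean_space \<Rightarrow> real. F \<in> borel_measurable borel \<longrightarrow> (\<forall>z. 0 \<le> F z) \<longrightarrow>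
    (\<integral>\<^sup>+u. epowr (\<integral>\<^sup>+t. ennreal (F (t, curve u t)) \<partial>lborel) (N * p) \<partial>Pi\<^sub>M {..<N} (\<lambda>_. lborel))
      \<le> ennreal C * (\<integral>\<^sup>+z. ennreal (F z powr p) \<partial>lborel) ^ N"
proof -
  obtain C where C: "C > 0" "\<And>F :: (real ^ 'n) \<times> 'b \<Rightarrow> real. F \<in> borel_measurable borel \<Longrightarrow> (\<forall>z. 0 \<le> F z) \<Longrightarrow>
    (\<exists>B. \<forall>z. F z \<le> B \<and> (norm (fst z) > B \<longrightarrow> F z = 0)) \<Longrightarrow>
    (\<integral>\<^sup>+u. epowr (\<integral>\<^sup>+t. ennreal (F (t, curve u t)) \<partial>lborel) (N * p) \<partial>Pi\<^sub>M {..<N} (\<lambda>_. lborel))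
      \<le> ennreal C * (\<integral>\<^sup>+z. ennreal (F z powr p) \<partial>lborel) ^ N"
    using strong_type_truncated[OF p] by blast
  have p0: "p > 0" using p N_pos \<theta>(1) by (simp add: add_pos_nonneg)
  then have Np: "N * p > 0" using N_pos by simp
  show ?thesis
  proof (intro exI[of _ C] conjI allI impI C(1))
    fix F :: "(real ^ 'n) \<times> 'b \<Rightarrow> real"
    assume F[measurable]: "F \<in> borel_measurable borel" and F0: "\<forall>z. 0 \<le> F z"
    define G where "G j z = (if norm (fst z) \<le> real j then min (F z) (real j) else 0)" for j :: nat and z
    have Gm[measurable]: "G j \<in> borel_measurable borel" for j
      unfolding G_def borel_prod[symmetric] using F by (simp add: borel_prod[symmetric]) measurable
    have G0: "\<forall>z. 0 \<le> G j z" for j using F0 by (simp add: G_def)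
    have GF: "G j z \<le> F z" for j z using F0[rule_format, of z] by (simp add: G_def)
    have inc: "incseq (\<lambda>j t. ennreal (G j (t, curve u t)))" for u
      by (auto simp: incseq_def le_fun_def G_def F0 intro!: ennreal_leI)
    have SUP: "(SUP j. ennreal (G j z)) = ennreal (F z)" for z
    proof (rule antisym)
      show "(SUP j. ennreal (G j z)) \<le> ennreal (F z)" by (intro SUP_least ennreal_leI GF)
      obtain j :: nat where "max (norm (fst z)) (F z) \<le> real j" using real_arch_simple by blast
      then have "G j z = F z" by (simp add: G_def)
      then show "ennreal (F z) \<le> (SUP j. ennreal (G j z))" by (metis SUP_upper UNIV_I)
    qed
    let ?I = "\<lambda>j u. \<integral>\<^sup>+t. ennreal (G j (t, curve u t)) \<partial>lborel"
    let ?U = "Pi\<^sub>M {..<N} (\<lambda>_. lborel) :: (nat \<Rightarrow> 'b) measure"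
    have I: "(\<integral>\<^sup>+t. ennreal (F (t, curve u t)) \<partial>lborel) = (SUP j. ?I j u)" for u
      unfolding SUP[symmetric] by (intro nn_integral_monotone_convergence_SUP inc) measurable
    have Im[measurable]: "?I j \<in> borel_measurable ?U" for j
    proof -
      have "(\<lambda>(u, t). ennreal (G j (t, curve u t))) \<in> borel_measurable (?U \<Otimes>\<^sub>M lborel)"
        unfolding curve_def case_prod_beta by measurable
      then show ?thesis by (rule lborel.borel_measurable_nn_integral)
    qed
    have "(\<integral>\<^sup>+u. epowr (\<integral>\<^sup>+t. ennreal (F (t, curve u t)) \<partial>lborel) (N * p) \<partial>?U) = (\<integral>\<^sup>+u. (SUP j. epowr (?I j u) (N * p)) \<partial>?U)"
      using Np by (simp add: I epowr_SUP)
    also have "\<dots> = (SUP j. \<integral>\<^sup>+u. epowr (?I j u) (N * p) \<partial>?U)"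
    proof (rule nn_integral_monotone_convergence_SUP)
      show "incseq (\<lambda>j u. epowr (?I j u) (N * p))"
        using inc Np by (intro incseq_SucI le_funI epowr_mono nn_integral_mono) (auto simp: incseq_def le_fun_def)
    qed measurable
    also have "\<dots> \<le> ennreal C * (\<integral>\<^sup>+z. ennreal (F z powr p) \<partial>lborel) ^ N"
    proof (rule SUP_least)
      fix j
      have "(\<integral>\<^sup>+u. epowr (?I j u) (N * p) \<partial>?U) \<le> ennreal C * (\<integral>\<^sup>+z. ennreal (G j z powr p) \<partial>lborel) ^ N"
        by (intro C(2) Gm G0 exI[of _ "real j"]) (auto simp: G_def)
      also have "\<dots> \<le> ennreal C * (\<integral>\<^sup>+z. ennreal (F z powr p) \<partial>lborel) ^ N"
        using GF G0 p0 by (intro mult_left_mono power_mono nn_integral_mono ennreal_leI powr_mono2) auto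
      finally show "(\<integral>\<^sup>+u. epowr (?I j u) (N * p) \<partial>?U) \<le> ennreal C * (\<integral>\<^sup>+z. ennreal (F z powr p) \<partial>lborel) ^ N" .
    qed
    finally show "(\<integral>\<^sup>+u. epowr (\<integral>\<^sup>+t. ennreal (F (t, curve u t)) \<partial>lborel) (N * p) \<partial>?U)
      \<le> ennreal C * (\<integral>\<^sup>+z. ennreal (F z powr p) \<partial>lborel) ^ N" .
  qed
qed

end

subsection \<open>Multiindices\<close>

text \<open>Stars and bars: appending the slack d - |\<alpha>| turns multiindices into lists of
  length n + 1 with sum exactly d.\<close>

lemma card_multiindices:
  "card (multiindices d :: (nat ^ 'n::finite) set) = (CARD('n) + d) choose d"
proof -
  obtain vs :: "'n list" where vs: "set vs = UNIV" "distinct vs"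
    using finite_distinct_list[of "UNIV :: 'n set"] by auto
  have len: "length vs = CARD('n)" using vs distinct_card by metis
  have sum: "sum_list (map (($) \<alpha>) vs) = (\<Sum>j\<in>UNIV. \<alpha> $ j)" for \<alpha> :: "nat ^ 'n"
    using sum_list_distinct_conv_sum_set[OF vs(2)] vs(1) by simp
  let ?f = "\<lambda>\<alpha> :: nat ^ 'n. map (($) \<alpha>) vs @ [d - (\<Sum>j\<in>UNIV. \<alpha> $ j)]"
  have "bij_betw ?f (multiindices d) {l. length l = CARD('n) + 1 \<and> sum_list l = d}"
  proof (intro bij_betw_imageI inj_onI equalityI subsetI)
    fix \<alpha> \<beta> assume "?f \<alpha> = ?f \<beta>"
    then show "\<alpha> = \<beta>" using vs by (auto simp: vec_eq_iff)
  next
    fix l assume "l \<in> ?f ` multiindices d"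
    then show "l \<in> {l. length l = CARD('n) + 1 \<and> sum_list l = d}"
      by (auto simp: sum len multiindices_def)
  next
    fix l :: "nat list" assume "l \<in> {l. length l = CARD('n) + 1 \<and> sum_list l = d}"
    then have l: "length l = CARD('n) + 1" "sum_list l = d" by auto
    then have split: "l = butlast l @ [last l]" by (metis Suc_eq_plus1 append_butlast_last_id length_0_conv nat.distinct(1))
    define \<alpha> :: "nat ^ 'n" where "\<alpha> = (\<chi> v. the (map_of (zip vs (butlast l)) v))"
    have "length vs = length (butlast l)" using l len by simp
    then have "map (($) \<alpha>) vs = butlast l"
      using map_of_zip_nth[OF _ vs(2), of "butlast l"] by (intro nth_equalityI) (auto simp: \<alpha>_def)
    moreover from this have "sum_list (butlast l) = (\<Sum>j\<in>UNIV. \<alpha> $ j)" using sum[of \<alpha>] by simp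
    moreover have "sum_list (butlast l) + last l = d" using l(2) split by (metis sum_list_append sum_list.Cons sum_list.Nil add_0_right)
    ultimately show "l \<in> ?f ` multiindices d"
      using split by (intro image_eqI[of _ _ \<alpha>]) (auto simp: multiindices_def)
  qed
  then have "card (multiindices d :: (nat ^ 'n) set) = card {l :: nat list. length l = CARD('n) + 1 \<and> sum_list l = d}"
    by (rule bij_betw_same_card)
  then show ?thesis by (simp add: card_length_sum_list add.commute)
qed

text \<open>d - |\<alpha>| counts the k < d with |\<alpha>| \<le> k. Exchanging sums leaves the
  numbers of multiindices of degree at most k, whose sum is one binomial coefficient by the
  hockey-stick identity; two absorption identities bring it to the stated form.\<close>

lemma sum_codegree_multiindices:
  "(CARD('n) + 1) * (\<Sum>\<alpha>\<in>(multiindices d :: (nat ^ 'n::finite) set). d - (\<Sum>j\<in>UNIV. \<alpha> $ j)) = d * ((CARD('n) + d) choose d)"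
proof -
  let ?n = "CARD('n)"
  let ?M = "multiindices d :: (nat ^ 'n) set"
  have "(\<Sum>\<alpha>\<in>?M. d - (\<Sum>j\<in>UNIV. \<alpha> $ j)) = (\<Sum>\<alpha>\<in>?M. \<Sum>k<d. if (\<Sum>j\<in>UNIV. \<alpha> $ j) \<le> k then 1 else 0)"
  proof (intro sum.cong refl)
    fix \<alpha> :: "nat ^ 'n"
    have "{..<d} \<inter> {k. (\<Sum>j\<in>UNIV. \<alpha> $ j) \<le> k} = {(\<Sum>j\<in>UNIV. \<alpha> $ j)..<d}" by auto
    then show "d - (\<Sum>j\<in>UNIV. \<alpha> $ j) = (\<Sum>k<d. if (\<Sum>j\<in>UNIV. \<alpha> $ j) \<le> k then 1 else 0)"
      by (simp add: sum.If_cases)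
  qed
  also have "\<dots> = (\<Sum>k<d. \<Sum>\<alpha>\<in>?M. if (\<Sum>j\<in>UNIV. \<alpha> $ j) \<le> k then 1 else 0)"
    by (rule sum.swap)
  also have "\<dots> = (\<Sum>k<d. (?n + k) choose k)"
  proof (intro sum.cong refl)
    fix k assume "k \<in> {..<d}"
    then have "?M \<inter> {\<alpha>. (\<Sum>j\<in>UNIV. \<alpha> $ j) \<le> k} = multiindices k" by (auto simp: multiindices_def)
    then show "(\<Sum>\<alpha>\<in>?M. if (\<Sum>j\<in>UNIV. \<alpha> $ j) \<le> k then 1 else 0) = (?n + k) choose k"
      by (simp add: sum.If_cases finite_multiindices card_multiindices)
  qed
  finally have S: "(\<Sum>\<alpha>\<in>?M. d - (\<Sum>j\<in>UNIV. \<alpha> $ j)) = (\<Sum>k<d. (?n + k) choose k)" .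
  show ?thesis
  proof (cases d)
    case 0
    then show ?thesis by (simp add: S)
  next
    case (Suc d')
    have "(\<Sum>k<d. (?n + k) choose k) = Suc (?n + d') choose d'"
      unfolding Suc lessThan_Suc_atMost by (rule sum_choose_lower)
    also have "\<dots> = Suc (?n + d') choose Suc ?n"
      using binomial_symmetric[of d' "Suc (?n + d')"] by simp
    finally have "(?n + 1) * (\<Sum>k<d. (?n + k) choose k) = Suc ?n * (Suc (?n + d') choose Suc ?n)" by simp
    also have "\<dots> = Suc (?n + d') * ((?n + d') choose ?n)" by (rule Suc_times_binomial)
    also have "(?n + d') choose ?n = (?n + d') choose d'"
      using binomial_symmetric[of ?n "?n + d'"] by simp
    also have "Suc (?n + d') * ((?n + d') choose d') = Suc d' * (Suc (?n + d') choose Suc d')" by (rule Suc_times_binomial[symmetric])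
    finally have X: "(?n + 1) * (\<Sum>k<d. (?n + k) choose k) = Suc d' * (Suc (?n + d') choose Suc d')" .
    show ?thesis unfolding S using X by (simp only: Suc add_Suc_right)
  qed
qed

text \<open>Exchanging the exponent of \<open>t\<^sub>v\<close> with the codegree, i.e. with the exponent of the homogenizing variable, is an involution.\<close>
lemma sum_coordinate_multiindices:
  "(\<Sum>\<alpha>\<in>(multiindices d :: (nat ^ 'n::finite) set). \<alpha> $ v) = (\<Sum>\<alpha>\<in>(multiindices d :: (nat ^ 'n) set). d - (\<Sum>j\<in>UNIV. \<alpha> $ j))"
proof -
  let ?M = "multiindices d :: (nat ^ 'n) set"
  let ?s = "\<lambda>\<alpha> :: nat ^ 'n. \<Sum>j\<in>UNIV. \<alpha> $ j"
  define g :: "nat ^ 'n \<Rightarrow> nat ^ 'n" where "g \<alpha> = (\<chi> w. if w = v then d - ?s \<alpha> else \<alpha> $ w)" for \<alpha>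
  have s: "?s \<alpha> = \<alpha> $ v + (\<Sum>j\<in>UNIV - {v}. \<alpha> $ j)" for \<alpha> by (simp add: sum.remove)
  have sg: "?s (g \<alpha>) = (d - ?s \<alpha>) + (\<Sum>j\<in>UNIV - {v}. \<alpha> $ j)" for \<alpha>
    unfolding s[of "g \<alpha>"] by (simp add: g_def)
  have sg': "?s (g \<alpha>) + \<alpha> $ v = d" if "\<alpha> \<in> ?M" for \<alpha>
    using that unfolding sg using s[of \<alpha>] by (simp add: multiindices_def)
  have gM: "g \<alpha> \<in> ?M" if "\<alpha> \<in> ?M" for \<alpha> using sg'[OF that] by (simp add: multiindices_def)
  have gg: "g (g \<alpha>) = \<alpha>" if "\<alpha> \<in> ?M" for \<alpha>
  proof -
    have "d - ?s (g \<alpha>) = \<alpha> $ v" using sg'[OF that] by simp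
    then show ?thesis by (auto simp: vec_eq_iff g_def[of "g \<alpha>"]) (simp add: g_def)
  qed
  have "(\<Sum>\<alpha>\<in>?M. \<alpha> $ v) = (\<Sum>\<alpha>\<in>?M. g \<alpha> $ v)"
    using gM gg by (intro sum.reindex_bij_witness[of _ g g]) auto
  then show ?thesis by (simp add: g_def)
qed

text \<open>Sorting the exponent lists gives the enumeration. The exchange of a coordinate with the
  codegree shows that each variable has total exponent dN/(n+1), and \<open>\<theta>\<close> is its
  reciprocal.\<close>

lemma multiindex_enumeration_exists:
  assumes "d \<ge> 1"
  shows "\<exists>(e :: nat \<Rightarrow> nat ^ 'n::finite) vs. multiindex_enumeration d (card (multiindices d :: (nat ^ 'n) set)) e vs
    ((real CARD('n) + 1) / (d * card (multiindices d :: (nat ^ 'n) set)))"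
proof -
  let ?M = "multiindices d :: (nat ^ 'n) set"
  let ?N = "card ?M"
  obtain vs :: "'n list" where vs: "set vs = UNIV" "distinct vs"
    using finite_distinct_list[of "UNIV :: 'n set"] by auto
  define L where "L \<alpha> = map (($) \<alpha>) vs" for \<alpha> :: "nat ^ 'n"
  have injL: "inj L" using vs by (auto simp: inj_def L_def vec_eq_iff)
  have fin: "finite (L ` ?M)" by (intro finite_imageI finite_multiindices)
  define ks where "ks = sorted_list_of_set (L ` ?M)"
  have ks: "set ks = L ` ?M" "sorted_wrt (<) ks" "distinct ks"
    unfolding ks_def using fin by auto
  have len: "length ks = ?N"
  proof -
    have "length ks = card (L ` ?M)" using distinct_card[OF ks(3)] ks(1) by simp
    also have "\<dots> = ?N" using injL by (intro card_image) (auto simp: inj_def inj_on_def)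
    finally show ?thesis .
  qed
  define e where "e i = inv L (ks ! i)" for i
  have Le: "L (e i) = ks ! i" if "i < ?N" for i
  proof -
    have "ks ! i \<in> set ks" using that len by simp
    then have "ks ! i \<in> range L" unfolding ks(1) by auto
    then show ?thesis by (simp add: e_def f_inv_into_f)
  qed
  have "bij_betw ((!) ks) {..<?N} (set ks)"
    using bij_betw_nth[OF ks(3)] len by auto
  moreover have "bij_betw (inv L) (L ` ?M) ?M"
    using injL by (intro bij_betw_imageI) (auto simp: inj_on_inv_into intro!: inj_on_inv_into)
  ultimately have bij: "bij_betw e {..<?N} ?M"
    unfolding e_def[abs_def] ks(1) by (drule_tac bij_betw_trans) (auto simp: o_def)
  have Npos: "?N > 0"
    using finite_multiindices[of d, where 'n='n] by (auto simp: card_gt_0_iff multiindices_def intro!: exI[of _ 0])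
  have "multiindex_enumeration d ?N e vs ((real CARD('n) + 1) / (d * ?N))"
  proof
    fix i k assume "i < k" "k < ?N"
    then have "ks ! i < ks ! k" using ks(2) len by (simp add: sorted_wrt_nth_less)
    then show "map (($) (e i)) vs < map (($) (e k)) vs"
      using Le[of i] Le[of k] \<open>i < k\<close> \<open>k < ?N\<close> by (simp add: L_def)
  next
    fix v :: 'n
    have "real ((CARD('n) + 1) * (\<Sum>\<alpha>\<in>?M. \<alpha> $ v)) = real (d * ?N)"
      unfolding sum_coordinate_multiindices sum_codegree_multiindices card_multiindices ..
    then show "(real CARD('n) + 1) / (d * ?N) * (\<Sum>\<alpha>\<in>?M. \<alpha> $ v) = 1"
      using Npos assms by (simp add: field_simps)
  qed (use assms vs bij Npos in auto)
  then show ?thesis by blast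
qed

section \<open>Transfer to coefficients indexed by multiindices\<close>

lemma distr_PiM_reindex_finite:
  fixes M :: "'b::euclidean_space measure"
  assumes "finite I" "bij_betw e I J"
  shows "distr (Pi\<^sub>M I (\<lambda>_. lborel :: 'b measure)) (Pi\<^sub>M J (\<lambda>_. lborel)) (\<lambda>w. \<lambda>j\<in>J. w (the_inv_into I e j)) = Pi\<^sub>M J (\<lambda>_. lborel)"
proof -
  interpret J: product_sigma_finite "\<lambda>_::'c. lborel :: 'b measure" by (rule product_sigma_finite_lborel)
  interpret I: product_sigma_finite "\<lambda>_::'a. lborel :: 'b measure" by (rule product_sigma_finite_lborel)
  have fJ: "finite J" using assms bij_betw_finite by auto
  have bij: "bij_betw (the_inv_into I e) J I" by (rule bij_betw_the_inv_into[OF assms(2)])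
  then have im: "the_inv_into I e j \<in> I" if "j \<in> J" for j using that by (auto simp: bij_betw_def)
  have meas: "(\<lambda>w. \<lambda>j\<in>J. w (the_inv_into I e j)) \<in> Pi\<^sub>M I (\<lambda>_. lborel :: 'b measure) \<rightarrow>\<^sub>M Pi\<^sub>M J (\<lambda>_. lborel)"
    using im by measurable
  show ?thesis
  proof (rule J.PiM_eqI[OF fJ])
    fix A :: "'c \<Rightarrow> 'b set" assume A: "\<And>j. j \<in> J \<Longrightarrow> A j \<in> sets lborel"
    have inv: "the_inv_into I e (e i) = i" if "i \<in> I" for i
      using assms(2) that by (simp add: bij_betw_def the_inv_into_f_f)
    have eJ: "e i \<in> J" if "i \<in> I" for i using assms(2) that by (auto simp: bij_betw_def)
    have "(\<lambda>w. \<lambda>j\<in>J. w (the_inv_into I e j)) -` Pi\<^sub>E J A \<inter> space (Pi\<^sub>M I (\<lambda>_. lborel)) = Pi\<^sub>E I (\<lambda>i. A (e i))"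
    proof (intro equalityI subsetI)
      fix w assume w: "w \<in> (\<lambda>w. \<lambda>j\<in>J. w (the_inv_into I e j)) -` Pi\<^sub>E J A \<inter> space (Pi\<^sub>M I (\<lambda>_. lborel))"
      have "w i \<in> A (e i)" if "i \<in> I" for i
        using w eJ[OF that] inv[OF that] by (auto simp: PiE_iff dest: bspec[of _ _ "e i"])
      then show "w \<in> Pi\<^sub>E I (\<lambda>i. A (e i))" using w by (auto simp: space_PiM PiE_iff)
    next
      fix w assume w: "w \<in> Pi\<^sub>E I (\<lambda>i. A (e i))"
      have "w (the_inv_into I e j) \<in> A j" if "j \<in> J" for j
        using w im[OF that] f_the_inv_into_f_bij_betw[OF assms(2), of j] that by (auto simp: PiE_iff)
      then show "w \<in> (\<lambda>w. \<lambda>j\<in>J. w (the_inv_into I e j)) -` Pi\<^sub>E J A \<inter> space (Pi\<^sub>M I (\<lambda>_. lborel))"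
        using w by (auto simp: space_PiM PiE_iff)
    qed
    then have "emeasure (distr (Pi\<^sub>M I (\<lambda>_. lborel :: 'b measure)) (Pi\<^sub>M J (\<lambda>_. lborel)) (\<lambda>w. \<lambda>j\<in>J. w (the_inv_into I e j))) (Pi\<^sub>E J A) = emeasure (Pi\<^sub>M I (\<lambda>_. lborel)) (Pi\<^sub>E I (\<lambda>i. A (e i)))"
      using A fJ by (subst emeasure_distr[OF meas]) (auto intro!: sets_PiM_I_finite)
    also have "\<dots> = (\<Prod>i\<in>I. emeasure lborel (A (e i)))"
      using A eJ assms(1) by (intro I.emeasure_PiM) auto
    also have "\<dots> = (\<Prod>j\<in>J. emeasure lborel (A j))"
      by (rule prod.reindex_bij_betw[OF assms(2)])
    finally show "emeasure (distr (Pi\<^sub>M I (\<lambda>_. lborel :: 'b measure)) (Pi\<^sub>M J (\<lambda>_. lborel)) (\<lambda>w. \<lambda>j\<in>J. w (the_inv_into I e j))) (Pi\<^sub>E J A) = (\<Prod>j\<in>J. emeasure lborel (A j))" .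
  qed simp
qed

lemma measurable_graph_point:
  "(\<lambda>(u, t). graph_point d u t) \<in> (Pi\<^sub>M (multiindices d) (\<lambda>_. lborel) \<Otimes>\<^sub>M borel) \<rightarrow>\<^sub>M (borel :: ((real ^ 'n::finite) \<times> (real ^ 'm::finite)) measure)"
  unfolding graph_point_def case_prod_beta by measurable

lemma measurable_graph_point1 [measurable]: "graph_point d u \<in> borel \<rightarrow>\<^sub>M borel"
  unfolding graph_point_def[abs_def] by measurable

text \<open>The operator on nonnegative functions with values in the extended reals, so that
  estimates can be proved before convergence of the integral is known.\<close>

definition radon :: "nat \<Rightarrow> ((real ^ 'n::finite) \<times> (real ^ 'm::finite) \<Rightarrow> real) \<Rightarrow> (nat ^ 'n \<Rightarrow> real ^ 'm) \<Rightarrow> ennreal" where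
  "radon d F u = (\<integral>\<^sup>+t. ennreal (F (graph_point d u t)) \<partial>lborel)"

lemma measurable_radon [measurable]:
  assumes [measurable]: "F \<in> borel_measurable borel"
  shows "radon d F \<in> borel_measurable (Pi\<^sub>M (multiindices d) (\<lambda>_. lborel))"
proof -
  have "(\<lambda>(u, t). ennreal (F (graph_point d u t))) \<in> borel_measurable (Pi\<^sub>M (multiindices d) (\<lambda>_. lborel) \<Otimes>\<^sub>M lborel)"
    unfolding case_prod_beta using measurable_compose[OF measurable_graph_point, of F borel d]
    by (simp add: case_prod_beta)
  then show ?thesis unfolding radon_def[abs_def] by (rule lborel.borel_measurable_nn_integral)
qed

text \<open>Relabelling coordinates preserves the product measure, so the estimate in enumerated
  coordinates carries over. Degree 0 lies outside the enumeration locale; there p = N = 1 and the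
  claim is Tonelli's theorem. This case later yields the vertex (1, 1) and the treatment of null
  sets.\<close>

lemma radon_strong_type:
  fixes d :: nat
  defines "N \<equiv> card (multiindices d :: (nat ^ 'n::finite) set)"
  defines "p \<equiv> 1 + real CARD('m::finite) * real d / (real CARD('n) + 1)"
  shows "\<exists>C>0. \<forall>F :: (real ^ 'n) \<times> (real ^ 'm) \<Rightarrow> real. F \<in> borel_measurable borel \<longrightarrow> (\<forall>z. 0 \<le> F z) \<longrightarrow>
    (\<integral>\<^sup>+u. epowr (radon d F u) (N * p) \<partial>Pi\<^sub>M (multiindices d) (\<lambda>_. lborel))
      \<le> ennreal C * (\<integral>\<^sup>+z. ennreal (F z powr p) \<partial>lborel) ^ N"
proof (cases "d = 0")
  case True
  interpret product_sigma_finite "\<lambda>_::nat ^ 'n. lborel :: (real ^ 'm) measure" by (rule product_sigma_finite_lborel)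
  have M: "(multiindices d :: (nat ^ 'n) set) = {0}"
    using True by (auto simp: multiindices_def vec_eq_iff)
  then have Np: "N = 1" "p = 1" using True by (auto simp: N_def p_def)
  show ?thesis
  proof (intro exI[of _ 1] conjI allI impI)
    fix F :: "(real ^ 'n) \<times> (real ^ 'm) \<Rightarrow> real"
    assume [measurable]: "F \<in> borel_measurable borel" and F0: "\<forall>z. 0 \<le> F z"
    have "(\<integral>\<^sup>+u. radon d F u \<partial>Pi\<^sub>M {0} (\<lambda>_. lborel)) = (\<integral>\<^sup>+y. \<integral>\<^sup>+t. ennreal (F (t, y)) \<partial>lborel \<partial>lborel)"
      unfolding radon_def graph_point_def M by (simp add: product_nn_integral_singleton[of "\<lambda>y. \<integral>\<^sup>+t. ennreal (F (t, y)) \<partial>lborel"])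
    also have "\<dots> = (\<integral>\<^sup>+t. \<integral>\<^sup>+y. ennreal (F (t, y)) \<partial>lborel \<partial>lborel)"
      by (intro nn_integral_swap sigma_finite_lborel) measurable
    also have "\<dots> = (\<integral>\<^sup>+z. ennreal (F z) \<partial>lborel)"
      using lborel.nn_integral_fst[of "\<lambda>z. ennreal (F z)" lborel] by (simp add: lborel_prod)
    finally show "(\<integral>\<^sup>+u. epowr (radon d F u) (N * p) \<partial>Pi\<^sub>M (multiindices d) (\<lambda>_. lborel))
      \<le> ennreal 1 * (\<integral>\<^sup>+z. ennreal (F z powr p) \<partial>lborel) ^ N"
      using F0[rule_format] by (simp add: Np M)
  qed simp
next
  case False
  let ?M = "multiindices d :: (nat ^ 'n) set"
  obtain e :: "nat \<Rightarrow> nat ^ 'n" and vs where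
    "multiindex_enumeration d N e vs ((real CARD('n) + 1) / (d * N))"
    using multiindex_enumeration_exists[of d] False unfolding N_def by (auto simp: Suc_leI)
  then interpret multiindex_enumeration d N e vs "(real CARD('n) + 1) / (d * N)" .
  have p: "p = 1 + DIM(real ^ 'm) / (N * ((real CARD('n) + 1) / (d * N)))"
  proof -
    have "N * ((real CARD('n) + 1) / (d * N)) = (real CARD('n) + 1) / d" using N_pos by simp
    then show ?thesis by (simp add: p_def)
  qed
  obtain C where C: "C > 0" "\<And>F :: (real ^ 'n) \<times> (real ^ 'm) \<Rightarrow> real. F \<in> borel_measurable borel \<Longrightarrow> (\<forall>z. 0 \<le> F z) \<Longrightarrow>
    (\<integral>\<^sup>+u. epowr (\<integral>\<^sup>+t. ennreal (F (t, curve u t)) \<partial>lborel) (N * p) \<partial>Pi\<^sub>M {..<N} (\<lambda>_. lborel))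
      \<le> ennreal C * (\<integral>\<^sup>+z. ennreal (F z powr p) \<partial>lborel) ^ N"
    using strong_type[OF p] by blast
  show ?thesis
  proof (intro exI[of _ C] conjI allI impI C(1))
    fix F :: "(real ^ 'n) \<times> (real ^ 'm) \<Rightarrow> real"
    assume F[measurable]: "F \<in> borel_measurable borel" and F0: "\<forall>z. 0 \<le> F z"
    let ?T = "\<lambda>w :: nat \<Rightarrow> real ^ 'm. \<lambda>\<alpha>\<in>?M. w (the_inv_into {..<N} e \<alpha>)"
    have Tm: "?T \<in> Pi\<^sub>M {..<N} (\<lambda>_. lborel) \<rightarrow>\<^sub>M Pi\<^sub>M ?M (\<lambda>_. lborel)"
      using bij_betw_apply[OF bij_betw_the_inv_into[OF bij]] by measurable
    have gp: "graph_point d (?T w) t = (t, curve w t)" for w t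
    proof -
      have "(\<Sum>\<alpha>\<in>?M. monomial t \<alpha> *\<^sub>R ?T w \<alpha>) = (\<Sum>k<N. monomial t (e k) *\<^sub>R ?T w (e k))"
        by (rule sum.reindex_bij_betw[OF bij, symmetric])
      also have "\<dots> = curve w t"
        unfolding curve_def using bij by (intro sum.cong) (auto simp: bij_betw_def the_inv_into_f_f)
      finally show ?thesis by (simp add: graph_point_def)
    qed
    have "(\<integral>\<^sup>+u. epowr (radon d F u) (N * p) \<partial>Pi\<^sub>M ?M (\<lambda>_. lborel)) = (\<integral>\<^sup>+w. epowr (radon d F (?T w)) (N * p) \<partial>Pi\<^sub>M {..<N} (\<lambda>_. lborel))"
      by (subst distr_PiM_reindex_finite[OF _ bij, symmetric], simp, subst nn_integral_distr[OF Tm]) measurable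
    also have "\<dots> \<le> ennreal C * (\<integral>\<^sup>+z. ennreal (F z powr p) \<partial>lborel) ^ N"
      unfolding radon_def gp using F F0 by (intro C(2)) auto
    finally show "(\<integral>\<^sup>+u. epowr (radon d F u) (N * p) \<partial>Pi\<^sub>M ?M (\<lambda>_. lborel)) \<le> ennreal C * (\<integral>\<^sup>+z. ennreal (F z powr p) \<partial>lborel) ^ N" .
  qed
qed

subsection \<open>Local estimates and interpolation\<close>

lemma nn_integral_lborel_shift:
  fixes f :: "'a::euclidean_space \<Rightarrow> ennreal"
  assumes "f \<in> borel_measurable borel"
  shows "(\<integral>\<^sup>+x. f (x + s) \<partial>lborel) = (\<integral>\<^sup>+x. f x \<partial>lborel)"
  using nn_integral_lborel_affine[of 1 f s] assms by (simp add: add.commute)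

lemma measurable_fst_borel [measurable]: "(fst :: 'a::second_countable_topology \<times> 'b::second_countable_topology \<Rightarrow> 'a) \<in> borel \<rightarrow>\<^sub>M borel"
  and measurable_snd_borel [measurable]: "(snd :: 'a \<times> 'b \<Rightarrow> 'b) \<in> borel \<rightarrow>\<^sub>M borel"
  unfolding borel_prod[symmetric] by (rule measurable_fst, rule measurable_snd)

lemma radon_frozen_strong_type:
  fixes j d :: nat
  defines "N \<equiv> card (multiindices j :: (nat ^ 'n::finite) set)"
  defines "p \<equiv> 1 + real CARD('m::finite) * real j / (real CARD('n) + 1)"
  assumes jd: "j \<le> d"
  shows "\<exists>C>0. \<forall>(F :: (real ^ 'n) \<times> (real ^ 'm) \<Rightarrow> real) B. F \<in> borel_measurable borel \<longrightarrow> (\<forall>z. 0 \<le> F z) \<longrightarrow>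
    (\<forall>\<alpha>\<in>multiindices d - multiindices j. B \<alpha> \<in> sets borel) \<longrightarrow>
    (\<integral>\<^sup>+u. (\<Prod>\<alpha>\<in>multiindices d - multiindices j. indicator (B \<alpha>) (u \<alpha>)) * epowr (radon d F u) (N * p) \<partial>Pi\<^sub>M (multiindices d) (\<lambda>_. lborel))
      \<le> ennreal C * (\<Prod>\<alpha>\<in>multiindices d - multiindices j. emeasure lborel (B \<alpha>)) * (\<integral>\<^sup>+z. ennreal (F z powr p) \<partial>lborel) ^ N"
proof -
  interpret product_sigma_finite "\<lambda>_::nat ^ 'n. lborel :: (real ^ 'm) measure" by (rule product_sigma_finite_lborel)
  let ?Md = "multiindices d :: (nat ^ 'n) set" and ?Mj = "multiindices j :: (nat ^ 'n) set"
  let ?R = "?Md - ?Mj"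
  have sub: "?Mj \<subseteq> ?Md" using jd by (auto simp: multiindices_def)
  have fin: "finite ?R" "finite ?Mj" "?R \<union> ?Mj = ?Md" "?R \<inter> ?Mj = {}"
    using sub finite_multiindices by auto
  obtain C where C: "C > 0" "\<And>F :: (real ^ 'n) \<times> (real ^ 'm) \<Rightarrow> real. F \<in> borel_measurable borel \<Longrightarrow> (\<forall>z. 0 \<le> F z) \<Longrightarrow>
    (\<integral>\<^sup>+u. epowr (radon j F u) (N * p) \<partial>Pi\<^sub>M ?Mj (\<lambda>_. lborel))
      \<le> ennreal C * (\<integral>\<^sup>+z. ennreal (F z powr p) \<partial>lborel) ^ N"
    using radon_strong_type[of j, where 'n='n and 'm='m] unfolding N_def p_def by blast
  show ?thesis
  proof (intro exI[of _ C] conjI allI impI C(1))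
    fix F :: "(real ^ 'n) \<times> (real ^ 'm) \<Rightarrow> real" and B :: "nat ^ 'n \<Rightarrow> (real ^ 'm) set"
    assume F[measurable]: "F \<in> borel_measurable borel" and F0: "\<forall>z. 0 \<le> F z"
      and B: "\<forall>\<alpha>\<in>?R. B \<alpha> \<in> sets borel"
    let ?E = "(\<integral>\<^sup>+z. ennreal (F z powr p) \<partial>lborel) ^ N"
    define s where "s x t = (\<Sum>\<alpha>\<in>?R. monomial t \<alpha> *\<^sub>R x \<alpha>)" for x :: "nat ^ 'n \<Rightarrow> real ^ 'm" and t
    have s[measurable]: "s x \<in> borel_measurable borel" for x unfolding s_def[abs_def] by measurable
    define G where "G x z = F (fst z, snd z + s x (fst z))" for x z
    have Gm[measurable]: "G x \<in> borel_measurable borel" for x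
      unfolding G_def[abs_def] by measurable
    have G0: "\<forall>z. 0 \<le> G x z" for x using F0 by (simp add: G_def)
    have Gint: "(\<integral>\<^sup>+z. ennreal (G x z powr p) \<partial>lborel) = (\<integral>\<^sup>+z. ennreal (F z powr p) \<partial>lborel)" for x
    proof -
      have "(\<integral>\<^sup>+z. ennreal (G x z powr p) \<partial>lborel) = (\<integral>\<^sup>+t. \<integral>\<^sup>+y. ennreal (G x (t, y) powr p) \<partial>lborel \<partial>lborel)"
        using lborel.nn_integral_fst[of "\<lambda>z. ennreal (G x z powr p)" lborel] by (simp add: lborel_prod)
      also have "\<dots> = (\<integral>\<^sup>+t. \<integral>\<^sup>+y. ennreal (F (t, y) powr p) \<partial>lborel \<partial>lborel)"
      proof (rule nn_integral_cong)
        fix t :: "real ^ 'n"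
        show "(\<integral>\<^sup>+y. ennreal (G x (t, y) powr p) \<partial>lborel) = (\<integral>\<^sup>+y. ennreal (F (t, y) powr p) \<partial>lborel)"
          unfolding G_def using nn_integral_lborel_shift[of "\<lambda>y. ennreal (F (t, y) powr p)" "s x t"] by simp
      qed
      also have "\<dots> = (\<integral>\<^sup>+z. ennreal (F z powr p) \<partial>lborel)"
        using lborel.nn_integral_fst[of "\<lambda>z. ennreal (F z powr p)" lborel] by (simp add: lborel_prod)
      finally show ?thesis .
    qed
    let ?f = "\<lambda>u. (\<Prod>\<alpha>\<in>?R. indicator (B \<alpha>) (u \<alpha>)) * epowr (radon d F u) (N * p)"
    have fm: "?f \<in> borel_measurable (Pi\<^sub>M (?R \<union> ?Mj) (\<lambda>_. lborel))"
      unfolding fin(3)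
    proof (intro borel_measurable_times_ennreal borel_measurable_prod_ennreal measurable_epowr measurable_radon F)
      fix \<alpha> assume "\<alpha> \<in> ?R"
      then have [measurable]: "B \<alpha> \<in> sets borel" "\<alpha> \<in> ?Md" using B by auto
      show "(\<lambda>u. indicator (B \<alpha>) (u \<alpha>) :: ennreal) \<in> borel_measurable (Pi\<^sub>M ?Md (\<lambda>_. lborel))"
        by measurable
    qed
    have mg: "?f (merge ?R ?Mj (x, y)) = (\<Prod>\<alpha>\<in>?R. indicator (B \<alpha>) (x \<alpha>)) * epowr (radon j (G x) y) (N * p)" for x y
    proof -
      have "graph_point d (merge ?R ?Mj (x, y)) t = (t, snd (graph_point j y t) + s x t)" for t
      proof -
        have "(\<Sum>\<alpha>\<in>?Md. monomial t \<alpha> *\<^sub>R merge ?R ?Mj (x, y) \<alpha>) = (\<Sum>\<alpha>\<in>?R. monomial t \<alpha> *\<^sub>R merge ?R ?Mj (x, y) \<alpha>) + (\<Sum>\<alpha>\<in>?Mj. monomial t \<alpha> *\<^sub>R merge ?R ?Mj (x, y) \<alpha>)"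
          using fin sum.union_disjoint[OF fin(1,2,4), of "\<lambda>\<alpha>. monomial t \<alpha> *\<^sub>R merge ?R ?Mj (x, y) \<alpha>"] by simp
        then show ?thesis by (simp add: graph_point_def s_def merge_def add.commute)
      qed
      then have "radon d F (merge ?R ?Mj (x, y)) = radon j (G x) y"
        by (simp add: radon_def G_def graph_point_def)
      moreover have "(\<Prod>\<alpha>\<in>?R. indicator (B \<alpha>) (merge ?R ?Mj (x, y) \<alpha>)) = (\<Prod>\<alpha>\<in>?R. indicator (B \<alpha>) (x \<alpha>) :: ennreal)"
        by (intro prod.cong) (auto simp: merge_def)
      ultimately show ?thesis by simp
    qed
    have "(\<integral>\<^sup>+u. ?f u \<partial>Pi\<^sub>M ?Md (\<lambda>_. lborel)) = (\<integral>\<^sup>+x. \<integral>\<^sup>+y. ?f (merge ?R ?Mj (x, y)) \<partial>Pi\<^sub>M ?Mj (\<lambda>_. lborel) \<partial>Pi\<^sub>M ?R (\<lambda>_. lborel))"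
      using product_nn_integral_fold[OF fin(4,1,2) fm] unfolding fin(3) .
    also have "\<dots> = (\<integral>\<^sup>+x. (\<Prod>\<alpha>\<in>?R. indicator (B \<alpha>) (x \<alpha>)) * (\<integral>\<^sup>+y. epowr (radon j (G x) y) (N * p) \<partial>Pi\<^sub>M ?Mj (\<lambda>_. lborel)) \<partial>Pi\<^sub>M ?R (\<lambda>_. lborel))"
      unfolding mg by (intro nn_integral_cong nn_integral_cmult) measurable
    also have "\<dots> \<le> (\<integral>\<^sup>+x. (\<Prod>\<alpha>\<in>?R. indicator (B \<alpha>) (x \<alpha>)) * (ennreal C * ?E) \<partial>Pi\<^sub>M ?R (\<lambda>_. lborel))"
      using C(2)[OF Gm G0] unfolding Gint by (intro nn_integral_mono mult_left_mono) auto
    also have "\<dots> = (\<integral>\<^sup>+x. (\<Prod>\<alpha>\<in>?R. indicator (B \<alpha>) (x \<alpha>)) \<partial>Pi\<^sub>M ?R (\<lambda>_. lborel)) * (ennreal C * ?E)"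
    proof (intro nn_integral_multc borel_measurable_prod_ennreal)
      fix \<alpha> assume "\<alpha> \<in> ?R"
      then have [measurable]: "B \<alpha> \<in> sets borel" "\<alpha> \<in> ?R" using B by auto
      show "(\<lambda>u. indicator (B \<alpha>) (u \<alpha>) :: ennreal) \<in> borel_measurable (Pi\<^sub>M ?R (\<lambda>_. lborel))"
        by measurable
    qed
    also have "(\<integral>\<^sup>+x. (\<Prod>\<alpha>\<in>?R. indicator (B \<alpha>) (x \<alpha>)) \<partial>Pi\<^sub>M ?R (\<lambda>_. lborel)) = (\<Prod>\<alpha>\<in>?R. emeasure lborel (B \<alpha>))"
      using B by (subst product_nn_integral_prod[OF fin(1)]) (auto intro!: prod.cong)
    finally show "(\<integral>\<^sup>+u. ?f u \<partial>Pi\<^sub>M ?Md (\<lambda>_. lborel)) \<le> ennreal C * (\<Prod>\<alpha>\<in>?R. emeasure lborel (B \<alpha>)) * ?E"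
      by (simp add: mult_ac)
  qed
qed

lemma AE_radon_null:
  fixes Z :: "((real ^ 'n::finite) \<times> (real ^ 'm::finite)) set"
  assumes Z[measurable]: "Z \<in> sets borel" and "emeasure lborel Z = 0"
  shows "AE u in Pi\<^sub>M (multiindices d) (\<lambda>_. lborel). AE t in lborel. graph_point d u t \<notin> Z"
proof -
  let ?M = "Pi\<^sub>M (multiindices d) (\<lambda>_. lborel) :: (nat ^ 'n \<Rightarrow> real ^ 'm) measure"
  have M0: "(multiindices 0 :: (nat ^ 'n) set) = {0}" by (auto simp: multiindices_def vec_eq_iff)
  let ?R = "multiindices d - multiindices 0 :: (nat ^ 'n) set"
  obtain C where "\<And>(F :: (real ^ 'n) \<times> (real ^ 'm) \<Rightarrow> real) B. F \<in> borel_measurable borel \<Longrightarrow> (\<forall>z. 0 \<le> F z) \<Longrightarrow>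
    (\<forall>\<alpha>\<in>?R. B \<alpha> \<in> sets borel) \<Longrightarrow>
    (\<integral>\<^sup>+u. (\<Prod>\<alpha>\<in>?R. indicator (B \<alpha>) (u \<alpha>)) * epowr (radon d F u) (card (multiindices 0 :: (nat ^ 'n) set) * (1 + real CARD('m) * real 0 / (real CARD('n) + 1))) \<partial>?M)
      \<le> ennreal C * (\<Prod>\<alpha>\<in>?R. emeasure lborel (B \<alpha>)) * (\<integral>\<^sup>+z. ennreal (F z powr (1 + real CARD('m) * real 0 / (real CARD('n) + 1))) \<partial>lborel) ^ card (multiindices 0 :: (nat ^ 'n) set)"
    using radon_frozen_strong_type[of 0 d, where 'n='n and 'm='m] by blast
  \<comment> \<open>With every B equal to the whole space the product of measures may be infinite;
    multiplied by the measure 0 of Z it is 0 in \<open>ennreal\<close>.\<close>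
  from this[of "indicator Z" "\<lambda>_. UNIV"]
  have "(\<integral>\<^sup>+u. radon d (indicator Z) u \<partial>?M) \<le> ennreal C * (\<Prod>\<alpha>\<in>?R. emeasure lborel (UNIV :: (real ^ 'm) set)) * (\<integral>\<^sup>+z. ennreal (indicator Z z) \<partial>lborel)"
    by (simp add: M0)
  also have "(\<integral>\<^sup>+z. ennreal (indicator Z z) \<partial>lborel) = 0"
    using assms by (simp add: ennreal_indicator)
  finally have "(\<integral>\<^sup>+u. radon d (indicator Z) u \<partial>?M) = 0" by simp
  then have "AE u in ?M. radon d (indicator Z) u = 0"
    by (subst (asm) nn_integral_0_iff_AE) auto
  then show ?thesis
  proof eventually_elim
    case (elim u)
    then have "AE t in lborel. ennreal (indicator Z (graph_point d u t)) = 0"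
      unfolding radon_def by (subst (asm) nn_integral_0_iff_AE) measurable
    then show ?case by eventually_elim (auto simp: indicator_def split: if_splits)
  qed
qed

section \<open>The localized bilinear form and interpolation\<close>

definition coeff_box :: "nat \<Rightarrow> real \<Rightarrow> (nat ^ 'n::finite \<Rightarrow> real ^ 'm::finite) set" where
  "coeff_box d R = Pi\<^sub>E (multiindices d) (\<lambda>_. cball 0 R)"

lemma sets_coeff_box [measurable]: "coeff_box d R \<in> sets (Pi\<^sub>M (multiindices d) (\<lambda>_. lborel))"
  unfolding coeff_box_def by (intro sets_PiM_I_finite finite_multiindices) auto

lemma emeasure_coeff_box_finite:
  "emeasure (Pi\<^sub>M (multiindices d) (\<lambda>_. lborel)) (coeff_box d R :: (nat ^ 'n::finite \<Rightarrow> real ^ 'm::finite) set) < \<infinity>"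
  unfolding coeff_box_def
  using emeasure_lborel_cball_finite[of "0 :: real ^ 'm" R]
  by (subst product_sigma_finite.emeasure_PiM[OF product_sigma_finite_lborel finite_multiindices])
     (auto simp: power_eq_top_ennreal less_top[symmetric])

text \<open>Localization in t, the variable of integration; it makes the transform of a bounded
  function bounded, as used at the vertices (0, 0) and (0, 1).\<close>

definition slab :: "real \<Rightarrow> ('a::real_normed_vector \<times> 'b \<Rightarrow> real) \<Rightarrow> 'a \<times> 'b \<Rightarrow> real" where
  "slab R F z = (if norm (fst z) \<le> R then F z else 0)"

lemma measurable_slab [measurable (raw)]:
  fixes F :: "'a::euclidean_space \<times> 'b::euclidean_space \<Rightarrow> real"
  assumes [measurable]: "F \<in> borel_measurable borel"
  shows "slab R F \<in> borel_measurable borel"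
proof -
  show ?thesis unfolding slab_def[abs_def] by measurable
qed

definition unit_pair :: "nat \<Rightarrow> ((real ^ 'n::finite) \<times> (real ^ 'm::finite) \<Rightarrow> real) \<Rightarrow> ((nat ^ 'n \<Rightarrow> real ^ 'm) \<Rightarrow> real) \<Rightarrow> bool" where
  "unit_pair d F H \<longleftrightarrow> F \<in> borel_measurable borel \<and> (\<forall>z. 0 \<le> F z) \<and> (\<integral>\<^sup>+z. ennreal (F z) \<partial>lborel) \<le> 1 \<and>
      H \<in> borel_measurable (Pi\<^sub>M (multiindices d) (\<lambda>_. lborel)) \<and> (\<forall>u. 0 \<le> H u) \<and>
      (\<integral>\<^sup>+u. ennreal (H u) \<partial>Pi\<^sub>M (multiindices d) (\<lambda>_. lborel)) \<le> 1"

text \<open>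
  By duality, the bound \<open>\<parallel>T f\<parallel>\<^sub>q \<le> C \<parallel>f\<parallel>\<^sub>p\<close> for \<open>f = F\<^bsup>1/p\<^esup>\<close> is tested against \<open>H\<^bsup>1-1/q\<^esup>\<close> with
  \<open>\<integral>F \<le> 1\<close> and \<open>\<integral>H \<le> 1\<close>. In this form interpolation is the pointwise arithmetic-geometric mean
  inequality. Note that \<open>0 powr 0 = 0\<close>.
\<close>
definition local_form_bounded :: "'n::finite itself \<Rightarrow> 'm::finite itself \<Rightarrow> nat \<Rightarrow> real \<Rightarrow> real \<times> real \<Rightarrow> bool" where
  "local_form_bounded _ _ d R z \<longleftrightarrow>
    (\<exists>C::real. \<forall>(F :: (real ^ 'n) \<times> (real ^ 'm) \<Rightarrow> real) H. unit_pair d F H \<longrightarrow>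
      (\<integral>\<^sup>+u. indicator (coeff_box d R) u * ennreal (H u powr (1 - snd z)) * radon d (slab R (\<lambda>w. F w powr fst z)) u
         \<partial>Pi\<^sub>M (multiindices d) (\<lambda>_. lborel)) \<le> ennreal C)"

lemma powr_convex_le:
  fixes a b :: real
  assumes "0 \<le> a" "0 \<le> b" "0 \<le> s" "s \<le> 1"
  shows "a powr (1 - s) * b powr s \<le> a + b"
proof -
  have "a powr (1 - s) * b powr s \<le> max a b powr (1 - s) * max a b powr s"
    using assms by (intro mult_mono powr_mono2) auto
  also have "\<dots> = max a b" using assms by (simp add: powr_add[symmetric])
  also have "\<dots> \<le> a + b" using assms by auto
  finally show ?thesis .
qed

text \<open>The exponents of F and H are affine in the point, so the integrand at a convex
  combination is the weighted geometric mean of the integrands at the end points, for the same F and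
  H, and hence at most their sum. The identities for \<open>powr\<close> behind this also hold at 0,
  exponent 0 included.\<close>

lemma convex_local_form_bounded: "convex {z. local_form_bounded TYPE('n::finite) TYPE('m::finite) d R z}"
proof (rule convexI, unfold mem_Collect_eq)
  fix z0 z1 :: "real \<times> real" and a b :: real
  assume "local_form_bounded TYPE('n) TYPE('m) d R z0" "local_form_bounded TYPE('n) TYPE('m) d R z1"
    and ab: "0 \<le> a" "0 \<le> b" "a + b = 1"
  let ?U = "Pi\<^sub>M (multiindices d) (\<lambda>_. lborel) :: (nat ^ 'n \<Rightarrow> real ^ 'm) measure"
  let ?B = "\<lambda>F H z. \<integral>\<^sup>+u. indicator (coeff_box d R) u * ennreal (H u powr (1 - snd z)) * radon d (slab R (\<lambda>w. F w powr fst z)) u \<partial>?U"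
  obtain C0 C1 where C: "\<And>F H. unit_pair d F H \<Longrightarrow> ?B F H z0 \<le> ennreal C0" "\<And>F H. unit_pair d F H \<Longrightarrow> ?B F H z1 \<le> ennreal C1"
    using \<open>local_form_bounded TYPE('n) TYPE('m) d R z0\<close> \<open>local_form_bounded TYPE('n) TYPE('m) d R z1\<close>
    unfolding local_form_bounded_def by blast
  have a: "a = 1 - b" using ab by simp
  let ?z = "a *\<^sub>R z0 + b *\<^sub>R z1"
  have "?B F H ?z \<le> ennreal (max C0 0 + max C1 0)" if ok: "unit_pair d F H" for F H
  proof -
    have [measurable]: "F \<in> borel_measurable borel" "H \<in> borel_measurable ?U" using ok by (auto simp: unit_pair_def)
    have F0: "0 \<le> F z" and H0: "0 \<le> H u" for z u using ok unfolding unit_pair_def by blast+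
    have pt: "ennreal (H u powr (1 - snd ?z)) * radon d (slab R (\<lambda>w. F w powr fst ?z)) u
        \<le> ennreal (H u powr (1 - snd z0)) * radon d (slab R (\<lambda>w. F w powr fst z0)) u + ennreal (H u powr (1 - snd z1)) * radon d (slab R (\<lambda>w. F w powr fst z1)) u" for u
    proof -
      have sm[measurable]: "(\<lambda>t. slab R (\<lambda>w. F w powr e) (graph_point d u t)) \<in> borel_measurable borel" for e
        by (rule measurable_compose[OF measurable_graph_point1 measurable_slab]) measurable
      have cm: "(\<integral>\<^sup>+t. ennreal c * ennreal (slab R (\<lambda>w. F w powr e) (graph_point d u t)) \<partial>lborel) = ennreal c * radon d (slab R (\<lambda>w. F w powr e)) u" for c e
        unfolding radon_def by (rule nn_integral_cmult) (use sm in measurable)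
      have "H u powr (1 - snd ?z) * slab R (\<lambda>w. F w powr fst ?z) w \<le> H u powr (1 - snd z0) * slab R (\<lambda>w. F w powr fst z0) w + H u powr (1 - snd z1) * slab R (\<lambda>w. F w powr fst z1) w" for w
      proof -
        have "H u powr (1 - snd ?z) * F w powr fst ?z = (H u powr (1 - snd z0) * F w powr fst z0) powr (1 - b) * (H u powr (1 - snd z1) * F w powr fst z1) powr b"
        proof -
          have e: "1 - snd ?z = (1 - snd z0) * (1 - b) + (1 - snd z1) * b" "fst ?z = fst z0 * (1 - b) + fst z1 * b"
            by (simp_all add: a algebra_simps)
          show ?thesis unfolding e powr_add by (simp add: powr_mult powr_powr mult_ac)
        qed
        also have "\<dots> \<le> H u powr (1 - snd z0) * F w powr fst z0 + H u powr (1 - snd z1) * F w powr fst z1"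
          using ab by (intro powr_convex_le) auto
        finally show ?thesis by (simp add: slab_def)
      qed
      then have "(\<integral>\<^sup>+t. ennreal (H u powr (1 - snd ?z)) * ennreal (slab R (\<lambda>w. F w powr fst ?z) (graph_point d u t)) \<partial>lborel)
        \<le> (\<integral>\<^sup>+t. ennreal (H u powr (1 - snd z0)) * ennreal (slab R (\<lambda>w. F w powr fst z0) (graph_point d u t)) + ennreal (H u powr (1 - snd z1)) * ennreal (slab R (\<lambda>w. F w powr fst z1) (graph_point d u t)) \<partial>lborel)"
        by (intro nn_integral_mono) (simp add: ennreal_mult[symmetric] ennreal_plus[symmetric] slab_def ennreal_leI del: ennreal_plus)
      also have "\<dots> = (\<integral>\<^sup>+t. ennreal (H u powr (1 - snd z0)) * ennreal (slab R (\<lambda>w. F w powr fst z0) (graph_point d u t)) \<partial>lborel)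
          + (\<integral>\<^sup>+t. ennreal (H u powr (1 - snd z1)) * ennreal (slab R (\<lambda>w. F w powr fst z1) (graph_point d u t)) \<partial>lborel)"
        by (rule nn_integral_add) measurable
      finally show ?thesis unfolding cm .
    qed
    have "?B F H ?z \<le> (\<integral>\<^sup>+u. indicator (coeff_box d R) u * ennreal (H u powr (1 - snd z0)) * radon d (slab R (\<lambda>w. F w powr fst z0)) u
        + indicator (coeff_box d R) u * ennreal (H u powr (1 - snd z1)) * radon d (slab R (\<lambda>w. F w powr fst z1)) u \<partial>?U)"
      using pt by (intro nn_integral_mono) (auto split: split_indicator)
    also have "\<dots> = ?B F H z0 + ?B F H z1"
      by (rule nn_integral_add) measurable
    also have "\<dots> \<le> ennreal (max C0 0) + ennreal (max C1 0)"
      using C[OF ok] by (intro add_mono) (auto intro: order.trans[OF _ ennreal_leI])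
    finally show ?thesis by simp
  qed
  then show "local_form_bounded TYPE('n) TYPE('m) d R ?z"
    unfolding local_form_bounded_def by blast
qed


lemma radon_slab_indicator_le:
  fixes u :: "nat ^ 'n::finite \<Rightarrow> real ^ 'm::finite"
  shows "radon d (slab R (\<lambda>w. if P w then 0 else 1)) u \<le> emeasure lborel (cball (0 :: real ^ 'n) R)"
proof -
  have "radon d (slab R (\<lambda>w. if P w then 0 else 1)) u \<le> (\<integral>\<^sup>+t. indicator (cball (0 :: real ^ 'n) R) t \<partial>lborel)"
    unfolding radon_def by (intro nn_integral_mono) (auto simp: slab_def graph_point_def split: split_indicator)
  then show ?thesis by simp
qed

lemma powr_0_eq: "(x::real) powr 0 = (if x = 0 then 0 else 1)"
  by simp

text \<open>The trivial bound from L^\<infinity> to L^\<infinity>: F enters as the indicator of its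
  support, whose slab has transform at most the volume of the ball, and H enters to the first
  power.\<close>

lemma local_form_bounded_00: "local_form_bounded TYPE('n::finite) TYPE('m::finite) d R (0, 0)"
proof -
  let ?U = "Pi\<^sub>M (multiindices d) (\<lambda>_. lborel) :: (nat ^ 'n \<Rightarrow> real ^ 'm) measure"
  let ?V = "emeasure lborel (cball (0 :: real ^ 'n) R)"
  have V: "?V = ennreal (enn2real ?V)"
    using emeasure_lborel_cball_finite[of "0 :: real ^ 'n" R] by (simp add: less_top)
  have "(\<integral>\<^sup>+u. indicator (coeff_box d R) u * ennreal (H u powr (1 - snd (0, 0))) * radon d (slab R (\<lambda>w. F w powr fst (0, 0))) u \<partial>?U) \<le> ennreal (enn2real ?V)"
    if ok: "unit_pair d F H" for F H
  proof -
    have [measurable]: "H \<in> borel_measurable ?U" and H0: "\<And>u. 0 \<le> H u" and H1: "(\<integral>\<^sup>+u. ennreal (H u) \<partial>?U) \<le> 1"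
      using ok unfolding unit_pair_def by blast+
    have "(\<integral>\<^sup>+u. indicator (coeff_box d R) u * ennreal (H u powr (1 - snd (0, 0))) * radon d (slab R (\<lambda>w. F w powr fst (0, 0))) u \<partial>?U)
      \<le> (\<integral>\<^sup>+u. ennreal (H u) * ?V \<partial>?U)"
      using radon_slab_indicator_le[of d R "\<lambda>w. F w = 0"] H0
      by (intro nn_integral_mono) (auto simp: powr_0_eq intro!: mult_left_mono split: split_indicator)
    also have "\<dots> = (\<integral>\<^sup>+u. ennreal (H u) \<partial>?U) * ?V" by (rule nn_integral_multc) measurable
    also have "\<dots> \<le> 1 * ?V" by (intro mult_right_mono H1) auto
    finally show ?thesis using V by simp
  qed
  then show ?thesis unfolding local_form_bounded_def by blast
qed

text \<open>The bound from L^\<infinity> to L^1: H enters to the power 0, which is at most 1, and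
  the coefficient box has finite measure.\<close>

lemma local_form_bounded_01: "local_form_bounded TYPE('n::finite) TYPE('m::finite) d R (0, 1)"
proof -
  let ?U = "Pi\<^sub>M (multiindices d) (\<lambda>_. lborel) :: (nat ^ 'n \<Rightarrow> real ^ 'm) measure"
  let ?V = "emeasure lborel (cball (0 :: real ^ 'n) R)"
  let ?C = "emeasure ?U (coeff_box d R) * ?V"
  have C: "?C = ennreal (enn2real ?C)"
    using emeasure_lborel_cball_finite[of "0 :: real ^ 'n" R] emeasure_coeff_box_finite[of d R, where 'n='n and 'm='m]
    by (simp add: ennreal_mult_less_top)
  have "(\<integral>\<^sup>+u. indicator (coeff_box d R) u * ennreal (H u powr (1 - snd (0, 1))) * radon d (slab R (\<lambda>w. F w powr fst (0, 1))) u \<partial>?U) \<le> ennreal (enn2real ?C)"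
    for F and H :: "(nat ^ 'n \<Rightarrow> real ^ 'm) \<Rightarrow> real"
  proof -
    have "(\<integral>\<^sup>+u. indicator (coeff_box d R) u * ennreal (H u powr (1 - snd (0, 1))) * radon d (slab R (\<lambda>w. F w powr fst (0, 1))) u \<partial>?U)
      \<le> (\<integral>\<^sup>+u. ?V * indicator (coeff_box d R) u \<partial>?U)"
      using radon_slab_indicator_le[of d R "\<lambda>w. F w = 0"]
      by (intro nn_integral_mono) (auto simp: powr_0_eq split: split_indicator)
    also have "\<dots> = ?C" by (subst nn_integral_cmult_indicator) (auto simp: mult.commute)
    finally show ?thesis using C by simp
  qed
  then show ?thesis unfolding local_form_bounded_def by blast
qed

text \<open>Young's inequality without sharp constants: either a \<le> b^y and the left-hand side is
  at most b, or b \<le> a^(1/y) and it is at most a^(1/y).\<close>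

lemma mult_epowr_le:
  fixes a :: ennreal and b y :: real
  assumes "0 < y" "y \<le> 1" "0 \<le> b"
  shows "ennreal (b powr (1 - y)) * a \<le> epowr a (1 / y) + ennreal b"
proof (cases a)
  case (real r)
  have "b powr (1 - y) * r \<le> r powr (1 / y) + b"
  proof (cases "r \<le> b powr y")
    case True
    then have "b powr (1 - y) * r \<le> b powr (1 - y) * b powr y" by (intro mult_left_mono) auto
    also have "\<dots> = b" using assms by (simp add: powr_add[symmetric])
    finally show ?thesis by (simp add: add_increasing)
  next
    case False
    then have r: "r > 0" "b powr y \<le> r" using real by (auto intro: le_less_trans[of 0 "b powr y"])
    then have "(b powr y) powr (1 / y) \<le> r powr (1 / y)" using assms by (intro powr_mono2) auto
    then have "b \<le> r powr (1 / y)" using assms by (simp add: powr_powr)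
    then have "b powr (1 - y) * r \<le> (r powr (1 / y)) powr (1 - y) * r"
      using assms r by (intro mult_right_mono powr_mono2) auto
    also have "\<dots> = r powr (1 / y * (1 - y)) * r powr 1" using r by (simp add: powr_powr)
    also have "\<dots> = r powr (1 / y)" unfolding powr_add[symmetric] using assms by (simp add: field_simps)
    finally show ?thesis using assms by simp
  qed
  then show ?thesis
    using real assms by (simp add: ennreal_mult[symmetric] ennreal_plus[symmetric] ennreal_leI del: ennreal_plus)
qed simp

lemma critical_point_0: "critical_point n m 0 = (1, 1)"
  by (simp add: critical_point_def add_pos_nonneg)

lemma local_form_bounded_critical:
  assumes "j \<le> d"
  shows "local_form_bounded TYPE('n::finite) TYPE('m::finite) d R (critical_point CARD('n) CARD('m) j)"
proof -
  let ?U = "Pi\<^sub>M (multiindices d) (\<lambda>_. lborel) :: (nat ^ 'n \<Rightarrow> real ^ 'm) measure"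
  let ?Rest = "multiindices d - multiindices j :: (nat ^ 'n) set"
  define N where "N = card (multiindices j :: (nat ^ 'n) set)"
  define p where "p = 1 + real CARD('m) * real j / (real CARD('n) + 1)"
  have p: "p \<ge> 1" by (simp add: p_def)
  have N: "N \<ge> 1"
    using finite_multiindices[of j, where 'n='n] by (auto simp: N_def Suc_le_eq card_gt_0_iff multiindices_def intro!: exI[of _ 0])
  have cp: "critical_point CARD('n) CARD('m) j = (1 / p, 1 / (N * p))"
  proof -
    have "(real CARD('n) + 1) / (real CARD('n) + real CARD('m) * real j + 1) = 1 / p"
      by (simp add: p_def field_simps add_pos_nonneg)
    then show ?thesis by (simp add: critical_point_def Let_def N_def card_multiindices inverse_eq_divide)
  qed
  have Np: "N * p \<ge> 1" using N p by (metis mult_le_cancel_right1 mult_mono' of_nat_1 of_nat_mono zero_le_one mult_1)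
  obtain C where C: "C > 0" "\<And>(F :: (real ^ 'n) \<times> (real ^ 'm) \<Rightarrow> real) B. F \<in> borel_measurable borel \<Longrightarrow> (\<forall>z. 0 \<le> F z) \<Longrightarrow>
    (\<forall>\<alpha>\<in>?Rest. B \<alpha> \<in> sets borel) \<Longrightarrow>
    (\<integral>\<^sup>+u. (\<Prod>\<alpha>\<in>?Rest. indicator (B \<alpha>) (u \<alpha>)) * epowr (radon d F u) (N * p) \<partial>?U)
      \<le> ennreal C * (\<Prod>\<alpha>\<in>?Rest. emeasure lborel (B \<alpha>)) * (\<integral>\<^sup>+z. ennreal (F z powr p) \<partial>lborel) ^ N"
    using radon_frozen_strong_type[OF assms, where 'n='n and 'm='m] unfolding N_def p_def by blast
  let ?V = "\<Prod>\<alpha>\<in>?Rest. emeasure lborel (cball (0 :: real ^ 'm) R)"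
  have "?V < \<infinity>"
    using emeasure_lborel_cball_finite[of "0 :: real ^ 'm" R] by (auto simp: power_eq_top_ennreal less_top[symmetric])
  then obtain V where V: "?V = ennreal V" "V \<ge> 0" by (cases ?V) auto
  have "(\<integral>\<^sup>+u. indicator (coeff_box d R) u * ennreal (H u powr (1 - snd (1 / p, 1 / (N * p)))) * radon d (slab R (\<lambda>w. F w powr fst (1 / p, 1 / (N * p)))) u \<partial>?U) \<le> ennreal (C * V + 1)"
    if ok: "unit_pair d F H" for F H
  proof -
    have [measurable]: "F \<in> borel_measurable borel" "H \<in> borel_measurable ?U" and F0: "\<And>z. 0 \<le> F z" and F1: "(\<integral>\<^sup>+z. ennreal (F z) \<partial>lborel) \<le> 1"
      and H0: "\<And>u. 0 \<le> H u" and H1: "(\<integral>\<^sup>+u. ennreal (H u) \<partial>?U) \<le> 1"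
      using ok unfolding unit_pair_def by blast+
    let ?G = "slab R (\<lambda>w. F w powr (1 / p))"
    let ?I = "\<lambda>u. \<Prod>\<alpha>\<in>?Rest. indicator (cball 0 R) (u \<alpha>) :: ennreal"
    have Im: "?I \<in> borel_measurable ?U"
    proof (intro borel_measurable_prod_ennreal)
      fix \<alpha> assume "\<alpha> \<in> ?Rest"
      then have "\<alpha> \<in> multiindices d" by simp
      then show "(\<lambda>u. indicator (cball 0 R) (u \<alpha>) :: ennreal) \<in> borel_measurable ?U"
        by (rule measurable_compose[OF measurable_component_singleton]) (simp add: borel_measurable_indicator)
    qed
    have "(\<integral>\<^sup>+u. indicator (coeff_box d R) u * ennreal (H u powr (1 - snd (1 / p, 1 / (N * p)))) * radon d (slab R (\<lambda>w. F w powr fst (1 / p, 1 / (N * p)))) u \<partial>?U)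
      \<le> (\<integral>\<^sup>+u. ?I u * epowr (radon d ?G u) (N * p) + ennreal (H u) \<partial>?U)"
    proof (rule nn_integral_mono)
      fix u
      have "ennreal (H u powr (1 - 1 / (N * p))) * radon d ?G u \<le> epowr (radon d ?G u) (N * p) + ennreal (H u)"
        using mult_epowr_le[of "1 / (N * p)" "H u" "radon d ?G u"] Np H0 by simp
      moreover have "?I u = 1" if "u \<in> coeff_box d R"
        using that by (intro prod.neutral) (auto simp: coeff_box_def PiE_iff)
      ultimately show "indicator (coeff_box d R) u * ennreal (H u powr (1 - snd (1 / p, 1 / (N * p)))) * radon d (slab R (\<lambda>w. F w powr fst (1 / p, 1 / (N * p)))) u
        \<le> ?I u * epowr (radon d ?G u) (N * p) + ennreal (H u)"
        by (auto split: split_indicator)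
    qed
    also have "\<dots> = (\<integral>\<^sup>+u. ?I u * epowr (radon d ?G u) (N * p) \<partial>?U) + (\<integral>\<^sup>+u. ennreal (H u) \<partial>?U)"
      by (intro nn_integral_add borel_measurable_times_ennreal Im) measurable
    also have "\<dots> \<le> ennreal C * ?V * (\<integral>\<^sup>+z. ennreal (?G z powr p) \<partial>lborel) ^ N + 1"
      by (intro add_mono C(2) H1) (auto simp: slab_def)
    also have "\<dots> \<le> ennreal C * ?V * 1 ^ N + 1"
    proof (intro add_mono mult_left_mono power_mono order.refl)
      have "(\<integral>\<^sup>+z. ennreal (?G z powr p) \<partial>lborel) \<le> (\<integral>\<^sup>+z. ennreal (F z) \<partial>lborel)"
        using p F0 by (intro nn_integral_mono) (auto simp: slab_def powr_powr)
      then show "(\<integral>\<^sup>+z. ennreal (?G z powr p) \<partial>lborel) \<le> 1" using F1 by (rule order.trans)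
    qed auto
    also have "\<dots> = ennreal (C * V + 1)"
      unfolding V(1) using C(1) V(2) by (simp add: ennreal_mult ennreal_plus)
    finally show ?thesis .
  qed
  then show ?thesis unfolding local_form_bounded_def cp by blast
qed

lemma local_form_bounded_hull:
  assumes "z \<in> closure (convex hull ({(0, 0), (1, 1), (0, 1)} \<union> critical_point CARD('n) CARD('m) ` {1..d}))"
  shows "local_form_bounded TYPE('n::finite) TYPE('m::finite) d R z"
proof -
  let ?S = "{(0, 0), (1, 1), (0, 1)} \<union> critical_point CARD('n) CARD('m) ` {1..d}"
  have "compact (convex hull ?S)" by (intro finite_imp_compact_convex_hull) auto
  then have "z \<in> convex hull ?S" using assms by (simp add: compact_imp_closed closure_closed)
  moreover have "convex hull ?S \<subseteq> {z. local_form_bounded TYPE('n) TYPE('m) d R z}"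
    using local_form_bounded_critical[of 0 d, where 'n='n and 'm='m] local_form_bounded_critical[of _ d, where 'n='n and 'm='m]
    by (intro hull_minimal convex_local_form_bounded)
       (auto simp: local_form_bounded_00 local_form_bounded_01 critical_point_0)
  ultimately show ?thesis by auto
qed

subsection \<open>From the dual form to norms\<close>

text \<open>The converse half of duality. With i the integral of F^(1/x), let h be the transform cut
  off at height k on the box and r the integral of h^(1/y). Testing the form on F^(1/x) / i and H =
  h^(1/y) / r and writing h^(1/y) = h^(1/y - 1) h gives r \<le> C i^x r^(1-y). Division by r^(1-y)
  needs r finite, which the cutoff provides; then k tends to \<infinity>.\<close>

lemma local_form_imp_norm_bound:
  assumes lf: "local_form_bounded TYPE('n::finite) TYPE('m::finite) d R (x, y)" and x: "0 < x" and y: "0 < y" "y \<le> 1"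
  shows "\<exists>C>0. \<forall>F :: (real ^ 'n) \<times> (real ^ 'm) \<Rightarrow> real. F \<in> borel_measurable borel \<longrightarrow> (\<forall>z. 0 \<le> F z) \<longrightarrow>
    (\<integral>\<^sup>+u. indicator (coeff_box d R) u * epowr (radon d (slab R F) u) (1 / y) \<partial>Pi\<^sub>M (multiindices d) (\<lambda>_. lborel))
      \<le> ennreal C * epowr (\<integral>\<^sup>+z. ennreal (F z powr (1 / x)) \<partial>lborel) (x / y)"
proof -
  let ?U = "Pi\<^sub>M (multiindices d) (\<lambda>_. lborel) :: (nat ^ 'n \<Rightarrow> real ^ 'm) measure"
  let ?Q = "coeff_box d R :: (nat ^ 'n \<Rightarrow> real ^ 'm) set"
  obtain C' where C': "\<And>(F :: (real ^ 'n) \<times> (real ^ 'm) \<Rightarrow> real) H. unit_pair d F H \<Longrightarrow>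
      (\<integral>\<^sup>+u. indicator ?Q u * ennreal (H u powr (1 - y)) * radon d (slab R (\<lambda>w. F w powr x)) u \<partial>?U) \<le> ennreal C'"
    using lf unfolding local_form_bounded_def by auto
  define C where "C = max C' 1"
  have C: "C > 0" "\<And>(F :: (real ^ 'n) \<times> (real ^ 'm) \<Rightarrow> real) H. unit_pair d F H \<Longrightarrow>
      (\<integral>\<^sup>+u. indicator ?Q u * ennreal (H u powr (1 - y)) * radon d (slab R (\<lambda>w. F w powr x)) u \<partial>?U) \<le> ennreal C"
    by (simp add: C_def) (rule order.trans[OF C'], auto simp: C_def intro: ennreal_leI)
  show ?thesis
  proof (intro exI[of _ "C powr (1 / y)"] conjI allI impI)
    show "C powr (1 / y) > 0" using C by simp
    fix F :: "(real ^ 'n) \<times> (real ^ 'm) \<Rightarrow> real"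
    assume F[measurable]: "F \<in> borel_measurable borel" and F0: "\<forall>z. 0 \<le> F z"
    define I where "I = (\<integral>\<^sup>+z. ennreal (F z powr (1 / x)) \<partial>lborel)"
    define S where "S = radon d (slab R F)"
    have Sm[measurable]: "S \<in> borel_measurable ?U" unfolding S_def by measurable
    show "(\<integral>\<^sup>+u. indicator ?Q u * epowr (radon d (slab R F) u) (1 / y) \<partial>?U)
      \<le> ennreal (C powr (1 / y)) * epowr (\<integral>\<^sup>+z. ennreal (F z powr (1 / x)) \<partial>lborel) (x / y)"
    proof (cases I)
      case top
      then show ?thesis using C(1) by (simp add: I_def[symmetric] ennreal_mult_top)
    next
      case (real i)
      show ?thesis
      \<comment> \<open>A function that vanishes almost everywhere cannot be normalised; its
        transform is 0 for almost every u.\<close>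
      proof (cases "i = 0")
        case True
        then have "AE z in lborel. ennreal (F z powr (1 / x)) = 0"
          using real by (subst (asm) I_def) (simp add: nn_integral_0_iff_AE)
        then have "AE z in lborel. F z = 0" by eventually_elim (use F0 in \<open>auto simp: ennreal_eq_0_iff\<close>)
        then have "emeasure lborel {z. F z \<noteq> 0} = 0"
          by (subst (asm) AE_iff_measurable[of "{z. F z \<noteq> 0}"]) auto
        then have "AE u in ?U. AE t in lborel. graph_point d u t \<notin> {z. F z \<noteq> 0}"
          by (intro AE_radon_null) measurable
        then have "AE u in ?U. S u = 0"
        proof eventually_elim
          case (elim u)
          then have "AE t in lborel. ennreal (slab R F (graph_point d u t)) = 0"
            by eventually_elim (auto simp: slab_def)
          then show ?case unfolding S_def radon_def by (subst nn_integral_cong_AE[of _ "\<lambda>_. 0"]) auto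
        qed
        then have "(\<integral>\<^sup>+u. indicator ?Q u * epowr (S u) (1 / y) \<partial>?U) = (\<integral>\<^sup>+u. 0 \<partial>?U)"
          by (intro nn_integral_cong_AE) auto
        then show ?thesis by (simp add: S_def)
      next
        case False
        then have i: "i > 0" using real by simp
        define G where "G z = F z powr (1 / x) / i" for z
        have Gm[measurable]: "G \<in> borel_measurable borel" unfolding G_def by measurable
        have G0: "\<forall>z. 0 \<le> G z" using i by (simp add: G_def)
        have G1: "(\<integral>\<^sup>+z. ennreal (G z) \<partial>lborel) \<le> 1"
        proof -
          have "(\<integral>\<^sup>+z. ennreal (G z) \<partial>lborel) = (\<integral>\<^sup>+z. ennreal (1 / i) * ennreal (F z powr (1 / x)) \<partial>lborel)"
            using i by (intro nn_integral_cong) (simp add: G_def ennreal_mult[symmetric])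
          also have "\<dots> = ennreal (1 / i) * I" unfolding I_def by (rule nn_integral_cmult) measurable
          also have "\<dots> = 1" using i real by (simp add: ennreal_mult[symmetric])
          finally show ?thesis by simp
        qed
        have Gx: "G z powr x = F z / i powr x" for z
          using i x F0[rule_format, of z] by (simp add: G_def powr_divide powr_powr)
        have sm: "(\<lambda>t. slab R (\<lambda>w. G w powr x) (graph_point d u t)) \<in> borel_measurable borel" for u
          by (rule measurable_compose[OF measurable_graph_point1 measurable_slab]) measurable
        have SG: "S u = ennreal (i powr x) * radon d (slab R (\<lambda>w. G w powr x)) u" for u
        proof -
          have "S u = (\<integral>\<^sup>+t. ennreal (i powr x) * ennreal (slab R (\<lambda>w. G w powr x) (graph_point d u t)) \<partial>lborel)"
            unfolding S_def radon_def using i F0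
            by (intro nn_integral_cong) (auto simp: slab_def Gx ennreal_mult[symmetric] F0[rule_format])
          also have "\<dots> = ennreal (i powr x) * radon d (slab R (\<lambda>w. G w powr x)) u"
            unfolding radon_def
            by (intro nn_integral_cmult) (use sm in measurable)
          finally show ?thesis .
        qed
        define h where "h k u = enn2real (min (S u) (ennreal (real k))) * indicator ?Q u" for k :: nat and u
        have h[measurable]: "h k \<in> borel_measurable ?U" for k unfolding h_def[abs_def] by measurable
        have h0: "0 \<le> h k u" for k u by (simp add: h_def)
        have hk: "ennreal (h k u) = min (S u) (ennreal (real k)) * indicator ?Q u" for k u
        proof -
          have "min (S u) (ennreal (real k)) < top" by (simp add: min_less_iff_disj)
          then have "ennreal (enn2real (min (S u) (ennreal (real k)))) = min (S u) (ennreal (real k))" by (rule ennreal_enn2real)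
          then show ?thesis by (simp add: h_def split: split_indicator)
        qed
        have hle: "h k u \<le> real k * indicator ?Q u" for k u
          unfolding h_def by (intro mult_right_mono enn2real_leI) auto
        define M where "M = (C * i powr x) powr (1 / y)"
        have M: "M \<ge> 0" by (simp add: M_def)
        have Jk: "(\<integral>\<^sup>+u. ennreal (h k u powr (1 / y)) \<partial>?U) \<le> ennreal M" for k
        proof -
          define J where "J = (\<integral>\<^sup>+u. ennreal (h k u powr (1 / y)) \<partial>?U)"
          have "J \<le> (\<integral>\<^sup>+u. ennreal (real k powr (1 / y)) * indicator ?Q u \<partial>?U)"
            unfolding J_def
          proof (rule nn_integral_mono)
            fix u
            show "ennreal (h k u powr (1 / y)) \<le> ennreal (real k powr (1 / y)) * indicator ?Q u"
            proof (cases "u \<in> ?Q")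
              case True
              then show ?thesis using hle[of k u] h0[of k u] y by (auto intro!: ennreal_leI powr_mono2)
            next
              case False
              then show ?thesis by (simp add: h_def)
            qed
          qed
          also have "\<dots> = ennreal (real k powr (1 / y)) * emeasure ?U ?Q" by (rule nn_integral_cmult_indicator) measurable
          also have "\<dots> < \<infinity>" using emeasure_coeff_box_finite[of d R, where 'n='n and 'm='m] by (simp add: ennreal_mult_less_top)
          finally obtain r where r: "J = ennreal r" "r \<ge> 0" by (cases J) auto
          show ?thesis
          proof (cases "r = 0")
            case True
            then show ?thesis using r by (simp add: J_def[symmetric])
          next
            case False
            then have r0: "r > 0" using r by simp
            define H where "H u = h k u powr (1 / y) / r" for u
            have up: "unit_pair d G H"
              unfolding unit_pair_def
            proof (intro conjI Gm G0 G1)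
              show "H \<in> borel_measurable ?U" unfolding H_def[abs_def] by measurable
              show "\<forall>u. 0 \<le> H u" using r0 by (simp add: H_def)
              have "(\<integral>\<^sup>+u. ennreal (H u) \<partial>?U) = (\<integral>\<^sup>+u. ennreal (1 / r) * ennreal (h k u powr (1 / y)) \<partial>?U)"
                using r0 by (intro nn_integral_cong) (simp add: H_def ennreal_mult[symmetric])
              also have "\<dots> = ennreal (1 / r) * J" unfolding J_def by (rule nn_integral_cmult) measurable
              also have "\<dots> = 1" using r0 r by (simp add: ennreal_mult[symmetric])
              finally show "(\<integral>\<^sup>+u. ennreal (H u) \<partial>?U) \<le> 1" by simp
            qed
            have Hy: "H u powr (1 - y) = h k u powr (1 / y - 1) / r powr (1 - y)" for u
              using r0 h0 y by (simp add: H_def powr_divide powr_powr field_simps)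
            have pt: "ennreal (h k u powr (1 / y)) \<le> ennreal (r powr (1 - y) * i powr x) * (indicator ?Q u * ennreal (H u powr (1 - y)) * radon d (slab R (\<lambda>w. G w powr x)) u)" for u
            proof (cases "u \<in> ?Q")
              case True
              \<comment> \<open>At h = 0 both sides are 0 by the convention for \<open>powr\<close>,
                also for y = 1.\<close>
              have "h k u powr (1 / y) = h k u powr (1 / y - 1) * h k u"
                using h0[of k u] by (cases "h k u = 0") (auto simp: powr_diff)
              then have "ennreal (h k u powr (1 / y)) = ennreal (h k u powr (1 / y - 1)) * ennreal (h k u)"
                using h0 by (simp add: ennreal_mult[symmetric])
              also have "\<dots> \<le> ennreal (h k u powr (1 / y - 1)) * S u"
                using hk[of k u] True by (intro mult_left_mono) auto
              also have "ennreal (h k u powr (1 / y - 1)) = ennreal (r powr (1 - y)) * ennreal (H u powr (1 - y))"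
                using r0 by (simp add: Hy ennreal_mult[symmetric])
              also have "ennreal (r powr (1 - y)) * ennreal (H u powr (1 - y)) * S u = ennreal (r powr (1 - y) * i powr x) * (ennreal (H u powr (1 - y)) * radon d (slab R (\<lambda>w. G w powr x)) u)"
                by (simp add: SG ennreal_mult mult_ac)
              finally show ?thesis using True by simp
            next
              case False
              then show ?thesis by (simp add: h_def)
            qed
            have "J \<le> (\<integral>\<^sup>+u. ennreal (r powr (1 - y) * i powr x) * (indicator ?Q u * ennreal (H u powr (1 - y)) * radon d (slab R (\<lambda>w. G w powr x)) u) \<partial>?U)"
              unfolding J_def by (intro nn_integral_mono pt)
            also have "\<dots> = ennreal (r powr (1 - y) * i powr x) * (\<integral>\<^sup>+u. indicator ?Q u * ennreal (H u powr (1 - y)) * radon d (slab R (\<lambda>w. G w powr x)) u \<partial>?U)"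
              unfolding H_def by (rule nn_integral_cmult) measurable
            also have "\<dots> \<le> ennreal (r powr (1 - y) * i powr x) * ennreal C"
              by (intro mult_left_mono C(2) up) auto
            finally have "ennreal r \<le> ennreal (r powr (1 - y) * i powr x * C)"
              using C(1) by (simp add: r ennreal_mult)
            then have "r \<le> r powr (1 - y) * i powr x * C" using C(1) by (simp add: ennreal_le_iff)
            moreover have "r = r powr (1 - y) * r powr y" using r0 by (simp add: powr_add[symmetric])
            ultimately have "r powr (1 - y) * r powr y \<le> r powr (1 - y) * (i powr x * C)" by (simp add: mult.assoc)
            then have "r powr y \<le> C * i powr x" using r0 by (simp add: mult.commute)
            then have "(r powr y) powr (1 / y) \<le> M" unfolding M_def using y by (intro powr_mono2) auto
            then have "r \<le> M" using r0 y by (simp add: powr_powr)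
            then show ?thesis using r by (simp add: J_def[symmetric] ennreal_leI)
          qed
        qed
        have SUPk: "(SUP k. ennreal (h k u powr (1 / y))) = indicator ?Q u * epowr (S u) (1 / y)" for u
        proof (cases "u \<in> ?Q")
          case True
          have "(SUP k. ennreal (h k u powr (1 / y))) = (SUP k. epowr (min (S u) (of_nat k)) (1 / y))"
            using h0 True by (intro SUP_cong refl) (simp add: hk ennreal_of_nat_eq_real_of_nat flip: epowr_ennreal)
          also have "\<dots> = epowr (SUP k. min (S u) (of_nat k)) (1 / y)"
            using y by (intro epowr_SUP[symmetric]) auto
          also have "(SUP k. min (S u) (of_nat k)) = S u"
          proof (rule antisym)
            show "(SUP k. min (S u) (of_nat k)) \<le> S u" by (intro SUP_least) auto
            show "S u \<le> (SUP k. min (S u) (of_nat k))"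
            proof (cases "S u")
              case (real s)
              obtain k :: nat where "s \<le> real k" using real_arch_simple by blast
              then have "min (S u) (of_nat k) = S u" using real by (simp add: ennreal_of_nat_eq_real_of_nat ennreal_leI min_absorb1)
              then show ?thesis by (metis SUP_upper UNIV_I)
            next
              case top
              then show ?thesis by (simp add: ennreal_SUP_of_nat_eq_top)
            qed
          qed
          finally show ?thesis using True by simp
        next
          case False
          then show ?thesis by (simp add: h_def)
        qed
        have inc: "incseq (\<lambda>k u. ennreal (h k u powr (1 / y)))"
        proof (intro incseq_SucI le_funI)
          fix k u
          have "ennreal (h k u) \<le> ennreal (h (Suc k) u)"
            unfolding hk by (intro mult_right_mono min.mono ennreal_leI) auto
          then have "h k u \<le> h (Suc k) u" using h0 by (simp add: ennreal_le_iff)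
          then show "ennreal (h k u powr (1 / y)) \<le> ennreal (h (Suc k) u powr (1 / y))"
            using h0 y by (intro ennreal_leI powr_mono2) auto
        qed
        have "(\<integral>\<^sup>+u. indicator ?Q u * epowr (S u) (1 / y) \<partial>?U) = (SUP k. \<integral>\<^sup>+u. ennreal (h k u powr (1 / y)) \<partial>?U)"
          unfolding SUPk[symmetric] by (rule nn_integral_monotone_convergence_SUP[OF inc]) measurable
        also have "\<dots> \<le> ennreal M" by (intro SUP_least Jk)
        also have "ennreal M = ennreal (C powr (1 / y)) * epowr I (x / y)"
          using C(1) real i by (simp add: M_def powr_mult powr_powr ennreal_mult)
        finally show ?thesis by (simp add: S_def I_def)
      qed
    qed
  qed
qed

section \<open>Lebesgue measurable functions and Borel representatives\<close>

lemma measurable_completion_AE: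
  assumes f: "f \<in> M \<rightarrow>\<^sub>M N" and ae: "AE x in M. f x = g x" and g: "g \<in> space M \<rightarrow> space N"
  shows "g \<in> completion M \<rightarrow>\<^sub>M N"
proof (rule measurableI)
  fix x assume "x \<in> space (completion M)"
  then show "g x \<in> space N" using g by auto
next
  fix A assume A: "A \<in> sets N"
  show "g -` A \<inter> space (completion M) \<in> sets (completion M)"
  proof (rule completion.in_sets_AE)
    show "AE x in completion M. x \<in> f -` A \<inter> space M \<longleftrightarrow> x \<in> g -` A \<inter> space (completion M)"
      using AE_completion[OF ae] by eventually_elim auto
    show "f -` A \<inter> space M \<in> sets (completion M)" using f A by (auto intro: measurable_sets)
  qed auto
qed

lemma lebesgue_complex_borel_representative:
  fixes f :: "'a::euclidean_space \<Rightarrow> complex"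
  assumes [measurable]: "f \<in> borel_measurable lebesgue"
  obtains g where "g \<in> borel_measurable borel" "AE x in lborel. f x = g x"
proof -
  have "(\<lambda>x. Re (f x)) \<in> borel_measurable (completion lborel)" "(\<lambda>x. Im (f x)) \<in> borel_measurable (completion lborel)"
    by measurable
  from this[THEN completion_ex_borel_measurable_real]
  obtain a b where a: "a \<in> borel_measurable lborel" "AE x in lborel. Re (f x) = a x"
    and b: "b \<in> borel_measurable lborel" "AE x in lborel. Im (f x) = b x"
    by blast
  show ?thesis
  proof (rule that[of "\<lambda>x. Complex (a x) (b x)"])
    have "(\<lambda>x. complex_of_real (a x) + \<i> * complex_of_real (b x)) \<in> borel_measurable borel"
      using a(1) b(1) by measurable
    then show "(\<lambda>x. Complex (a x) (b x)) \<in> borel_measurable borel" by (simp add: Complex_eq)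
    show "AE x in lborel. f x = Complex (a x) (b x)"
      using a(2) b(2) by eventually_elim (simp add: complex_eq_iff)
  qed
qed

text \<open>For almost every u the graph meets the null set where f and g differ only for a null set
  of t, so f has the same transform as its Borel representative, and measurability in u passes to
  the completion. The set \<open>S\<close> allows both the whole coefficient space and a compact
  part of it.\<close>

lemma poly_radon_restrict:
  fixes f g :: "(real ^ 'n::finite) \<times> (real ^ 'm::finite) \<Rightarrow> complex"
  assumes g[measurable]: "g \<in> borel_measurable borel" and fg: "AE z in lborel. f z = g z"
    and S: "S \<in> sets (Pi\<^sub>M (multiindices d) (\<lambda>_. lborel))"
    and fin: "AE u in Pi\<^sub>M (multiindices d) (\<lambda>_. lborel). u \<in> S \<longrightarrow> radon d (\<lambda>z. norm (g z)) u < \<infinity>"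
  shows "AE u in restrict_space (coeff_measure d) S. poly_radon_defined d f u"
    and "poly_radon d f \<in> borel_measurable (restrict_space (coeff_measure d) S)"
    and "AE u in restrict_space (coeff_measure d) S. ennreal (norm (poly_radon d f u)) \<le> radon d (\<lambda>z. norm (g z)) u"
proof -
  let ?U = "Pi\<^sub>M (multiindices d) (\<lambda>_. lborel) :: (nat ^ 'n \<Rightarrow> real ^ 'm) measure"
  obtain Z where Z: "Z \<in> null_sets lborel" "{z. f z \<noteq> g z} \<subseteq> Z"
    using fg by (auto simp: eventually_ae_filter)
  have ae: "AE u in ?U. AE t in lborel. f (graph_point d u t) = g (graph_point d u t)"
  proof -
    have "AE u in ?U. AE t in lborel. graph_point d u t \<notin> Z"
      using Z(1) by (intro AE_radon_null) auto
    then show ?thesis using Z(2) by (auto elim!: eventually_mono)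
  qed
  have gm[measurable]: "(\<lambda>t. g (graph_point d u t)) \<in> borel_measurable borel" for u
    by (rule measurable_compose[OF measurable_graph_point1 g])
  have Ssp: "S \<inter> space (coeff_measure d) \<in> sets (coeff_measure d)"
    using S sets.sets_into_space[OF S] by (auto simp: coeff_measure_def Int_absorb2)
  have restr: "(AE u in restrict_space (coeff_measure d) S. P u)" if "AE u in ?U. u \<in> S \<longrightarrow> P u" for P
    unfolding AE_restrict_space_iff[OF Ssp] unfolding coeff_measure_def using that by (rule AE_completion)
  have main: "AE u in ?U. u \<in> S \<longrightarrow> poly_radon_defined d f u \<and> ennreal (norm (poly_radon d f u)) \<le> radon d (\<lambda>z. norm (g z)) u"
    using ae fin
  proof eventually_elim
    case (elim u)
    show ?case
    proof
      assume "u \<in> S"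
      then have "radon d (\<lambda>z. norm (g z)) u < \<infinity>" using elim by simp
      then have ig: "integrable lborel (\<lambda>t. g (graph_point d u t))"
        by (intro integrableI_bounded) (auto simp: radon_def)
      then have igl: "integrable lebesgue (\<lambda>t. g (graph_point d u t))"
        by (subst integrable_completion) auto
      have fm: "(\<lambda>t. f (graph_point d u t)) \<in> borel_measurable lebesgue"
        using elim(1) by (intro measurable_completion_AE[where f = "\<lambda>t. g (graph_point d u t)"]) (auto elim: eventually_mono)
      have ae': "AE t in lebesgue. f (graph_point d u t) = g (graph_point d u t)"
        using elim(1) by (rule AE_completion)
      have "integrable lebesgue (\<lambda>t. f (graph_point d u t))"
        using integrable_cong_AE[OF fm borel_measurable_integrable[OF igl] ae'] igl by simp
      moreover have "poly_radon d f u = (LINT t|lborel. g (graph_point d u t))"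
        unfolding poly_radon_def
        using integral_cong_AE[OF fm borel_measurable_integrable[OF igl] ae'] by (simp add: integral_completion)
      moreover have "ennreal (norm (LINT t|lborel. g (graph_point d u t))) \<le> radon d (\<lambda>z. norm (g z)) u"
        unfolding radon_def by (rule integral_norm_bound_ennreal[OF ig])
      ultimately show "poly_radon_defined d f u \<and> ennreal (norm (poly_radon d f u)) \<le> radon d (\<lambda>z. norm (g z)) u"
        by (simp add: poly_radon_defined_def)
    qed
  qed
  then show "AE u in restrict_space (coeff_measure d) S. poly_radon_defined d f u"
    and "AE u in restrict_space (coeff_measure d) S. ennreal (norm (poly_radon d f u)) \<le> radon d (\<lambda>z. norm (g z)) u"
    by (auto intro!: restr elim: eventually_mono)
  have gU: "(\<lambda>u. LINT t|lborel. g (graph_point d u t)) \<in> borel_measurable ?U"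
  proof (rule lborel.borel_measurable_lebesgue_integral)
    show "(\<lambda>(u, t). g (graph_point d u t)) \<in> borel_measurable (?U \<Otimes>\<^sub>M lborel)"
      using measurable_compose[OF measurable_graph_point g, of d] by (simp add: case_prod_beta')
  qed
  have "poly_radon d f \<in> borel_measurable (coeff_measure d)"
    unfolding coeff_measure_def
  proof (rule measurable_completion_AE[OF gU])
    show "AE u in ?U. (LINT t|lborel. g (graph_point d u t)) = poly_radon d f u"
      using ae
    proof eventually_elim
      case (elim u)
      have fm: "(\<lambda>t. f (graph_point d u t)) \<in> borel_measurable lebesgue"
        using elim by (intro measurable_completion_AE[where f = "\<lambda>t. g (graph_point d u t)"]) (auto elim: eventually_mono)
      have "(LINT t|lebesgue. f (graph_point d u t)) = (LINT t|lebesgue. g (graph_point d u t))"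
        by (rule integral_cong_AE[OF fm]) (auto intro: AE_completion[OF elim] measurable_completion)
      then show ?case by (simp add: poly_radon_def integral_completion)
    qed
  qed auto
  then show "poly_radon d f \<in> borel_measurable (restrict_space (coeff_measure d) S)"
    by (rule measurable_restrict_space1)
qed

lemma Lp_norm_eq_epowr:
  "p \<noteq> \<infinity> \<Longrightarrow> Lp_norm M p f = epowr (\<integral>\<^sup>+x. ennreal (norm (f x) powr enn2real p) \<partial>M) (1 / enn2real p)"
  by (simp add: Lp_norm_def epowr_def Let_def)

subsection \<open>Sufficiency\<close>

text \<open>By second countability an open set in a finite product is a countable union of boxes
  taken from a countable base.\<close>

lemma sets_PiM_if_openin:
  fixes A :: "('i \<Rightarrow> 'a::second_countable_topology) set"
  assumes I: "finite I" and A: "openin (product_topology (\<lambda>_. euclidean) I) A"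
  shows "A \<in> sets (Pi\<^sub>M I (\<lambda>_. borel))"
proof -
  obtain B :: "'a set set" where B: "countable B" "topological_basis B" using ex_countable_basis by blast
  define \<F> where "\<F> = {X \<in> (\<lambda>b. Pi\<^sub>E I b) ` (Pi\<^sub>E I (\<lambda>_. B)). X \<subseteq> A}"
  have cnt: "countable \<F>" unfolding \<F>_def
    using I B(1) by (intro countable_Collect countable_image countable_PiE) auto
  have "A = \<Union>\<F>"
  proof (intro equalityI subsetI)
    fix x assume x: "x \<in> A"
    obtain U where "\<forall>i\<in>I. openin euclidean (U i)" and U': "x \<in> Pi\<^sub>E I U" "Pi\<^sub>E I U \<subseteq> A"
      using bspec[OF iffD1[OF openin_product_topology_alt A] x] by blast
    then have U: "\<And>i. i \<in> I \<Longrightarrow> open (U i)" "x \<in> Pi\<^sub>E I U" "Pi\<^sub>E I U \<subseteq> A"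
      by auto
    have "\<forall>i\<in>I. \<exists>b\<in>B. x i \<in> b \<and> b \<subseteq> U i"
    proof
      fix i assume i: "i \<in> I"
      then have "x i \<in> U i" using U(2) by (auto simp: PiE_iff)
      then obtain b where "b \<in> B" "x i \<in> b" "b \<subseteq> U i"
        using topological_basisE[OF B(2) U(1)[OF i]] by metis
      then show "\<exists>b\<in>B. x i \<in> b \<and> b \<subseteq> U i" by blast
    qed
    then obtain b where b: "\<And>i. i \<in> I \<Longrightarrow> b i \<in> B \<and> x i \<in> b i \<and> b i \<subseteq> U i" by metis
    let ?b = "restrict b I"
    have "?b \<in> Pi\<^sub>E I (\<lambda>_. B)" using b by auto
    moreover have "x \<in> Pi\<^sub>E I ?b" using b U(2) by (auto simp: PiE_iff)
    moreover have "Pi\<^sub>E I ?b \<subseteq> Pi\<^sub>E I U" using b by (intro PiE_mono) simp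
    then have "Pi\<^sub>E I ?b \<subseteq> A" using U(3) by simp
    ultimately show "x \<in> \<Union>\<F>"
      unfolding \<F>_def using \<open>Pi\<^sub>E I ?b \<subseteq> A\<close> by (intro UnionI[of "Pi\<^sub>E I ?b"]) auto
  qed (auto simp: \<F>_def)
  moreover have "X \<in> sets (Pi\<^sub>M I (\<lambda>_. borel))" if "X \<in> \<F>" for X
  proof -
    obtain b where b: "X = Pi\<^sub>E I b" "b \<in> Pi\<^sub>E I (\<lambda>_. B)" using \<open>X \<in> \<F>\<close> by (auto simp: \<F>_def)
    have "b i \<in> sets borel" if "i \<in> I" for i
      using topological_basis_open[OF B(2)] b(2) that by (auto simp: PiE_iff)
    then show ?thesis unfolding b(1) using I by (intro sets_PiM_I_finite) auto
  qed
  ultimately show ?thesis using cnt by (metis sets.countable_Union subsetI)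
qed

text \<open>The Hausdorff property makes K closed, hence measurable. Each coordinate projection of K
  is compact, hence bounded, and there are finitely many of them.\<close>

lemma compactin_coeff_topology:
  fixes K :: "(nat ^ 'n::finite \<Rightarrow> real ^ 'm::finite) set"
  assumes K: "compactin (coeff_topology d) K"
  shows "K \<in> sets (Pi\<^sub>M (multiindices d) (\<lambda>_. lborel))" and "\<exists>R. K \<subseteq> coeff_box d R"
proof -
  let ?M = "multiindices d :: (nat ^ 'n) set"
  let ?X = "coeff_topology d :: (nat ^ 'n \<Rightarrow> real ^ 'm) topology"
  have "Hausdorff_space ?X"
    unfolding coeff_topology_def by (simp add: Hausdorff_space_product_topology)
  then have "closedin ?X K" using K compactin_imp_closedin by blast
  then have KE: "K \<subseteq> Pi\<^sub>E ?M (\<lambda>_. UNIV)" and op: "openin ?X (topspace ?X - K)"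
    by (auto simp: closedin_def coeff_topology_def)
  have ts: "topspace ?X = Pi\<^sub>E ?M (\<lambda>_. UNIV)" by (simp add: coeff_topology_def)
  have "sets (Pi\<^sub>M ?M (\<lambda>_. borel :: (real ^ 'm) measure)) = sets (Pi\<^sub>M ?M (\<lambda>_. lborel))"
    by (rule sets_PiM_cong) auto
  then have "topspace ?X - K \<in> sets (Pi\<^sub>M ?M (\<lambda>_. lborel))"
    using sets_PiM_if_openin[OF finite_multiindices op[unfolded coeff_topology_def]] by (simp add: coeff_topology_def)
  then have "space (Pi\<^sub>M ?M (\<lambda>_. lborel)) - (topspace ?X - K) \<in> sets (Pi\<^sub>M ?M (\<lambda>_. lborel))" by auto
  also have "space (Pi\<^sub>M ?M (\<lambda>_. lborel)) - (topspace ?X - K) = K"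
    using KE by (auto simp: ts space_PiM)
  finally show "K \<in> sets (Pi\<^sub>M ?M (\<lambda>_. lborel))" .
  have "\<exists>r. \<forall>u\<in>K. norm (u \<alpha>) \<le> r" if "\<alpha> \<in> ?M" for \<alpha>
  proof -
    have "compactin euclidean ((\<lambda>u. u \<alpha>) ` K)"
      using K that unfolding coeff_topology_def
      by (intro image_compactin[of "product_topology (\<lambda>_. euclidean) ?M"] continuous_map_product_projection)
    then have "bounded ((\<lambda>u. u \<alpha>) ` K)" by (simp add: compact_imp_bounded)
    then show ?thesis by (auto simp: bounded_iff)
  qed
  then obtain r where r: "\<And>\<alpha> u. \<alpha> \<in> ?M \<Longrightarrow> u \<in> K \<Longrightarrow> norm (u \<alpha>) \<le> r \<alpha>" by metis
  have "norm (u \<alpha>) \<le> (\<Sum>\<alpha>\<in>?M. \<bar>r \<alpha>\<bar>)" if "\<alpha> \<in> ?M" "u \<in> K" for \<alpha> u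
  proof -
    have "norm (u \<alpha>) \<le> \<bar>r \<alpha>\<bar>" using r[OF that] by simp
    also have "\<dots> \<le> (\<Sum>\<alpha>\<in>?M. \<bar>r \<alpha>\<bar>)" using that finite_multiindices by (intro member_le_sum) auto
    finally show ?thesis .
  qed
  then have "K \<subseteq> coeff_box d (\<Sum>\<alpha>\<in>?M. \<bar>r \<alpha>\<bar>)" using KE by (auto simp: coeff_box_def PiE_iff)
  then show "\<exists>R. K \<subseteq> coeff_box d R" by blast
qed

lemma restrict_coeff_nn_integral:
  assumes "S \<in> sets (Pi\<^sub>M (multiindices d) (\<lambda>_. lborel))"
  shows "(\<integral>\<^sup>+u. h u \<partial>restrict_space (coeff_measure d) S) = (\<integral>\<^sup>+u. indicator S u * h u \<partial>Pi\<^sub>M (multiindices d) (\<lambda>_. lborel))"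
proof -
  have "S \<subseteq> space (coeff_measure d)" "S \<in> sets (coeff_measure d)"
    using assms sets.sets_into_space[OF assms] by (simp_all add: coeff_measure_def)
  then have "S \<inter> space (coeff_measure d) \<in> sets (coeff_measure d)" by (simp add: Int_absorb2)
  from nn_integral_restrict_space[OF this, of h] show ?thesis
    by (simp add: coeff_measure_def nn_integral_completion mult.commute)
qed

lemma Lp_norm_finite_exponent:
  "r > 0 \<Longrightarrow> Lp_norm M (ennreal r) f = epowr (\<integral>\<^sup>+x. ennreal (norm (f x) powr r) \<partial>M) (1 / r)"
  by (simp add: Lp_norm_eq_epowr)

text \<open>Common to the global and the local statement: an estimate for the transform of |g| gives
  everything demanded of f. Its finiteness yields absolute convergence for almost every u in S, and
  the norm bound follows by domination.\<close>

lemma poly_radon_norm_transfer: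
  fixes f g :: "(real ^ 'n::finite) \<times> (real ^ 'm::finite) \<Rightarrow> complex"
  assumes f: "f \<in> Lp lebesgue (ennreal r)" and r: "r \<ge> 1" and s: "s \<ge> 1"
    and g: "g \<in> borel_measurable borel" and fg: "AE z in lborel. f z = g z"
    and S: "S \<in> sets (Pi\<^sub>M (multiindices d) (\<lambda>_. lborel))" and C: "C > 0"
    and bound: "(\<integral>\<^sup>+u. indicator S u * epowr (radon d (\<lambda>z. norm (g z)) u) s \<partial>Pi\<^sub>M (multiindices d) (\<lambda>_. lborel))
      \<le> ennreal C * epowr (\<integral>\<^sup>+z. ennreal (norm (g z) powr r) \<partial>lborel) (s / r)"
  shows "(AE u in restrict_space (coeff_measure d) S. poly_radon_defined d f u) \<and>
    poly_radon d f \<in> Lp (restrict_space (coeff_measure d) S) (ennreal s) \<and>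
    Lp_norm (restrict_space (coeff_measure d) S) (ennreal s) (poly_radon d f) \<le> ennreal (C powr (1 / s)) * Lp_norm lebesgue (ennreal r) f"
proof -
  let ?U = "Pi\<^sub>M (multiindices d) (\<lambda>_. lborel) :: (nat ^ 'n \<Rightarrow> real ^ 'm) measure"
  let ?R = "restrict_space (coeff_measure d) S :: (nat ^ 'n \<Rightarrow> real ^ 'm) measure"
  let ?T = "radon d (\<lambda>z. norm (g z))"
  define I where "I = (\<integral>\<^sup>+z. ennreal (norm (g z) powr r) \<partial>lborel)"
  have [measurable]: "g \<in> borel_measurable borel" by (rule g)
  have [measurable]: "S \<in> sets ?U" by (rule S)
  have If: "(\<integral>\<^sup>+z. ennreal (norm (f z) powr r) \<partial>lebesgue) = I"
    unfolding I_def nn_integral_completion by (rule nn_integral_cong_AE) (use fg in eventually_elim, simp)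
  have nf: "Lp_norm lebesgue (ennreal r) f = epowr I (1 / r)"
    using r by (simp add: Lp_norm_finite_exponent If)
  then have fin: "epowr I (1 / r) < \<infinity>" using f by (simp add: Lp_def)
  then have Ifin: "I < \<infinity>" by (cases I) auto
  have B: "(\<integral>\<^sup>+u. indicator S u * epowr (?T u) s \<partial>?U) < \<infinity>"
  proof -
    have "ennreal C * epowr I (s / r) < \<infinity>" using Ifin by (cases I) (auto simp: ennreal_mult_less_top)
    then show ?thesis using bound unfolding I_def by (rule le_less_trans[rotated])
  qed
  have AEf: "AE u in ?U. u \<in> S \<longrightarrow> ?T u < \<infinity>"
  proof -
    have "AE u in ?U. indicator S u * epowr (?T u) s \<noteq> \<infinity>"
      using B by (intro nn_integral_PInf_AE) auto
    then show ?thesis by eventually_elim (auto simp: less_top[symmetric])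
  qed
  note facts = poly_radon_restrict[OF g fg S AEf]
  have "(\<integral>\<^sup>+u. ennreal (norm (poly_radon d f u) powr s) \<partial>?R) \<le> (\<integral>\<^sup>+u. epowr (?T u) s \<partial>?R)"
  proof (rule nn_integral_mono_AE)
    show "AE u in ?R. ennreal (norm (poly_radon d f u) powr s) \<le> epowr (?T u) s"
      using facts(3)
    proof eventually_elim
      case (elim u)
      then have "epowr (ennreal (norm (poly_radon d f u))) s \<le> epowr (?T u) s" using s by (intro epowr_mono) auto
      then show ?case by simp
    qed
  qed
  also have "\<dots> \<le> ennreal C * epowr I (s / r)"
    using bound by (simp add: restrict_coeff_nn_integral[OF S] I_def)
  finally have "epowr (\<integral>\<^sup>+u. ennreal (norm (poly_radon d f u) powr s) \<partial>?R) (1 / s) \<le> epowr (ennreal C * epowr I (s / r)) (1 / s)"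
    using s by (intro epowr_mono) auto
  also have "\<dots> = ennreal (C powr (1 / s)) * epowr I (1 / r)"
    using s C by (simp add: epowr_mult epowr_epowr)
  finally have le: "Lp_norm ?R (ennreal s) (poly_radon d f) \<le> ennreal (C powr (1 / s)) * Lp_norm lebesgue (ennreal r) f"
    using s by (simp add: nf Lp_norm_finite_exponent)
  also have "\<dots> < \<infinity>" using fin by (simp add: nf ennreal_mult_less_top)
  finally show ?thesis using le facts(1,2) by (simp add: Lp_def)
qed

lemma restrict_space_space_eq: "restrict_space M (space M) = M"
  by (rule measure_eqI) (auto simp: sets_restrict_space image_def emeasure_restrict_space Int_absorb1 sets.sets_into_space)

lemma maps_Lp_Lq_sufficient:
  assumes d: "d \<ge> 1" and p: "p = ennreal (1 + real CARD('m::finite) * real d / (real CARD('n::finite) + 1))"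
    and q: "q = of_nat (card (multiindices d :: (nat ^ 'n) set)) * p"
  shows "maps_Lp_Lq TYPE('n) TYPE('m) d p q"
proof -
  let ?U = "Pi\<^sub>M (multiindices d) (\<lambda>_. lborel) :: (nat ^ 'n \<Rightarrow> real ^ 'm) measure"
  define N where "N = card (multiindices d :: (nat ^ 'n) set)"
  define r where "r = 1 + real CARD('m) * real d / (real CARD('n) + 1)"
  have N: "N \<ge> 1" by (simp add: N_def card_multiindices Suc_le_eq)
  have r: "r \<ge> 1" by (simp add: r_def)
  have pr: "p = ennreal r" by (simp add: p r_def)
  have qs: "q = ennreal (N * r)" using r by (simp add: q N_def[symmetric] pr ennreal_of_nat_eq_real_of_nat ennreal_mult)
  have s: "N * r \<ge> 1" using N r mult_mono[of 1 "real N" 1 r] by simp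
  have Usp: "space ?U \<in> sets ?U" by simp
  have rs: "restrict_space (coeff_measure d) (space ?U) = (coeff_measure d :: (nat ^ 'n \<Rightarrow> real ^ 'm) measure)"
    using restrict_space_space_eq[of "coeff_measure d :: (nat ^ 'n \<Rightarrow> real ^ 'm) measure"] by (simp add: coeff_measure_def)
  obtain C where C: "C > 0" "\<And>F :: (real ^ 'n) \<times> (real ^ 'm) \<Rightarrow> real. F \<in> borel_measurable borel \<Longrightarrow> (\<forall>z. 0 \<le> F z) \<Longrightarrow>
    (\<integral>\<^sup>+u. epowr (radon d F u) (N * r) \<partial>?U) \<le> ennreal C * (\<integral>\<^sup>+z. ennreal (F z powr r) \<partial>lborel) ^ N"
    using radon_strong_type[of d, where 'n='n and 'm='m] unfolding N_def r_def by blast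
  show ?thesis
    unfolding maps_Lp_Lq_def
  proof (intro exI[of _ "C powr (1 / (N * r))"] ballI)
    fix f :: "(real ^ 'n) \<times> (real ^ 'm) \<Rightarrow> complex" assume f: "f \<in> Lp lebesgue p"
    then have "f \<in> borel_measurable lebesgue" by (simp add: Lp_def)
    then obtain g where g[measurable]: "g \<in> borel_measurable borel" and fg: "AE z in lborel. f z = g z"
      by (rule lebesgue_complex_borel_representative)
    have "(\<integral>\<^sup>+u. indicator (space ?U) u * epowr (radon d (\<lambda>z. norm (g z)) u) (N * r) \<partial>?U) = (\<integral>\<^sup>+u. epowr (radon d (\<lambda>z. norm (g z)) u) (N * r) \<partial>?U)"
      by (intro nn_integral_cong) auto
    also have "\<dots> \<le> ennreal C * (\<integral>\<^sup>+z. ennreal (norm (g z) powr r) \<partial>lborel) ^ N"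
      by (intro C(2)) auto
    also have "\<dots> = ennreal C * epowr (\<integral>\<^sup>+z. ennreal (norm (g z) powr r) \<partial>lborel) (N * r / r)"
      using N r by (simp add: epowr_of_nat)
    finally show "(AE u in coeff_measure d. poly_radon_defined d f u) \<and>
        poly_radon d f \<in> Lp (coeff_measure d) q \<and>
        Lp_norm (coeff_measure d) q (poly_radon d f) \<le> ennreal (C powr (1 / (N * r))) * Lp_norm lebesgue p f"
      using poly_radon_norm_transfer[OF f[unfolded pr] r s g fg Usp C(1)] unfolding rs pr qs by blast
  qed
qed

text \<open>The halfplane contains every vertex because the binomials increase with j. It makes 1/q
  positive whenever 1/p is, so within the hull a finite p excludes q = \<infinity>.\<close>

lemma hull_height:
  assumes "(x, y) \<in> closure (convex hull ({(0, 0), (1, 1), (0, 1)} \<union> critical_point n m ` {1..d}))" and n: "n \<ge> 1"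
  shows "x \<le> real ((n + d) choose d) * y"
proof -
  let ?S = "{(0, 0), (1, 1), (0, 1)} \<union> critical_point n m ` {1..d}"
  have "compact (convex hull ?S)" by (intro finite_imp_compact_convex_hull) auto
  then have z: "(x, y) \<in> convex hull ?S" using assms by (simp add: compact_imp_closed closure_closed)
  let ?b = "real ((n + d) choose d)"
  have "(n + d) choose d \<ge> 1" by (simp add: Suc_le_eq)
  then have b1: "?b \<ge> 1" by linarith
  have "convex hull ?S \<subseteq> {z. (1, - ?b) \<bullet> z \<le> 0}"
  proof (rule hull_minimal)
    show "convex {z. (1, - ?b) \<bullet> z \<le> 0}" by (rule convex_halfspace_le)
    have "critical_point n m j \<in> {z. (1, - ?b) \<bullet> z \<le> 0}" if j: "j \<in> {1..d}" for j
    proof -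
      have "(n + j) choose j \<le> (n + d) choose d"
      proof -
        have "(n + j) choose n \<le> (n + d) choose n" using j by (intro binomial_right_mono) auto
        then show ?thesis using binomial_symmetric[of j "n + j"] binomial_symmetric[of d "n + d"] by simp
      qed
      moreover have "(n + j) choose j > 0" by simp
      ultimately have "1 \<le> ?b * inverse (real ((n + j) choose j))" by (simp add: field_simps)
      then have "x * 1 \<le> x * (?b * inverse (real ((n + j) choose j)))" if "x \<ge> 0" for x :: real
        using that by (intro mult_left_mono)
      from this[of "(real n + 1) / (real n + real m * real j + 1)"] show ?thesis
        by (simp add: critical_point_def Let_def inner_prod_def mult_ac)
    qed
    then show "?S \<subseteq> {z. (1, - ?b) \<bullet> z \<le> 0}" using b1 by (auto simp: inner_prod_def)
  qed
  then show ?thesis using z by (auto simp: inner_prod_def)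
qed

lemma ennreal_ge_1_cases:
  assumes "1 \<le> (p :: ennreal)"
  obtains "p = \<infinity>" "enn2real (inverse p) = 0" | r where "p = ennreal r" "r \<ge> 1" "enn2real (inverse p) = 1 / r"
proof (cases p)
  case (real r)
  then have "r \<ge> 1" using assms by (metis ennreal_le_iff ennreal_1)
  then show ?thesis using that(2)[of r] real by (simp add: inverse_ennreal inverse_eq_divide)
next
  case top
  then show ?thesis using that(1) by simp
qed

text \<open>For finite p both coordinates are positive and the dual form applies. For p =
  \<infinity> it does not, since F to the power 0 carries no size; there the transform is bounded by
  the volume of a ball times the essential supremum of f, and every q follows because K' has finite
  measure.\<close>

lemma maps_Lpcomp_Lqloc_sufficient:
  assumes p: "1 \<le> p" and q: "1 \<le> q"
    and hull: "(enn2real (inverse p), enn2real (inverse q)) \<in>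
      closure (convex hull ({(0, 0), (1, 1), (0, 1)} \<union> critical_point CARD('n) CARD('m) ` {1..d}))"
  shows "maps_Lpcomp_Lqloc TYPE('n::finite) TYPE('m::finite) d p q"
  unfolding maps_Lpcomp_Lqloc_def
proof (intro allI impI)
  fix K :: "((real ^ 'n) \<times> (real ^ 'm)) set" and K' :: "(nat ^ 'n \<Rightarrow> real ^ 'm) set"
  assume K: "compact K" and K': "compactin (coeff_topology d) K'"
  let ?U = "Pi\<^sub>M (multiindices d) (\<lambda>_. lborel) :: (nat ^ 'n \<Rightarrow> real ^ 'm) measure"
  let ?R = "restrict_space (coeff_measure d) K' :: (nat ^ 'n \<Rightarrow> real ^ 'm) measure"
  have Km[measurable]: "K' \<in> sets ?U" by (rule compactin_coeff_topology(1)[OF K'])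
  obtain R1 where R1: "K' \<subseteq> coeff_box d R1" using compactin_coeff_topology(2)[OF K'] by blast
  obtain R2 where R2: "\<And>z. z \<in> K \<Longrightarrow> norm z \<le> R2" using compact_imp_bounded[OF K] by (auto simp: bounded_iff)
  define R where "R = max R1 R2"
  have KR: "norm (fst z) \<le> R" if "z \<in> K" for z
    using R2[OF that] norm_fst_le[of "fst z" "snd z"] by (simp add: R_def)
  have KR': "K' \<subseteq> coeff_box d R" using R1 by (force simp: coeff_box_def PiE_iff R_def)
  \<comment> \<open>The support condition holds almost everywhere; the representative is altered so
    that it vanishes for every large t and thus equals its own slab.\<close>
  have repr: "\<exists>g. g \<in> borel_measurable borel \<and> (AE z in lborel. f z = g z) \<and> (\<forall>z. norm (fst z) > R \<longrightarrow> g z = 0)"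
    if f: "f \<in> Lp lebesgue p" and supp: "AE z in lebesgue. z \<notin> K \<longrightarrow> f z = 0" for f :: "(real ^ 'n) \<times> (real ^ 'm) \<Rightarrow> complex"
  proof -
    have "f \<in> borel_measurable lebesgue" using f by (simp add: Lp_def)
    then obtain g where g[measurable]: "g \<in> borel_measurable borel" and fg: "AE z in lborel. f z = g z"
      by (rule lebesgue_complex_borel_representative)
    have "AE z in lborel. z \<notin> K \<longrightarrow> f z = 0" using supp by (simp add: AE_completion_iff)
    with fg have "AE z in lborel. f z = (if norm (fst z) \<le> R then g z else 0)"
      by eventually_elim (use KR in auto)
    then show ?thesis by (intro exI[of _ "\<lambda>z. if norm (fst z) \<le> R then g z else 0"]) auto
  qed
  show "\<exists>C. \<forall>f\<in>Lp (lebesgue :: ((real ^ 'n) \<times> (real ^ 'm)) measure) p. (AE z in lebesgue. z \<notin> K \<longrightarrow> f z = 0) \<longrightarrow>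
      (AE u in ?R. poly_radon_defined d f u) \<and> poly_radon d f \<in> Lp ?R q \<and>
      Lp_norm ?R q (poly_radon d f) \<le> ennreal C * Lp_norm lebesgue p f"
  proof (cases rule: ennreal_ge_1_cases[OF p])
    case (2 r)
    have "1 / r \<le> real ((CARD('n) + d) choose d) * enn2real (inverse q)"
      using hull_height[OF hull] 2 by simp
    then have "enn2real (inverse q) \<noteq> 0" using 2 by (auto simp: not_le)
    then obtain s where s: "q = ennreal s" "s \<ge> 1" "enn2real (inverse q) = 1 / s"
      using ennreal_ge_1_cases[OF q] by metis
    have "local_form_bounded TYPE('n) TYPE('m) d R (1 / r, 1 / s)"
      using local_form_bounded_hull[OF hull, of R] 2 s by simp
    from local_form_imp_norm_bound[OF this] 2 s
    obtain C where C: "C > 0" "\<And>F :: (real ^ 'n) \<times> (real ^ 'm) \<Rightarrow> real. F \<in> borel_measurable borel \<Longrightarrow> (\<forall>z. 0 \<le> F z) \<Longrightarrow>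
      (\<integral>\<^sup>+u. indicator (coeff_box d R) u * epowr (radon d (slab R F) u) s \<partial>?U)
      \<le> ennreal C * epowr (\<integral>\<^sup>+z. ennreal (F z powr r) \<partial>lborel) (s / r)" by auto
    show ?thesis
    proof (intro exI[of _ "C powr (1 / s)"] ballI impI)
      fix f :: "(real ^ 'n) \<times> (real ^ 'm) \<Rightarrow> complex"
      assume f: "f \<in> Lp lebesgue p" and supp: "AE z in lebesgue. z \<notin> K \<longrightarrow> f z = 0"
      obtain g where g[measurable]: "g \<in> borel_measurable borel" and fg: "AE z in lborel. f z = g z" and g0: "\<And>z. norm (fst z) > R \<Longrightarrow> g z = 0"
        using repr[OF f supp] by blast
      have sl: "slab R (\<lambda>z. norm (g z)) = (\<lambda>z. norm (g z))" using g0 by (auto simp: slab_def fun_eq_iff not_le)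
      have "(\<integral>\<^sup>+u. indicator K' u * epowr (radon d (\<lambda>z. norm (g z)) u) s \<partial>?U) \<le> (\<integral>\<^sup>+u. indicator (coeff_box d R) u * epowr (radon d (\<lambda>z. norm (g z)) u) s \<partial>?U)"
        using KR' by (intro nn_integral_mono mult_right_mono) (auto split: split_indicator)
      also have "\<dots> \<le> ennreal C * epowr (\<integral>\<^sup>+z. ennreal (norm (g z) powr r) \<partial>lborel) (s / r)"
        using C(2)[of "\<lambda>z. norm (g z)"] by (simp add: sl)
      finally show "(AE u in ?R. poly_radon_defined d f u) \<and> poly_radon d f \<in> Lp ?R q \<and>
        Lp_norm ?R q (poly_radon d f) \<le> ennreal (C powr (1 / s)) * Lp_norm lebesgue p f"
        using poly_radon_norm_transfer[OF f[unfolded 2] 2(2) s(2) g fg Km C(1)] unfolding 2 s by blast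
    qed
  next
    case 1
    let ?V = "emeasure lborel (cball (0 :: real ^ 'n) R)"
    obtain V where V: "?V = ennreal V" "V \<ge> 0"
      using emeasure_lborel_cball_finite[of "0 :: real ^ 'n" R] by (cases ?V) auto
    have main: "(AE u in ?R. poly_radon_defined d f u) \<and> poly_radon d f \<in> borel_measurable ?R \<and> Lp_norm lebesgue p f < \<infinity> \<and>
        (AE u in ?R. ennreal (norm (poly_radon d f u)) \<le> ennreal V * Lp_norm lebesgue p f)"
      if f: "f \<in> Lp lebesgue p" and supp: "AE z in lebesgue. z \<notin> K \<longrightarrow> f z = 0" for f :: "(real ^ 'n) \<times> (real ^ 'm) \<Rightarrow> complex"
    proof -
      obtain g where g[measurable]: "g \<in> borel_measurable borel" and fg: "AE z in lborel. f z = g z" and g0: "\<And>z. norm (fst z) > R \<Longrightarrow> g z = 0"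
        using repr[OF f supp] by blast
      define c where "c = Lp_norm lebesgue p f"
      have c: "c < \<infinity>" using f by (simp add: Lp_def c_def)
      have "AE z in lebesgue. ennreal (norm (f z)) \<le> c"
        unfolding c_def Lp_norm_def 1 by (simp add: esssup_AE)
      then have fc: "AE z in lborel. ennreal (norm (f z)) \<le> c" by (simp add: AE_completion_iff)
      \<comment> \<open>Values above the essential supremum are set to 0, so that the bound holds at
        every point and hence along every graph.\<close>
      define h where "h z = (if ennreal (norm (g z)) \<le> c then g z else 0)" for z
      have h[measurable]: "h \<in> borel_measurable borel" unfolding h_def[abs_def] by measurable
      have fh: "AE z in lborel. f z = h z" using fg fc by eventually_elim (simp add: h_def)
      have T: "radon d (\<lambda>z. norm (h z)) u \<le> ennreal V * c" for u
      proof -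
        have "radon d (\<lambda>z. norm (h z)) u \<le> (\<integral>\<^sup>+t. c * indicator (cball (0 :: real ^ 'n) R) t \<partial>lborel)"
          unfolding radon_def using g0 by (intro nn_integral_mono) (auto simp: h_def graph_point_def not_le split: split_indicator)
        also have "\<dots> = c * ?V" by (rule nn_integral_cmult_indicator) auto
        finally show ?thesis by (simp add: V mult.commute)
      qed
      have "ennreal V * c < \<infinity>" using c by (simp add: ennreal_mult_less_top)
      then have "AE u in ?U. u \<in> K' \<longrightarrow> radon d (\<lambda>z. norm (h z)) u < \<infinity>"
        using T le_less_trans by blast
      note facts = poly_radon_restrict[OF h fh Km this]
      have "AE u in ?R. ennreal (norm (poly_radon d f u)) \<le> ennreal V * c"
        using facts(3) by eventually_elim (use T order.trans in blast)
      then show ?thesis using facts c by (simp add: c_def)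
    qed
    show ?thesis
    proof (cases rule: ennreal_ge_1_cases[OF q])
      case q1: 1
      show ?thesis
      proof (intro exI[of _ V] ballI impI)
        fix f :: "(real ^ 'n) \<times> (real ^ 'm) \<Rightarrow> complex"
        assume "f \<in> Lp lebesgue p" "AE z in lebesgue. z \<notin> K \<longrightarrow> f z = 0"
        note m = main[OF this]
        have le: "Lp_norm ?R q (poly_radon d f) \<le> ennreal V * Lp_norm lebesgue p f"
          unfolding q1 Lp_norm_def[of ?R] using m by (auto intro!: esssup_I)
        also have "\<dots> < \<infinity>" using m by (simp add: ennreal_mult_less_top)
        finally show "(AE u in ?R. poly_radon_defined d f u) \<and> poly_radon d f \<in> Lp ?R q \<and>
          Lp_norm ?R q (poly_radon d f) \<le> ennreal V * Lp_norm lebesgue p f"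
          using m le by (simp add: Lp_def)
      qed
    next
      case (2 s)
      let ?E = "emeasure ?U K'"
      have "?E \<le> emeasure ?U (coeff_box d R)" using KR' by (intro emeasure_mono) auto
      also have "\<dots> < \<infinity>" by (rule emeasure_coeff_box_finite)
      finally obtain E where E: "?E = ennreal E" "E \<ge> 0" by (cases ?E) auto
      show ?thesis
      proof (intro exI[of _ "V * E powr (1 / s)"] ballI impI)
        fix f :: "(real ^ 'n) \<times> (real ^ 'm) \<Rightarrow> complex"
        assume "f \<in> Lp lebesgue p" "AE z in lebesgue. z \<notin> K \<longrightarrow> f z = 0"
        note m = main[OF this]
        let ?b = "ennreal V * Lp_norm lebesgue p f"
        have "(\<integral>\<^sup>+u. ennreal (norm (poly_radon d f u) powr s) \<partial>?R) \<le> (\<integral>\<^sup>+u. epowr ?b s \<partial>?R)"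
        proof (rule nn_integral_mono_AE)
          have "AE u in ?R. ennreal (norm (poly_radon d f u)) \<le> ?b" using m by simp
          then show "AE u in ?R. ennreal (norm (poly_radon d f u) powr s) \<le> epowr ?b s"
          proof eventually_elim
            case (elim u)
            then have "epowr (ennreal (norm (poly_radon d f u))) s \<le> epowr ?b s" using 2 by (intro epowr_mono) auto
            then show ?case by simp
          qed
        qed
        also have "\<dots> = (\<integral>\<^sup>+u. epowr ?b s * indicator K' u \<partial>?U)"
          unfolding restrict_coeff_nn_integral[OF Km] by (intro nn_integral_cong) (simp add: mult.commute)
        also have "\<dots> = epowr ?b s * ennreal E"
          unfolding E(1)[symmetric] by (rule nn_integral_cmult_indicator[OF Km])
        finally have "epowr (\<integral>\<^sup>+u. ennreal (norm (poly_radon d f u) powr s) \<partial>?R) (1 / s) \<le> epowr (epowr ?b s * ennreal E) (1 / s)"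
          using 2 by (intro epowr_mono) auto
        also have "\<dots> = ?b * ennreal (E powr (1 / s))" using 2 E by (simp add: epowr_mult epowr_epowr)
        also have "\<dots> = ennreal (V * E powr (1 / s)) * Lp_norm lebesgue p f"
          using V E by (simp add: ennreal_mult mult_ac)
        finally have le: "Lp_norm ?R q (poly_radon d f) \<le> ennreal (V * E powr (1 / s)) * Lp_norm lebesgue p f"
          using 2 by (simp add: Lp_norm_finite_exponent)
        also have "\<dots> < \<infinity>" using m by (simp add: ennreal_mult_less_top)
        finally show "(AE u in ?R. poly_radon_defined d f u) \<and> poly_radon d f \<in> Lp ?R q \<and>
          Lp_norm ?R q (poly_radon d f) \<le> ennreal (V * E powr (1 / s)) * Lp_norm lebesgue p f"
          using m le by (simp add: Lp_def)
      qed
    qed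
  qed
qed

subsection \<open>Necessity\<close>

definition cube :: "real \<Rightarrow> (real ^ 'n::finite) set" where
  "cube a = {t. \<forall>i. \<bar>t $ i\<bar> \<le> a}"

lemma cube_eq_cbox: "cube a = cbox (\<chi> i. - a) (\<chi> i. a)"
  by (auto simp: cube_def mem_box_cart abs_le_iff minus_le_iff)

lemma cube_borel [measurable]: "cube a \<in> sets borel"
  by (simp add: cube_eq_cbox)

lemma compact_cube: "compact (cube a)"
  by (simp add: cube_eq_cbox)

lemma emeasure_cube: "a \<ge> 0 \<Longrightarrow> emeasure lborel (cube a :: (real ^ 'n::finite) set) = ennreal ((2 * a) ^ CARD('n))"
proof -
  assume a: "a \<ge> 0"
  have le: "(\<chi> i. - a) \<bullet> b \<le> (\<chi> i. a) \<bullet> b" if "b \<in> Basis" for b :: "real ^ 'n"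
    using a that by (auto simp: Basis_vec_def inner_axis)
  show ?thesis
    using emeasure_lborel_cbox[OF le] by (simp add: cube_eq_cbox prod_Basis_vec inner_axis del: emeasure_lborel_cbox)
qed

lemma abs_monomial_le:
  assumes "t \<in> cube a"
  shows "\<bar>monomial t \<alpha>\<bar> \<le> a ^ (\<Sum>j\<in>UNIV. \<alpha> $ j)"
proof -
  have "\<bar>monomial t \<alpha>\<bar> = (\<Prod>j\<in>UNIV. \<bar>t $ j\<bar> ^ (\<alpha> $ j))" by (simp add: monomial_def abs_prod power_abs)
  also have "\<dots> \<le> (\<Prod>j\<in>UNIV. a ^ (\<alpha> $ j))"
    using assms by (intro prod_mono conjI power_mono) (auto simp: cube_def)
  finally show ?thesis by (simp add: power_sum)
qed

text \<open>Over the cube each term of the polynomial is at most b divided by the number of terms.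
  The whole graph over it therefore stays in the box, and the transform is the full volume of the
  cube.\<close>

lemma poly_radon_box:
  fixes u :: "nat ^ 'n::finite \<Rightarrow> real ^ 'm::finite" and a b :: real and c :: "nat ^ 'n \<Rightarrow> real"
  assumes a: "a \<ge> 0" and c: "\<And>\<alpha>. \<alpha> \<in> multiindices d \<Longrightarrow> c \<alpha> * a ^ (\<Sum>j\<in>UNIV. \<alpha> $ j) * card (multiindices d :: (nat ^ 'n) set) \<le> b"
    and u: "\<And>\<alpha>. \<alpha> \<in> multiindices d \<Longrightarrow> u \<alpha> \<in> cube (c \<alpha>)"
  shows "poly_radon d (\<lambda>z. indicator (cube a \<times> cube b) z) u = complex_of_real ((2 * a) ^ CARD('n))"
proof -
  let ?M = "multiindices d :: (nat ^ 'n) set"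
  have N: "card ?M > 0" by (simp add: card_multiindices)
  have "(\<Sum>\<alpha>\<in>?M. monomial t \<alpha> *\<^sub>R u \<alpha>) \<in> cube b" if t: "t \<in> cube a" for t
    unfolding cube_def
  proof (intro CollectI allI)
    fix k
    have "\<bar>(\<Sum>\<alpha>\<in>?M. monomial t \<alpha> *\<^sub>R u \<alpha>) $ k\<bar> \<le> (\<Sum>\<alpha>\<in>?M. \<bar>monomial t \<alpha> * u \<alpha> $ k\<bar>)"
      unfolding sum_component vector_scaleR_component real_scaleR_def by (rule sum_abs)
    also have "\<dots> \<le> (\<Sum>\<alpha>\<in>?M. b / card ?M)"
    proof (rule sum_mono)
      fix \<alpha> assume \<alpha>: "\<alpha> \<in> ?M"
      have "\<bar>u \<alpha> $ k\<bar> \<le> c \<alpha>" using u[OF \<alpha>] by (simp add: cube_def)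
      then have "\<bar>monomial t \<alpha> * u \<alpha> $ k\<bar> \<le> a ^ (\<Sum>j\<in>UNIV. \<alpha> $ j) * c \<alpha>"
        unfolding abs_mult using a by (intro mult_mono abs_monomial_le t) auto
      also have "\<dots> \<le> b / card ?M" using c[OF \<alpha>] N by (simp add: pos_le_divide_eq mult.commute)
      finally show "\<bar>monomial t \<alpha> * u \<alpha> $ k\<bar> \<le> b / card ?M" .
    qed
    also have "\<dots> = b" using N by simp
    finally show "\<bar>(\<Sum>\<alpha>\<in>?M. monomial t \<alpha> *\<^sub>R u \<alpha>) $ k\<bar> \<le> b" .
  qed
  then have "(indicator (cube a \<times> cube b) (graph_point d u t) :: complex) = indicator (cube a) t" for t
    by (auto simp: graph_point_def indicator_def)
  then have "poly_radon d (\<lambda>z. indicator (cube a \<times> cube b) z) u = (LINT t|lebesgue. indicator (cube a :: (real ^ 'n) set) t)"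
    by (simp add: poly_radon_def)
  also have "\<dots> = (LINT t|lborel. indicator (cube a :: (real ^ 'n) set) t)"
    by (rule integral_completion) measurable
  also have "\<dots> = complex_of_real (measure lborel (cube a :: (real ^ 'n) set))"
  proof -
    have "(indicator (cube a :: (real ^ 'n) set) t :: complex) = complex_of_real (indicator (cube a) t)" for t
      by (simp add: indicator_def)
    then show ?thesis by simp
  qed
  also have "measure lborel (cube a :: (real ^ 'n) set) = (2 * a) ^ CARD('n)"
    using a by (simp add: measure_def emeasure_cube[OF a])
  finally show ?thesis .
qed

lemma Lp_norm_box:
  fixes a b :: real
  assumes p: "1 \<le> p" and ab: "a > 0" "b > 0"
  defines "D \<equiv> cube a \<times> cube b :: ((real ^ 'n::finite) \<times> (real ^ 'm::finite)) set"
  shows "(\<lambda>z. indicator D z) \<in> Lp lebesgue p"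
    and "Lp_norm lebesgue p (\<lambda>z. indicator D z) \<le> ennreal (((2 * a) ^ CARD('n) * (2 * b) ^ CARD('m)) powr enn2real (inverse p))"
proof -
  let ?V = "(2 * a) ^ CARD('n) * (2 * b) ^ CARD('m)"
  have V: "?V > 0" using ab by simp
  have D[measurable]: "D \<in> sets borel" unfolding D_def borel_prod[symmetric] by (intro pair_measureI cube_borel)
  have eD: "emeasure lborel D = ennreal ?V"
    unfolding D_def lborel_prod[symmetric] using ab
    by (subst lborel.emeasure_pair_measure_Times) (auto simp: emeasure_cube ennreal_mult)
  have meas: "(\<lambda>z. indicator D z :: complex) \<in> borel_measurable lebesgue"
    by (rule measurable_completion) measurable
  show le: "Lp_norm lebesgue p (\<lambda>z. indicator D z) \<le> ennreal (?V powr enn2real (inverse p))"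
  proof (cases rule: ennreal_ge_1_cases[OF p])
    case 1
    have "esssup lebesgue (\<lambda>x. ennreal (norm (indicator D x :: complex))) \<le> 1"
      using meas by (intro esssup_I AE_I2) (auto simp: indicator_def)
    then show ?thesis using V ab unfolding 1 Lp_norm_def by (simp add: 1(2)[unfolded 1(1)])
  next
    case (2 r)
    have "(\<integral>\<^sup>+x. ennreal (norm (indicator D x :: complex) powr r) \<partial>lebesgue) = (\<integral>\<^sup>+x. indicator D x \<partial>lborel)"
      unfolding nn_integral_completion using 2 by (intro nn_integral_cong) (auto simp: indicator_def)
    also have "\<dots> = ennreal ?V" using eD by simp
    finally show ?thesis using 2 V by (simp add: Lp_norm_finite_exponent)
  qed
  show "(\<lambda>z. indicator D z) \<in> Lp lebesgue p"
    using meas le_less_trans[OF le] by (simp add: Lp_def)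
qed

lemma Lp_norm_lower_bound:
  assumes q: "1 \<le> q" and h: "h \<in> borel_measurable M" and A: "A \<in> sets M" "emeasure M A = ennreal E" "E > 0"
    and hA: "\<And>x. x \<in> A \<Longrightarrow> norm (h x) = \<kappa>" and \<kappa>: "\<kappa> \<ge> 0"
  shows "ennreal (\<kappa> * E powr enn2real (inverse q)) \<le> Lp_norm M q h"
proof (cases rule: ennreal_ge_1_cases[OF q])
  case 1
  have "ennreal \<kappa> \<le> esssup M (\<lambda>x. ennreal (norm (h x)))"
  proof (rule ccontr)
    assume *: "\<not> ?thesis"
    have "AE x in M. ennreal (norm (h x)) \<le> esssup M (\<lambda>x. ennreal (norm (h x)))" by (rule esssup_AE)
    then have "AE x in M. x \<notin> A" by eventually_elim (use * hA in auto)
    then have "emeasure M A = 0" using A(1) by (simp add: AE_iff_null_sets[symmetric] null_setsD1)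
    then show False using A by simp
  qed
  then show ?thesis using A(3) unfolding 1 Lp_norm_def by (simp add: 1(2)[unfolded 1(1)])
next
  case (2 s)
  have "ennreal (\<kappa> powr s * E) = (\<integral>\<^sup>+x. ennreal (\<kappa> powr s) * indicator A x \<partial>M)"
    using A by (simp add: nn_integral_cmult_indicator ennreal_mult)
  also have "\<dots> \<le> (\<integral>\<^sup>+x. ennreal (norm (h x) powr s) \<partial>M)"
    using hA by (intro nn_integral_mono) (auto split: split_indicator)
  finally have "epowr (ennreal (\<kappa> powr s * E)) (1 / s) \<le> epowr (\<integral>\<^sup>+x. ennreal (norm (h x) powr s) \<partial>M) (1 / s)"
    using 2 by (intro epowr_mono) auto
  moreover have "(\<kappa> powr s * E) powr (1 / s) = \<kappa> * E powr (1 / s)"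
    using 2 A(3) \<kappa> by (simp add: powr_mult powr_powr)
  ultimately show ?thesis using 2 A(3) by (simp add: Lp_norm_finite_exponent)
qed

text \<open>On the coefficient box U the transform is constant, so both norms are controlled by
  explicit volumes. The alternatives for \<open>R\<close> are the global measure and its restriction
  to a set containing U.\<close>

lemma box_test:
  fixes c :: "nat ^ 'n::finite \<Rightarrow> real" and a b :: real and d :: nat and C :: real
  defines "f \<equiv> \<lambda>z. indicator (cube a \<times> cube b :: ((real ^ 'n) \<times> (real ^ 'm::finite)) set) z :: complex"
  defines "U \<equiv> Pi\<^sub>E (multiindices d) (\<lambda>\<alpha>. cube (c \<alpha>)) :: (nat ^ 'n \<Rightarrow> real ^ 'm) set"
  assumes p: "1 \<le> p" and q: "1 \<le> q" and ab: "a > 0" "b > 0"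
    and c: "\<And>\<alpha>. \<alpha> \<in> multiindices d \<Longrightarrow> c \<alpha> > 0"
    and cb: "\<And>\<alpha>. \<alpha> \<in> multiindices d \<Longrightarrow> c \<alpha> * a ^ (\<Sum>j\<in>UNIV. \<alpha> $ j) * card (multiindices d :: (nat ^ 'n) set) \<le> b"
    and R: "R = coeff_measure d \<or> (\<exists>K. K \<in> sets (Pi\<^sub>M (multiindices d) (\<lambda>_. lborel)) \<and> U \<subseteq> K \<and> R = restrict_space (coeff_measure d) K)"
    and bound: "poly_radon d f \<in> Lp R q" "Lp_norm R q (poly_radon d f) \<le> ennreal C * Lp_norm lebesgue p f"
  shows "(2 * a) ^ CARD('n) * (\<Prod>\<alpha>\<in>multiindices d. (2 * c \<alpha>) ^ CARD('m)) powr enn2real (inverse q)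
    \<le> max C 0 * ((2 * a) ^ CARD('n) * (2 * b) ^ CARD('m)) powr enn2real (inverse p)"
proof -
  let ?P = "Pi\<^sub>M (multiindices d) (\<lambda>_. lborel) :: (nat ^ 'n \<Rightarrow> real ^ 'm) measure"
  let ?E = "\<Prod>\<alpha>\<in>multiindices d. (2 * c \<alpha>) ^ CARD('m)"
  let ?x = "enn2real (inverse p)" and ?y = "enn2real (inverse q)"
  let ?V = "(2 * a) ^ CARD('n) * (2 * b) ^ CARD('m)"
  have E: "?E > 0" using c by (intro prod_pos) auto
  have Us: "U \<in> sets ?P" unfolding U_def by (intro sets_PiM_I_finite finite_multiindices) auto
  have "emeasure ?P U = (\<Prod>\<alpha>\<in>multiindices d. emeasure lborel (cube (c \<alpha>) :: (real ^ 'm) set))"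
    unfolding U_def by (intro product_sigma_finite.emeasure_PiM[OF product_sigma_finite_lborel finite_multiindices]) auto
  also have "\<dots> = (\<Prod>\<alpha>\<in>multiindices d. ennreal ((2 * c \<alpha>) ^ CARD('m)))"
    using c by (intro prod.cong refl emeasure_cube) (simp add: less_imp_le)
  also have "\<dots> = ennreal ?E" using c by (intro prod_ennreal) (simp add: less_imp_le)
  finally have eU: "emeasure ?P U = ennreal ?E" .
  have UR: "U \<in> sets R \<and> emeasure R U = ennreal ?E"
    using R
  proof
    assume "R = coeff_measure d"
    then show ?thesis using Us eU by (simp add: coeff_measure_def)
  next
    assume "\<exists>K. K \<in> sets ?P \<and> U \<subseteq> K \<and> R = restrict_space (coeff_measure d) K"
    then obtain K where K: "K \<in> sets ?P" "U \<subseteq> K" "R = restrict_space (coeff_measure d) K" by blast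
    have "K \<subseteq> space (coeff_measure d)" "K \<in> sets (coeff_measure d)"
      using K(1) sets.sets_into_space[OF K(1)] by (simp_all add: coeff_measure_def)
    then have Ks: "K \<inter> space (coeff_measure d) \<in> sets (coeff_measure d)" by (simp add: Int_absorb2)
    have "U \<in> sets (coeff_measure d)" using Us by (simp add: coeff_measure_def)
    then show ?thesis
      unfolding K(3) using K(2) eU Us by (simp add: emeasure_restrict_space[OF Ks] sets_restrict_space_iff[OF Ks])
        (simp add: coeff_measure_def)
  qed
  have val: "norm (poly_radon d f u) = (2 * a) ^ CARD('n)" if "u \<in> U" for u
  proof -
    have eq: "poly_radon d f u = complex_of_real ((2 * a) ^ CARD('n))"
      unfolding f_def using ab cb that by (intro poly_radon_box[where c = c]) (auto simp: U_def PiE_iff)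
    show ?thesis unfolding eq norm_of_real using ab by simp
  qed
  have "ennreal ((2 * a) ^ CARD('n) * ?E powr ?y) \<le> Lp_norm R q (poly_radon d f)"
    using bound(1) UR E val ab by (intro Lp_norm_lower_bound[OF q, where A = U]) (auto simp: Lp_def)
  also have "\<dots> \<le> ennreal C * Lp_norm lebesgue p f" by (rule bound(2))
  also have "\<dots> \<le> ennreal C * ennreal (?V powr ?x)"
    unfolding f_def by (intro mult_left_mono Lp_norm_box p ab) auto
  \<comment> \<open>A negative C acts as 0 after conversion to \<open>ennreal\<close>, hence the
    maximum.\<close>
  also have "\<dots> = ennreal (max C 0 * ?V powr ?x)"
    by (cases "C \<ge> 0") (auto simp: ennreal_mult ennreal_neg max_def)
  finally show ?thesis by (simp add: ennreal_le_iff)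
qed

text \<open>If s < r, the quotient a^(s-r) would be unbounded as a tends to 0. The contradiction
  comes at the a for which it equals K2 / K1 + 1; this a is at most 1.\<close>

lemma exponent_le:
  fixes s r K1 K2 :: real
  assumes "\<And>a. 0 < a \<Longrightarrow> a \<le> 1 \<Longrightarrow> K1 * a powr s \<le> K2 * a powr r" and K: "K1 > 0" "K2 \<ge> 0"
  shows "r \<le> s"
proof (rule ccontr)
  assume sr: "\<not> r \<le> s"
  define k where "k = K2 / K1 + 1"
  have k: "k \<ge> 1" using K by (simp add: k_def)
  define a where "a = k powr (1 / (s - r))"
  have "a > 0" using k by (simp add: a_def)
  have "a \<le> k powr 0" unfolding a_def using k sr by (intro powr_mono) (auto simp: divide_nonpos_neg)
  then have "a \<le> 1" using k by simp
  then have "K1 * a powr s \<le> K2 * a powr r" using assms(1) \<open>a > 0\<close> by blast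
  then have "K1 * (a powr s / a powr r) \<le> K2" using \<open>a > 0\<close> by (simp add: field_simps)
  moreover have "a powr s / a powr r = k"
  proof -
    have "a powr s / a powr r = a powr (s - r)" by (simp add: powr_diff)
    also have "\<dots> = k powr (1 / (s - r) * (s - r))" by (simp only: a_def powr_powr)
    also have "\<dots> = k" using k sr by simp
    finally show ?thesis .
  qed
  ultimately have "K1 * k \<le> K2" by simp
  moreover have "K1 * k = K2 + K1" using K by (simp add: k_def field_simps)
  ultimately show False using K by simp
qed

lemma exponent_eq:
  fixes s r K1 K2 :: real
  assumes *: "\<And>a. 0 < a \<Longrightarrow> K1 * a powr s \<le> K2 * a powr r" and K: "K1 > 0" "K2 \<ge> 0"
  shows "s = r"
proof (rule antisym)
  show "r \<le> s" using assms by (intro exponent_le[of K1 s K2 r]) auto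
  have "- r \<le> - s"
  proof (rule exponent_le[of K1 "- s" K2 "- r"])
    fix a :: real assume "0 < a" "a \<le> 1"
    then show "K1 * a powr - s \<le> K2 * a powr - r"
      using *[of "1 / a"] by (simp add: powr_divide powr_minus_divide)
  qed (use K in auto)
  then show "s \<le> r" by simp
qed

section \<open>Powers and degree sums occurring in the tests\<close>

lemma power_powr_eq: "b > 0 \<Longrightarrow> (b ^ k) powr y = b powr (real k * y)"
  by (simp add: powr_realpow[symmetric] powr_powr)

lemma prod_scaled_power:
  fixes \<beta> :: "'a \<Rightarrow> real"
  shows "(\<Prod>\<alpha>\<in>A. (2 * (\<beta> \<alpha> / real N)) ^ m) = ((2 / N) ^ card A * (\<Prod>\<alpha>\<in>A. \<beta> \<alpha>)) ^ m"
proof -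
  have "(\<Prod>\<alpha>\<in>A. (2 * (\<beta> \<alpha> / real N)) ^ m) = (\<Prod>\<alpha>\<in>A. (2 / N) * \<beta> \<alpha>) ^ m"
    by (simp add: prod_power_distrib)
  also have "(\<Prod>\<alpha>\<in>A. (2 / N) * \<beta> \<alpha>) = (2 / N) ^ card A * (\<Prod>\<alpha>\<in>A. \<beta> \<alpha>)"
    by (simp only: prod.distrib prod_constant)
  finally show ?thesis .
qed

text \<open>Truncated subtraction annihilates the terms with |\<alpha>| > j, which reduces the sum
  to multiindices of degree at most j.\<close>

lemma sum_codegree_multiindices_le:
  assumes "j \<le> d"
  shows "(real CARD('n) + 1) * (\<Sum>\<alpha>\<in>(multiindices d :: (nat ^ 'n::finite) set). j - (\<Sum>i\<in>UNIV. \<alpha> $ i)) = j * real ((CARD('n) + j) choose j)"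
proof -
  have "(\<Sum>\<alpha>\<in>(multiindices d :: (nat ^ 'n) set). j - (\<Sum>i\<in>UNIV. \<alpha> $ i)) = (\<Sum>\<alpha>\<in>(multiindices j :: (nat ^ 'n) set). j - (\<Sum>i\<in>UNIV. \<alpha> $ i))"
  proof (rule sum.mono_neutral_right)
    show "finite (multiindices d :: (nat ^ 'n) set)" by (rule finite_multiindices)
    show "(multiindices j :: (nat ^ 'n) set) \<subseteq> multiindices d" using assms by (auto simp: multiindices_def)
    show "\<forall>\<alpha>\<in>multiindices d - multiindices j. j - (\<Sum>i\<in>UNIV. (\<alpha> :: nat ^ 'n) $ i) = 0" by (simp add: multiindices_def)
  qed
  then have "(CARD('n) + 1) * (\<Sum>\<alpha>\<in>(multiindices d :: (nat ^ 'n) set). j - (\<Sum>i\<in>UNIV. \<alpha> $ i)) = j * ((CARD('n) + j) choose j)"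
    using sum_codegree_multiindices[of j, where 'n='n] by (simp only:)
  then have "real ((CARD('n) + 1) * (\<Sum>\<alpha>\<in>(multiindices d :: (nat ^ 'n) set). j - (\<Sum>i\<in>UNIV. \<alpha> $ i))) = real (j * ((CARD('n) + j) choose j))"
    by (rule arg_cong)
  then show ?thesis by (simp only: of_nat_mult of_nat_add of_nat_1)
qed

lemma sum_degree_multiindices:
  "(real CARD('n) + 1) * (\<Sum>\<alpha>\<in>(multiindices d :: (nat ^ 'n::finite) set). \<Sum>i\<in>UNIV. \<alpha> $ i) = CARD('n) * d * real ((CARD('n) + d) choose d)"
proof -
  let ?M = "multiindices d :: (nat ^ 'n) set"
  have *: "(c + 1) * s = (c + 1) * (b * e) - (c + 1) * r" if "r + s = b * e" for b c e r s :: real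
  proof -
    have "s = b * e - r" using that by simp
    then show ?thesis by (simp only: right_diff_distrib)
  qed
  have "(\<Sum>\<alpha>\<in>?M. d - (\<Sum>i\<in>UNIV. \<alpha> $ i)) + (\<Sum>\<alpha>\<in>?M. \<Sum>i\<in>UNIV. \<alpha> $ i) = (\<Sum>\<alpha>\<in>?M. d)"
  proof -
    have "(\<Sum>\<alpha>\<in>?M. (d - (\<Sum>i\<in>UNIV. \<alpha> $ i)) + (\<Sum>i\<in>UNIV. \<alpha> $ i)) = (\<Sum>\<alpha>\<in>?M. d)"
      by (rule sum.cong) (simp_all add: multiindices_def)
    then show ?thesis by (simp only: sum.distrib)
  qed
  also have "\<dots> = ((CARD('n) + d) choose d) * d" by (simp add: card_multiindices)
  finally have "real (\<Sum>\<alpha>\<in>?M. d - (\<Sum>i\<in>UNIV. \<alpha> $ i)) + real (\<Sum>\<alpha>\<in>?M. \<Sum>i\<in>UNIV. \<alpha> $ i) = real ((CARD('n) + d) choose d) * real d"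
    unfolding of_nat_add[symmetric] of_nat_mult[symmetric] by (simp only:)
  then have "(real CARD('n) + 1) * real (\<Sum>\<alpha>\<in>?M. \<Sum>i\<in>UNIV. \<alpha> $ i) = (real CARD('n) + 1) * (real ((CARD('n) + d) choose d) * real d) - (real CARD('n) + 1) * real (\<Sum>\<alpha>\<in>?M. d - (\<Sum>i\<in>UNIV. \<alpha> $ i))"
    by (rule *)
  also have "(real CARD('n) + 1) * real (\<Sum>\<alpha>\<in>?M. d - (\<Sum>i\<in>UNIV. \<alpha> $ i)) = d * real ((CARD('n) + d) choose d)"
    by (rule sum_codegree_multiindices_le) simp
  finally show ?thesis by (simp add: algebra_simps)
qed

text \<open>Up to a constant, coefficients of size b / a^|\<alpha>| are the largest that keep each
  term below b on \<open>cube a\<close>. Both sides of the test are powers of a and b, which range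
  over all positive numbers, so exponents must agree: b yields Ny = x, and a then determines
  x.\<close>

lemma maps_Lp_Lq_necessary:
  assumes p: "1 \<le> p" and q: "1 \<le> q" and maps: "maps_Lp_Lq TYPE('n::finite) TYPE('m::finite) d p q"
  shows "p = ennreal (1 + real CARD('m) * real d / (real CARD('n) + 1)) \<and> q = of_nat (card (multiindices d :: (nat ^ 'n) set)) * p"
proof -
  let ?M = "multiindices d :: (nat ^ 'n) set"
  define n where "n = CARD('n)"
  define m where "m = CARD('m)"
  define N where "N = card ?M"
  define D where "D = (\<Sum>\<alpha>\<in>?M. \<Sum>i\<in>UNIV. \<alpha> $ i)"
  define x where "x = enn2real (inverse p)"
  define y where "y = enn2real (inverse q)"
  define k where "k = (2 / real N) ^ N"
  have n: "n > 0" and m: "m > 0" by (simp_all add: n_def m_def)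
  have N: "N > 0" by (simp add: N_def card_multiindices)
  then have k: "k > 0" by (simp add: k_def)
  obtain C where C: "\<And>f. f \<in> Lp (lebesgue :: ((real ^ 'n) \<times> (real ^ 'm)) measure) p \<Longrightarrow>
      poly_radon d f \<in> Lp (coeff_measure d) q \<and> Lp_norm (coeff_measure d) q (poly_radon d f) \<le> ennreal C * Lp_norm lebesgue p f"
    using maps unfolding maps_Lp_Lq_def by blast
  define C' where "C' = max C 0"
  have C': "C' \<ge> 0" by (simp add: C'_def)
  have test: "(2 * a) ^ n * ((k * (b ^ N / a ^ D)) ^ m) powr y \<le> C' * ((2 * a) ^ n * (2 * b) ^ m) powr x"
    if a: "a > 0" and b: "b > 0" for a b :: real
  proof -
    let ?f = "\<lambda>z. indicator (cube a \<times> cube b :: ((real ^ 'n) \<times> (real ^ 'm)) set) z :: complex"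
    let ?\<beta> = "\<lambda>\<alpha> :: nat ^ 'n. b / a ^ (\<Sum>i\<in>UNIV. \<alpha> $ i)"
    have f: "?f \<in> Lp lebesgue p" by (rule Lp_norm_box(1)[OF p a b])
    have "(2 * a) ^ CARD('n) * (\<Prod>\<alpha>\<in>?M. (2 * (?\<beta> \<alpha> / real N)) ^ CARD('m)) powr enn2real (inverse q)
      \<le> max C 0 * ((2 * a) ^ CARD('n) * (2 * b) ^ CARD('m)) powr enn2real (inverse p)"
      using a b N C[OF f] by (intro box_test[OF p q, where R = "coeff_measure d" and c = "\<lambda>\<alpha>. ?\<beta> \<alpha> / real N" and d = d]) (auto simp: N_def[symmetric])
    moreover have "(\<Prod>\<alpha>\<in>?M. ?\<beta> \<alpha>) = b ^ N / a ^ D"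
      by (simp add: prod_dividef N_def D_def power_sum)
    ultimately show ?thesis
      unfolding prod_scaled_power by (simp add: n_def m_def x_def y_def C'_def k_def N_def)
  qed
  have "N * m * y = m * x"
  proof (rule exponent_eq)
    fix b :: real assume b: "b > 0"
    have "(2 ^ n * (k ^ m) powr y) * b powr (N * m * y) = (2 * 1) ^ n * ((k * (b ^ N / 1 ^ D)) ^ m) powr y"
      using b by (simp add: power_mult_distrib powr_mult power_mult[symmetric] power_powr_eq)
    also have "\<dots> \<le> C' * ((2 * 1) ^ n * (2 * b) ^ m) powr x" by (rule test) (use b in auto)
    also have "\<dots> = (C' * (2 ^ n * 2 ^ m) powr x) * b powr (m * x)"
      using b by (simp add: power_mult_distrib powr_mult power_powr_eq)
    finally show "(2 ^ n * (k ^ m) powr y) * b powr (N * m * y) \<le> (C' * (2 ^ n * 2 ^ m) powr x) * b powr (m * x)" .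
  qed (use k C' in auto)
  then have Ny: "N * y = x" using m by (simp add: mult_ac)
  \<comment> \<open>D is the sum of all degrees; it arises from the product of the factors
    a^(-|\<alpha>|) over the coefficients.\<close>
  have "n - D * m * y = n * x"
  proof (rule exponent_eq)
    fix a :: real assume a: "a > 0"
    have "(2 ^ n * (k ^ m) powr y) * a powr (n - D * m * y) = (2 * a) ^ n * ((k * (1 ^ N / a ^ D)) ^ m) powr y"
      using a by (simp add: power_mult_distrib powr_mult power_mult[symmetric] power_powr_eq power_divide powr_divide powr_diff powr_realpow)
    also have "\<dots> \<le> C' * ((2 * a) ^ n * (2 * 1) ^ m) powr x" by (rule test) (use a in auto)
    also have "\<dots> = (C' * (2 ^ n * 2 ^ m) powr x) * a powr (n * x)"
      using a by (simp add: power_mult_distrib powr_mult power_powr_eq mult_ac)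
    finally show "(2 ^ n * (k ^ m) powr y) * a powr (n - D * m * y) \<le> (C' * (2 ^ n * 2 ^ m) powr x) * a powr (n * x)" .
  qed (use k C' in auto)
  then have "(real n + 1) * (n - D * m * y) = (real n + 1) * (n * x)" by (simp only:)
  then have "(real n + 1) * n - ((real n + 1) * D) * m * y = (real n + 1) * (n * x)" by (simp add: right_diff_distrib mult.assoc)
  moreover have D: "(real n + 1) * D = n * d * real N"
    using sum_degree_multiindices[of d, where 'n='n] by (simp add: n_def D_def N_def card_multiindices)
  ultimately have "(real n + 1) * n - (n * d * real N) * m * y = (real n + 1) * (n * x)"
    by (simp only:)
  then have "real n * (real n + 1) = real n * (x * (real n + 1 + real m * d))"
    unfolding Ny[symmetric] by (simp add: algebra_simps)
  then have "real n + 1 = x * (real n + 1 + real m * d)" using n by simp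
  moreover have "real n + 1 + real m * d > 0" using n by (intro add_pos_nonneg) auto
  ultimately have x: "x = (real n + 1) / (real n + 1 + real m * d)"
    by (metis less_irrefl nonzero_eq_divide_eq)
  define r where "r = 1 + real m * real d / (real n + 1)"
  have "r > 0" by (simp add: r_def add_pos_nonneg)
  have xr: "x = 1 / r" unfolding x r_def by (simp add: field_simps)
  have x0: "x > 0" using \<open>r > 0\<close> by (simp add: xr)
  have y: "y = 1 / (N * r)" using Ny N \<open>r > 0\<close> by (simp add: xr field_simps)
  have p': "p = ennreal r"
  proof (cases rule: ennreal_ge_1_cases[OF p])
    case 1
    then show ?thesis using x0 by (simp add: x_def)
  next
    case (2 s)
    then have "1 / s = 1 / r" using xr by (simp add: x_def)
    then show ?thesis using 2 by simp
  qed
  have "q = ennreal (N * r)"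
  proof (cases rule: ennreal_ge_1_cases[OF q])
    case 1
    then show ?thesis using y N \<open>r > 0\<close> by (simp add: y_def)
  next
    case (2 s)
    then have "1 / s = 1 / (N * r)" using y by (simp add: y_def)
    then show ?thesis using 2 by simp
  qed
  then have "q = of_nat N * p"
    unfolding p' using \<open>r > 0\<close> by (simp add: ennreal_of_nat_eq_real_of_nat ennreal_mult)
  then show ?thesis using p' by (simp add: r_def m_def n_def N_def)
qed

text \<open>Only a, b \<le> 1 are at hand, so the tests yield inequalities. The first one varies b
  alone. The one of index j uses height a^j over \<open>cube a\<close>, which permits coefficients
  of size a^(j - |\<alpha>|) for |\<alpha>| < j; beyond that K' limits them to size 1. For j \<ge> 1
  equality in it describes the line through the critical points j - 1 and j.\<close>

lemma maps_Lpcomp_Lqloc_necessary: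
  fixes x y :: real
  assumes p: "1 \<le> p" and q: "1 \<le> q" and maps: "maps_Lpcomp_Lqloc TYPE('n::finite) TYPE('m::finite) d p q"
  defines "x \<equiv> enn2real (inverse p)" and "y \<equiv> enn2real (inverse q)"
  shows "x \<le> real ((CARD('n) + d) choose d) * y"
    and "\<And>j. j \<le> d \<Longrightarrow> (CARD('n) + CARD('m) * real j) * x \<le> CARD('n) + CARD('m) * y * (j * real ((CARD('n) + j) choose j) / (real CARD('n) + 1))"
proof -
  let ?M = "multiindices d :: (nat ^ 'n) set"
  let ?P = "Pi\<^sub>M (multiindices d) (\<lambda>_. lborel) :: (nat ^ 'n \<Rightarrow> real ^ 'm) measure"
  define n where "n = CARD('n)"
  define m where "m = CARD('m)"
  define N where "N = card ?M"
  define k where "k = (2 / real N) ^ N"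
  have n: "n > 0" and m: "m > 0" by (simp_all add: n_def m_def)
  have N: "N > 0" by (simp add: N_def card_multiindices)
  then have k: "k > 0" by (simp add: k_def)
  define K :: "((real ^ 'n) \<times> (real ^ 'm)) set" where "K = cube 1 \<times> cube 1"
  define K' :: "(nat ^ 'n \<Rightarrow> real ^ 'm) set" where "K' = Pi\<^sub>E ?M (\<lambda>_. cube 1)"
  have "compact K" unfolding K_def by (intro compact_Times compact_cube)
  moreover have "compactin (coeff_topology d) K'"
    unfolding K'_def coeff_topology_def compactin_PiE by (simp add: compact_cube)
  ultimately obtain C where C: "\<And>f. f \<in> Lp (lebesgue :: ((real ^ 'n) \<times> (real ^ 'm)) measure) p \<Longrightarrow> (AE z in lebesgue. z \<notin> K \<longrightarrow> f z = 0) \<Longrightarrow>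
      poly_radon d f \<in> Lp (restrict_space (coeff_measure d) K') q \<and> Lp_norm (restrict_space (coeff_measure d) K') q (poly_radon d f) \<le> ennreal C * Lp_norm lebesgue p f"
    using maps unfolding maps_Lpcomp_Lqloc_def by meson
  define C' where "C' = max C 0"
  have C': "C' \<ge> 0" by (simp add: C'_def)
  have Ks: "K' \<in> sets ?P" unfolding K'_def by (intro sets_PiM_I_finite finite_multiindices) auto
  have test: "(2 * a) ^ n * ((k * (\<Prod>\<alpha>\<in>?M. \<beta> \<alpha>)) ^ m) powr y \<le> C' * ((2 * a) ^ n * (2 * b) ^ m) powr x"
    if a: "0 < a" "a \<le> 1" and b: "0 < b" "b \<le> 1" and \<beta>: "\<And>\<alpha>. 0 < \<beta> \<alpha> \<and> \<beta> \<alpha> \<le> 1 \<and> \<beta> \<alpha> * a ^ (\<Sum>i\<in>UNIV. \<alpha> $ i) \<le> b"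
    for a b :: real and \<beta> :: "nat ^ 'n \<Rightarrow> real"
  proof -
    let ?f = "\<lambda>z. indicator (cube a \<times> cube b :: ((real ^ 'n) \<times> (real ^ 'm)) set) z :: complex"
    have f: "?f \<in> Lp lebesgue p" by (rule Lp_norm_box(1)[OF p a(1) b(1)])
    have "cube a \<times> cube b \<subseteq> K" using a b by (auto simp: K_def cube_def intro: order.trans)
    then have supp: "AE z in lebesgue. z \<notin> K \<longrightarrow> ?f z = 0" by (intro AE_I2) (auto simp: indicator_def)
    have b1: "\<beta> \<alpha> / N \<le> 1" for \<alpha>
    proof -
      have "\<beta> \<alpha> \<le> 1" "1 \<le> real N" using \<beta>[of \<alpha>] N by auto
      then show ?thesis using N by (simp add: divide_le_eq)
    qed
    have "(2 * a) ^ CARD('n) * (\<Prod>\<alpha>\<in>?M. (2 * (\<beta> \<alpha> / real N)) ^ CARD('m)) powr enn2real (inverse q)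
      \<le> max C 0 * ((2 * a) ^ CARD('n) * (2 * b) ^ CARD('m)) powr enn2real (inverse p)"
    proof (rule box_test[OF p q a(1) b(1), where R = "restrict_space (coeff_measure d) K'" and c = "\<lambda>\<alpha>. \<beta> \<alpha> / real N" and d = d])
      show "restrict_space (coeff_measure d) K' = coeff_measure d \<or>
        (\<exists>K. K \<in> sets ?P \<and> (\<Pi>\<^sub>E \<alpha>\<in>?M. cube (\<beta> \<alpha> / real N)) \<subseteq> K \<and> restrict_space (coeff_measure d) K' = restrict_space (coeff_measure d) K)"
      proof (intro disjI2 exI[of _ K'] conjI Ks refl)
        show "(\<Pi>\<^sub>E \<alpha>\<in>?M. cube (\<beta> \<alpha> / real N)) \<subseteq> K'"
          unfolding K'_def using b1 by (intro PiE_mono) (auto simp: cube_def intro: order.trans)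
      qed
    next
      fix \<alpha> :: "nat ^ 'n"
      show "\<beta> \<alpha> / real N > 0" using \<beta>[of \<alpha>] N by simp
      show "\<beta> \<alpha> / real N * a ^ (\<Sum>j\<in>UNIV. \<alpha> $ j) * card ?M \<le> b" using \<beta>[of \<alpha>] N by (simp add: N_def[symmetric])
    qed (use C[OF f supp] in auto)
    then show ?thesis
      unfolding prod_scaled_power by (simp add: n_def m_def x_def y_def C'_def k_def N_def)
  qed
  have "m * x \<le> N * m * y"
  proof (rule exponent_le)
    fix b :: real assume b: "b > 0" "b \<le> 1"
    have "(2 ^ n * (k ^ m) powr y) * b powr (N * m * y) = (2 * 1) ^ n * ((k * (\<Prod>\<alpha>\<in>?M. b)) ^ m) powr y"
      using b by (simp add: power_mult_distrib powr_mult power_mult[symmetric] power_powr_eq N_def[symmetric])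
    also have "\<dots> \<le> C' * ((2 * 1) ^ n * (2 * b) ^ m) powr x" by (rule test) (use b in auto)
    also have "\<dots> = (C' * (2 ^ n * 2 ^ m) powr x) * b powr (m * x)"
      using b by (simp add: power_mult_distrib powr_mult power_powr_eq)
    finally show "(2 ^ n * (k ^ m) powr y) * b powr (N * m * y) \<le> (C' * (2 ^ n * 2 ^ m) powr x) * b powr (m * x)" .
  qed (use k C' in auto)
  then have "m * x \<le> m * (N * y)" by (simp add: mult_ac)
  then show "x \<le> real ((CARD('n) + d) choose d) * y" using m by (simp add: N_def card_multiindices)
  fix j assume j: "j \<le> d"
  define S where "S = (\<Sum>\<alpha>\<in>?M. j - (\<Sum>i\<in>UNIV. \<alpha> $ i))"
  have "(n + j * m) * x \<le> n + S * m * y"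
  proof (rule exponent_le)
    fix a :: real assume a: "a > 0" "a \<le> 1"
    \<comment> \<open>Truncated subtraction gives size 1 once |\<alpha>| reaches j.\<close>
    let ?\<beta> = "\<lambda>\<alpha> :: nat ^ 'n. a ^ (j - (\<Sum>i\<in>UNIV. \<alpha> $ i))"
    have \<beta>: "0 < ?\<beta> \<alpha> \<and> ?\<beta> \<alpha> \<le> 1 \<and> ?\<beta> \<alpha> * a ^ (\<Sum>i\<in>UNIV. \<alpha> $ i) \<le> a ^ j" for \<alpha>
      using a unfolding power_add[symmetric] by (auto intro!: power_le_one power_decreasing)
    have "(2 ^ n * (k ^ m) powr y) * a powr (n + S * m * y) = (2 * a) ^ n * ((k * a ^ S) ^ m) powr y"
      using a by (simp add: power_mult_distrib powr_mult power_mult[symmetric] power_powr_eq powr_add powr_realpow)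
    also have "a ^ S = (\<Prod>\<alpha>\<in>?M. ?\<beta> \<alpha>)" by (simp add: S_def power_sum)
    also have "(2 * a) ^ n * ((k * (\<Prod>\<alpha>\<in>?M. ?\<beta> \<alpha>)) ^ m) powr y \<le> C' * ((2 * a) ^ n * (2 * a ^ j) ^ m) powr x"
      by (rule test[OF _ _ _ _ \<beta>]) (use a in \<open>auto intro: power_le_one\<close>)
    also have "\<dots> = (C' * (2 ^ n * 2 ^ m) powr x) * a powr ((n + j * m) * x)"
    proof -
      have e: "(n + j * m) * x = n * x + (j * m) * x" by (simp add: algebra_simps)
      show ?thesis
        unfolding e powr_add using a by (simp add: power_mult_distrib powr_mult power_mult[symmetric] power_powr_eq mult_ac)
    qed
    finally show "(2 ^ n * (k ^ m) powr y) * a powr (n + S * m * y) \<le> (C' * (2 ^ n * 2 ^ m) powr x) * a powr ((n + j * m) * x)" .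
  qed (use k C' in auto)
  moreover have "real S = j * real ((CARD('n) + j) choose j) / (real CARD('n) + 1)"
    using sum_codegree_multiindices_le[OF j, where 'n='n] by (simp add: S_def field_simps)
  ultimately show "(CARD('n) + CARD('m) * real j) * x \<le> CARD('n) + CARD('m) * y * (j * real ((CARD('n) + j) choose j) / (real CARD('n) + 1))"
    by (simp add: n_def m_def mult_ac)
qed


text \<open>As (x, 1) is in the hull, a hull point (x, y0) with y0 \<le> y suffices. Such points are
  found on the chain from (0, 0) through the critical points d, ..., 1 to (1, 1), which acts as
  critical point 0. Each inequality describes the line through one edge: \<open>height\<close> the
  edge at the origin, the j-th of \<open>edges\<close> the one between the points j and j -
  1.\<close>

lemma in_hull_if_inequalities:
  fixes x y :: real
  assumes n: "n \<ge> 1" and m: "m \<ge> 1" and d: "d \<ge> 1" and x: "0 \<le> x" "x \<le> 1" and y: "y \<le> 1"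
    and height: "x \<le> real ((n + d) choose d) * y"
    and edges: "\<And>j. j \<in> {1..d} \<Longrightarrow> (n + m * real j) * x \<le> n + m * y * (j * real ((n + j) choose j) / (real n + 1))"
  shows "(x, y) \<in> convex hull ({(0, 0), (1, 1), (0, 1)} \<union> critical_point n m ` {1..d})"
proof -
  let ?S = "{(0, 0), (1, 1), (0, 1)} \<union> critical_point n m ` {1..d}"
  define X where "X j = (real n + 1) / (real n + real m * real j + 1)" for j :: nat
  define B where "B j = real ((n + j) choose j)" for j
  define Y where "Y j = X j / B j" for j
  have den: "real n + real m * real j + 1 > 0" for j by (simp add: add_nonneg_pos)
  have B: "B j > 0" for j by (simp add: B_def)
  have X: "X j > 0" for j using den[of j] by (simp add: X_def)
  have X0: "X 0 = 1" "Y 0 = 1" by (simp_all add: X_def Y_def B_def add_nonneg_pos)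
  have cp: "critical_point n m j = (X j, Y j)" for j
    by (simp add: critical_point_def Let_def X_def Y_def B_def field_simps)
  have conv: "convex (convex hull ?S)" by (rule convex_convex_hull)
  have seg: "((1 - s) * a + s * c, (1 - s) * b + s * e) \<in> convex hull ?S"
    if "(a, b) \<in> convex hull ?S" "(c, e) \<in> convex hull ?S" "0 \<le> s" "s \<le> 1" for a b c e s :: real
    using convexD_alt[OF conv that] by simp
  have inc: "z \<in> convex hull ?S" if "z \<in> ?S" for z using that by (rule hull_inc)
  have top: "(x, 1) \<in> convex hull ?S"
    using seg[OF inc inc, of 0 1 1 1 x] x by simp
  have up: "(x, y) \<in> convex hull ?S" if lo: "(x, y0) \<in> convex hull ?S" and y0: "y0 \<le> y" for y0
  proof (cases "y0 = 1")
    case True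
    then show ?thesis using top y y0 by simp
  next
    case False
    define s where "s = (y - y0) / (1 - y0)"
    have lt: "y0 < 1" using False y y0 by simp
    then have s: "0 \<le> s" "s \<le> 1" using y y0 by (simp_all add: s_def divide_le_eq)
    have "(1 - s) * x + s * x = x" by (simp add: algebra_simps)
    moreover have "(1 - s) * y0 + s * 1 = y"
    proof -
      have "(1 - s) * y0 + s * 1 = y0 + s * (1 - y0)" by (simp add: algebra_simps)
      also have "\<dots> = y" using lt by (simp add: s_def)
      finally show ?thesis .
    qed
    ultimately show ?thesis using seg[OF lo top s] by simp
  qed
  have crit: "(X j, Y j) \<in> convex hull ?S" if "j \<le> d" for j
  proof (cases "j = 0")
    case True
    then show ?thesis using inc[of "(1, 1)"] by (simp add: X0)
  next
    case False
    then show ?thesis using that cp[of j] by (intro inc) (force intro!: image_eqI[of _ _ j])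
  qed
  show ?thesis
  proof (cases "x \<le> X d")
    case True
    define s where "s = x / X d"
    have s: "0 \<le> s" "s \<le> 1" using True x X[of d] by (simp_all add: s_def)
    have "(s * X d, s * Y d) \<in> convex hull ?S"
      using seg[OF inc crit[OF order.refl], of 0 0 s] s by simp
    moreover have "s * X d = x" "s * Y d = x / B d" using X[of d] by (simp_all add: s_def Y_def)
    moreover have "x / B d \<le> y" using height B[of d] by (simp add: B_def divide_le_eq mult.commute)
    ultimately show ?thesis using up by simp
  next
    case False
    \<comment> \<open>Its predecessor, if there is one, satisfies X (j - 1) > x, so x lies over the
      edge between the points j and j - 1.\<close>
    define j where "j = (LEAST j. X j \<le> x)"
    have Xj: "X j \<le> x" unfolding j_def by (rule LeastI[of _ d]) (use False in simp)
    have jd: "j \<le> d" unfolding j_def by (rule Least_le) (use False in simp)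
    show ?thesis
    \<comment> \<open>For j = 0 one has x = 1, and the inequality of index 1 forces y \<ge>
      1.\<close>
    proof (cases "j = 0")
      case True
      then have "x = 1" using Xj x X0 by simp
      then have e1: "y \<ge> 1"
      proof -
        have "(n + m * real 1) * x \<le> n + m * y * (1 * real ((n + 1) choose 1) / (real n + 1))" using edges[of 1] d by simp
        then have "real m * 1 \<le> real m * y" using \<open>x = 1\<close> by (simp add: field_simps)
        then show ?thesis using m by (simp add: mult_le_cancel_left)
      qed
      then show ?thesis using y \<open>x = 1\<close> inc[of "(1, 1)"] by simp
    next
      case j0: False
      define i where "i = j - 1"
      have ij: "j = Suc i" using j0 by (simp add: i_def)
      have Xi: "x < X i" using not_less_Least[of i "\<lambda>j. X j \<le> x"] ij by (simp add: j_def[symmetric])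
      define s where "s = (x - X j) / (X i - X j)"
      have s: "0 \<le> s" "s \<le> 1" using Xi Xj by (simp_all add: s_def divide_le_eq)
      define y0 where "y0 = (1 - s) * Y j + s * Y i"
      have sx: "(1 - s) * X j + s * X i = x"
      proof -
        have "(1 - s) * X j + s * X i = X j + s * (X i - X j)" by (simp add: algebra_simps)
        also have "\<dots> = x" using Xi Xj by (simp add: s_def)
        finally show ?thesis .
      qed
      have lo: "(x, y0) \<in> convex hull ?S"
      proof -
        have id: "i \<le> d" using jd ij by simp
        show ?thesis using seg[OF crit[OF jd] crit[OF id] s] unfolding sx y0_def[symmetric] .
      qed
      define S where "S = j * B j / (real n + 1)"
      have S: "S > 0" using ij B[of j] by (simp add: S_def)
      \<comment> \<open>The slack of the j-th inequality. It is affine and vanishes at both end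
        points of the edge, hence at (x, y0).\<close>
      define l where "l a b = n + m * b * S - (n + m * real j) * a" for a b :: real
      have lj: "l (X j) (Y j) = 0"
      proof -
        have "real m * Y j * S = real m * real j * X j / (real n + 1)" using B[of j] by (simp add: Y_def S_def)
        moreover have "n + real m * real j * X j / (real n + 1) = (n + m * real j) * X j"
          using den[of j] by (simp add: X_def divide_simps) (simp add: algebra_simps)
        ultimately show ?thesis by (simp add: l_def)
      qed
      have li: "l (X i) (Y i) = 0"
      proof -
        have "Suc i * ((n + Suc i) choose Suc i) = Suc (n + i) * ((n + i) choose i)"
          using Suc_times_binomial[of i "n + i"] by simp
        then have "real (Suc i * ((n + Suc i) choose Suc i)) = real (Suc (n + i) * ((n + i) choose i))" by (rule arg_cong)
        \<comment> \<open>The absorption identity j B_j = (n + j) B_(j-1) is the reason why the line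
          of index j also passes through the point j - 1.\<close>
        then have BB: "real j * B j = (real n + real j) * B i" unfolding B_def ij of_nat_mult by simp
        have "real m * Y i * S = real m * (real n + real j) * X i / (real n + 1)"
          using B[of i] unfolding S_def BB by (simp add: Y_def)
        moreover have "n + real m * (real n + real j) * X i / (real n + 1) = (n + m * real j) * X i"
          using den[of i] by (simp add: X_def ij divide_simps) (simp add: algebra_simps)
        ultimately show ?thesis by (simp add: l_def)
      qed
      have "l x y0 = (1 - s) * l (X j) (Y j) + s * l (X i) (Y i)"
        unfolding sx[symmetric] y0_def l_def by (simp add: algebra_simps)
      then have "l x y0 = 0" by (simp add: lj li)
      moreover have "l x y \<ge> 0" using edges[of j] jd ij by (simp add: l_def S_def B_def)
      ultimately have "m * y0 * S \<le> m * y * S" by (simp add: l_def)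
      then have "y0 \<le> y" using S m by (simp add: mult_le_cancel_right)
      then show ?thesis using up[OF lo] by simp
    qed
  qed
qed

theorem theorem1:
  fixes d :: nat and p q :: ennreal
  assumes "1 \<le> d" and "1 \<le> p" and "1 \<le> q"
  shows "card (multiindices d :: (nat ^ 'n::finite) set) = (CARD('n) + d) choose d
       \<and> real ((CARD('n) + d) choose d) = fact (CARD('n) + d) / (fact (CARD('n)) * fact d)
       \<and> (maps_Lp_Lq TYPE('n) TYPE('m::finite) d p q \<longleftrightarrow>
            p = ennreal (1 + real CARD('m) * real d / (real CARD('n) + 1)) \<and>
            q = of_nat (card (multiindices d :: (nat ^ 'n) set)) * p)
       \<and> (maps_Lpcomp_Lqloc TYPE('n) TYPE('m) d p q \<longleftrightarrow>
            (enn2real (inverse p), enn2real (inverse q)) \<in>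
              closure (convex hull
                ({(0, 0), (1, 1), (0, 1)} \<union> critical_point CARD('n) CARD('m) ` {1..d})))"
proof (intro conjI)
  show "card (multiindices d :: (nat ^ 'n) set) = (CARD('n) + d) choose d"
    by (rule card_multiindices)
  show "real ((CARD('n) + d) choose d) = fact (CARD('n) + d) / (fact (CARD('n)) * fact d)"
    using binomial_fact[of d "CARD('n) + d", where 'a = real] by (simp add: mult.commute)
  show "maps_Lp_Lq TYPE('n) TYPE('m) d p q \<longleftrightarrow>
            p = ennreal (1 + real CARD('m) * real d / (real CARD('n) + 1)) \<and>
            q = of_nat (card (multiindices d :: (nat ^ 'n) set)) * p"
    using maps_Lp_Lq_necessary[OF assms(2,3)] maps_Lp_Lq_sufficient[OF assms(1)] by blast
  let ?S = "{(0, 0), (1, 1), (0, 1)} \<union> critical_point CARD('n) CARD('m) ` {1..d}"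
  show "maps_Lpcomp_Lqloc TYPE('n) TYPE('m) d p q \<longleftrightarrow>
            (enn2real (inverse p), enn2real (inverse q)) \<in> closure (convex hull ?S)"
  proof
    assume maps: "maps_Lpcomp_Lqloc TYPE('n) TYPE('m) d p q"
    have bounds: "0 \<le> enn2real (inverse r) \<and> enn2real (inverse r) \<le> 1" if "1 \<le> r" for r :: ennreal
      by (cases rule: ennreal_ge_1_cases[OF that]) auto
    have "(enn2real (inverse p), enn2real (inverse q)) \<in> convex hull ?S"
      using maps_Lpcomp_Lqloc_necessary[OF assms(2,3) maps] bounds[OF assms(2)] bounds[OF assms(3)] assms(1)
      by (intro in_hull_if_inequalities) (auto simp: Suc_le_eq)
    then show "(enn2real (inverse p), enn2real (inverse q)) \<in> closure (convex hull ?S)"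
      using closure_subset by blast
  next
    assume "(enn2real (inverse p), enn2real (inverse q)) \<in> closure (convex hull ?S)"
    then show "maps_Lpcomp_Lqloc TYPE('n) TYPE('m) d p q"
      by (rule maps_Lpcomp_Lqloc_sufficient[OF assms(2,3)])
  qed
qed

end
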